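(* Assume $Q'_1(\varphi,\varphi)\ge0$ for all $\varphi\in\mathcal F_1^0$. Consider the affine isometric action of $G$ on $\mathcal H'_1$ given by $A(g)v=\pi_1(g)v+[c(g)]$. Then for every $w\in\mathcal H'_1$ the closed linear span of $\{[c(g)]+w-\pi_1(g)w : g\in G\}$ equals $\mathcal H'_1$. Consequently the affine action is irreducible (the only nonempty closed $G$-invariant affine subspace of $\mathcal H'_1$ is $\mathcal H'_1$ itself), and, since $\mathcal H'_1$ has no nonzero $\pi_1$-invariant vectors, its affine commutant is trivial.
   Context: Let $(X,d)$ be a proper geodesic CAT(-1) space, $\partial X$ its Gromov boundary, $\overline X=X\cup\partial X$. $\langle y,z\rangle_x=\frac12(d(y,x)+d(z,x)-d(y,z))$ is the Gromov product (extended continuously to $\overline X$), $b_\xi(x,y)=\lim_{t\to\infty}(d(x,\xi_t)-d(y,\xi_t))$ the Busemann cocycle. Let $G$ be a discrete, non-elementary, convex-cocompact group of isometries of $X$ (acting cocompactly on $\mathcal Q(\Lambda(G))$, the union of geodesics with both endpoints in the limit set $\Lambda(G)$), $\delta\in(0,\infty)$ its critical exponent, $(\mu_x)_{x\in X}$ its Patterson–Sullivan density (probability measures on $\partial X$ supported on $\Lambda(G)$, $g_*\mu_x=\mu_{g.x}$, $\frac{d\mu_x}{d\mu_y}(\xi)=e^{-\delta b_\xi(x,y)}$). Fix $o\in\mathcal Q(\Lambda(G))$. $\pi_1(g)\varphi(\xi)=e^{-\delta b_\xi(g.o,o)}\varphi(g^{-1}\xi)$. $\mathcal F_1^0=\{\varphi\in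 C(\partial X):\int\varphi\,d\mu_o=0\}$, $Q'_1(\varphi,\psi)=\int\!\!\int\varphi(\xi)\overline{\psi(\eta)}\langle\xi,\eta\rangle_o\,d\mu_o(\xi)d\mu_o(\eta)$. When $Q'_1\ge0$, $\mathcal H'_1$ is the Hilbert completion of $\mathcal F_1^0$ modulo null vectors with inner product $Q'_1$, carrying the unitary extension of $\pi_1$; $[\varphi]$ is the class of $\varphi$. $c(x,y)(\xi)=e^{-\delta b_\xi(x,o)}-e^{-\delta b_\xi(y,o)}$ (density of $\mu_x-\mu_y$ w.r.t. $\mu_o$), $c(g)=c(o,g.o)$, a 1-cocycle: $c(gh)=c(g)+\pi_1(g)c(h)$. The affine commutant of an affine isometric action is the set of continuous affine maps of the Hilbert space commuting with all the $A(g)$. *)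

theory Defs
  imports "HOL-Probability.Probability"
begin

definition geodesic_seg :: "(real \<Rightarrow> 'a::metric_space) \<Rightarrow> 'a \<Rightarrow> 'a \<Rightarrow> bool" where
  "geodesic_seg \<gamma> x y \<longleftrightarrow> \<gamma> 0 = x \<and> \<gamma> (dist x y) = y \<and>
     (\<forall>s\<in>{0..dist x y}. \<forall>t\<in>{0..dist x y}. dist (\<gamma> s) (\<gamma> t) = \<bar>s - t\<bar>)"

text \<open>Proper geodesic CAT(-1) space (the whole type is the space X). The CAT(-1)
  comparison is the vertex-to-opposite-side comparison with the hyperbolic plane,
  written with the hyperbolic Stewart formula for the comparison distance.\<close>
definition proper_geodesic_CAT_m1 :: "'a::metric_space itself \<Rightarrow> bool" where
  "proper_geodesic_CAT_m1 _ \<longleftrightarrow>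
     (\<forall>x::'a. \<forall>r. compact (cball x r)) \<and>
     (\<forall>x y::'a. \<exists>\<gamma>. geodesic_seg \<gamma> x y) \<and>
     (\<forall>x y z::'a. \<forall>\<gamma> s. geodesic_seg \<gamma> y z \<and> 0 < dist y z \<and> 0 \<le> s \<and> s \<le> dist y z \<longrightarrow>
        cosh (dist x (\<gamma> s)) * sinh (dist y z)
          \<le> cosh (dist x y) * sinh (dist y z - s) + cosh (dist x z) * sinh s)"

definition bd_rays :: "'a::metric_space \<Rightarrow> (real \<Rightarrow> 'a) set" where
  "bd_rays x0 = {\<xi>. \<xi> 0 = x0 \<and> (\<forall>s\<ge>0. \<forall>t\<ge>0. dist (\<xi> s) (\<xi> t) = \<bar>s - t\<bar>) \<and> (\<forall>t<0. \<xi> t = x0)}"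

definition bd_act :: "'a::metric_space \<Rightarrow> ('a \<Rightarrow> 'a) \<Rightarrow> (real \<Rightarrow> 'a) \<Rightarrow> (real \<Rightarrow> 'a)" where
  "bd_act x0 g \<xi> = (THE \<eta>. \<eta> \<in> bd_rays x0 \<and> bdd_above ((\<lambda>t. dist (\<eta> t) (g (\<xi> t))) ` {0..}))"

definition busemann :: "(real \<Rightarrow> 'a::metric_space) \<Rightarrow> 'a \<Rightarrow> 'a \<Rightarrow> real" where
  "busemann \<xi> x y = Lim at_top (\<lambda>t. dist x (\<xi> t) - dist y (\<xi> t))"

definition gromov_pb :: "'a::metric_space \<Rightarrow> 'a \<Rightarrow> (real \<Rightarrow> 'a) \<Rightarrow> ereal" where
  "gromov_pb x0 x \<xi> = (SUP t\<in>{0..}. ereal ((dist x x0 + t - dist x (\<xi> t)) / 2))"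

text \<open>Gromov product <xi,eta>_{x0} of two boundary points (rays from x0); it is +infinity
  exactly on the diagonal (a null set), where we take the value 0.\<close>
definition gromov_bb :: "(real \<Rightarrow> 'a::metric_space) \<Rightarrow> (real \<Rightarrow> 'a) \<Rightarrow> real" where
  "gromov_bb \<xi> \<eta> = real_of_ereal (SUP t\<in>{0..}. ereal (t - dist (\<xi> t) (\<eta> t) / 2))"

definition isom_group :: "('a::metric_space \<Rightarrow> 'a) set \<Rightarrow> bool" where
  "isom_group G \<longleftrightarrow> (\<forall>g\<in>G. bij g \<and> (\<forall>x y. dist (g x) (g y) = dist x y)) \<and>
     id \<in> G \<and> (\<forall>g\<in>G. \<forall>h\<in>G. g \<circ> h \<in> G) \<and> (\<forall>g\<in>G. inv g \<in> G)"

definition discrete_group :: "'a::metric_space \<Rightarrow> ('a \<Rightarrow> 'a) set \<Rightarrow> bool" where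
  "discrete_group x0 G \<longleftrightarrow> (\<forall>R. finite {g\<in>G. dist x0 (g x0) \<le> R})"

definition limit_set :: "'a::metric_space \<Rightarrow> ('a \<Rightarrow> 'a) set \<Rightarrow> (real \<Rightarrow> 'a) set" where
  "limit_set x0 G = {\<xi>\<in>bd_rays x0. \<exists>gs. (\<forall>n. gs n \<in> G) \<and>
       (\<lambda>n. gromov_pb x0 (gs n x0) \<xi>) \<longlonglongrightarrow> \<infinity>}"

definition geodesic_line :: "(real \<Rightarrow> 'a::metric_space) \<Rightarrow> bool" where
  "geodesic_line \<gamma> \<longleftrightarrow> (\<forall>s t. dist (\<gamma> s) (\<gamma> t) = \<bar>s - t\<bar>)"

definition join_hull :: "'a::metric_space \<Rightarrow> (real \<Rightarrow> 'a) set \<Rightarrow> 'a set" where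
  "join_hull x0 L = {\<gamma> t | \<gamma> t. geodesic_line \<gamma> \<and>
       (\<exists>\<xi>\<in>L. bdd_above ((\<lambda>s. dist (\<gamma> s) (\<xi> s)) ` {0..})) \<and>
       (\<exists>\<eta>\<in>L. bdd_above ((\<lambda>s. dist (\<gamma> (- s)) (\<eta> s)) ` {0..}))}"

definition convex_cocompact :: "'a::metric_space \<Rightarrow> ('a \<Rightarrow> 'a) set \<Rightarrow> bool" where
  "convex_cocompact x0 G \<longleftrightarrow> (\<exists>K. compact K \<and> K \<subseteq> join_hull x0 (limit_set x0 G) \<and>
       join_hull x0 (limit_set x0 G) \<subseteq> (\<Union>g\<in>G. g ` K))"

definition non_elementary :: "'a::metric_space \<Rightarrow> ('a \<Rightarrow> 'a) set \<Rightarrow> bool" where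
  "non_elementary x0 G \<longleftrightarrow> infinite (limit_set x0 G)"

definition critical_exponent :: "'a::metric_space \<Rightarrow> ('a \<Rightarrow> 'a) set \<Rightarrow> real" where
  "critical_exponent x0 G = Inf {s. (\<lambda>g. exp (- s * dist x0 (g x0))) summable_on G}"

definition PS_density :: "'a::metric_space \<Rightarrow> ('a \<Rightarrow> 'a) set \<Rightarrow> real \<Rightarrow> ('a \<Rightarrow> (real \<Rightarrow> 'a) measure) \<Rightarrow> bool" where
  "PS_density x0 G \<delta> \<mu> \<longleftrightarrow>
     (\<forall>x. sets (\<mu> x) = sets (restrict_space borel (bd_rays x0)) \<and> finite_measure (\<mu> x) \<and>
          emeasure (\<mu> x) (bd_rays x0 - limit_set x0 G) = 0) \<and>
     prob_space (\<mu> x0) \<and>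
     (\<forall>g\<in>G. \<forall>x. distr (\<mu> x) (restrict_space borel (bd_rays x0)) (bd_act x0 g) = \<mu> (g x)) \<and>
     (\<forall>x y. \<mu> x = density (\<mu> y) (\<lambda>\<xi>. ennreal (exp (- \<delta> * busemann \<xi> x y))))"

definition F10 :: "'a::metric_space \<Rightarrow> ('a \<Rightarrow> (real \<Rightarrow> 'a) measure) \<Rightarrow> ((real \<Rightarrow> 'a) \<Rightarrow> complex) set" where
  "F10 x0 \<mu> = {\<phi>. continuous_on (bd_rays x0) \<phi> \<and> (LINT \<xi>|\<mu> x0. \<phi> \<xi>) = 0}"

definition Q1' :: "'a::metric_space \<Rightarrow> ('a \<Rightarrow> (real \<Rightarrow> 'a) measure) \<Rightarrow>
     ((real \<Rightarrow> 'a) \<Rightarrow> complex) \<Rightarrow> ((real \<Rightarrow> 'a) \<Rightarrow> complex) \<Rightarrow> complex" where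
  "Q1' x0 \<mu> \<phi> \<psi> = (LINT \<xi>|\<mu> x0. LINT \<eta>|\<mu> x0. \<phi> \<xi> * cnj (\<psi> \<eta>) * complex_of_real (gromov_bb \<xi> \<eta>))"

definition pi1 :: "'a::metric_space \<Rightarrow> real \<Rightarrow> ('a \<Rightarrow> 'a) \<Rightarrow> ((real \<Rightarrow> 'a) \<Rightarrow> complex) \<Rightarrow> ((real \<Rightarrow> 'a) \<Rightarrow> complex)" where
  "pi1 x0 \<delta> g \<phi> = (\<lambda>\<xi>. complex_of_real (exp (- \<delta> * busemann \<xi> (g x0) x0)) * \<phi> (bd_act x0 (inv g) \<xi>))"

definition cfun :: "'a::metric_space \<Rightarrow> real \<Rightarrow> 'a \<Rightarrow> 'a \<Rightarrow> ((real \<Rightarrow> 'a) \<Rightarrow> complex)" where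
  "cfun x0 \<delta> x y = (\<lambda>\<xi>. complex_of_real (exp (- \<delta> * busemann \<xi> x x0) - exp (- \<delta> * busemann \<xi> y x0)))"

definition cocyc :: "'a::metric_space \<Rightarrow> real \<Rightarrow> ('a \<Rightarrow> 'a) \<Rightarrow> ((real \<Rightarrow> 'a) \<Rightarrow> complex)" where
  "cocyc x0 \<delta> g = cfun x0 \<delta> x0 (g x0)"

section \<open>Complex Hilbert spaces as real Hilbert spaces with an orthogonal complex structure J\<close>

definition complex_structure :: "('h::real_inner \<Rightarrow> 'h) \<Rightarrow> bool" where
  "complex_structure J \<longleftrightarrow> linear J \<and> (\<forall>x. J (J x) = - x) \<and> (\<forall>x y. inner (J x) (J y) = inner x y)"

definition cspan :: "('h::real_inner \<Rightarrow> 'h) \<Rightarrow> 'h set \<Rightarrow> 'h set" where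
  "cspan J S = span (S \<union> J ` S)"

definition caffine :: "('h::real_inner \<Rightarrow> 'h) \<Rightarrow> 'h set \<Rightarrow> bool" where
  "caffine J A \<longleftrightarrow> affine A \<and> (\<forall>x\<in>A. \<forall>y\<in>A. x + J (y - x) \<in> A)"

definition cont_caffine_map :: "('h::real_inner \<Rightarrow> 'h) \<Rightarrow> ('h \<Rightarrow> 'h) \<Rightarrow> bool" where
  "cont_caffine_map J T \<longleftrightarrow> (\<exists>L b. bounded_linear L \<and> (\<forall>x. L (J x) = J (L x)) \<and> (\<forall>x. T x = L x + b))"

text \<open>(H, J, j) is a Hilbert completion of (F, Q) modulo null vectors, with class map j.
  The complex inner product of H is recovered from its real part, the real inner product.\<close>
definition hilbert_completion :: "('h::{real_inner,complete_space} \<Rightarrow> 'h) \<Rightarrow> ('f \<Rightarrow> 'h) \<Rightarrow> 'f set \<Rightarrow>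
     ('f \<Rightarrow> 'f \<Rightarrow> complex) \<Rightarrow> ('f \<Rightarrow> 'f \<Rightarrow> 'f) \<Rightarrow> (complex \<Rightarrow> 'f \<Rightarrow> 'f) \<Rightarrow> bool" where
  "hilbert_completion J j F Q add smul \<longleftrightarrow> complex_structure J \<and>
     (\<forall>\<phi>\<in>F. \<forall>\<psi>\<in>F. j (add \<phi> \<psi>) = j \<phi> + j \<psi>) \<and>
     (\<forall>\<phi>\<in>F. \<forall>a. j (smul a \<phi>) = Re a *\<^sub>R j \<phi> + Im a *\<^sub>R J (j \<phi>)) \<and>
     (\<forall>\<phi>\<in>F. \<forall>\<psi>\<in>F. inner (j \<phi>) (j \<psi>) = Re (Q \<phi> \<psi>)) \<and>
     closure (j ` F) = UNIV"

end

theory Submission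
  imports Defs "HOL-Real_Asymp.Real_Asymp"
begin

text \<open>
  Let \<open>P f\<close> be the integral of \<open>f\<close> against the Gromov product, so that the form pairs \<open>h\<close> with \<open>f\<close>
  by integrating \<open>h\<close> against \<open>P f\<close>. By a change of variables the pairing of \<open>c(g)\<close> with \<open>f\<close> is the mean
  of \<open>P f - P f \<circ> g\<close>. If \<open>g o\<close> tracks the ray towards a limit point \<open>\<zeta>\<close>, then \<open>g\<close> moves most of the
  boundary close to \<open>\<zeta>\<close>, so this tends to the mean of \<open>P f - P f \<zeta>\<close>; in the same way the coefficients
  of \<open>\<pi>\<^sub>1\<close> tend to 0. For every \<open>n\<close> and \<open>\<xi>\<close> choose \<open>g\<^sub>n(\<xi>)\<close> with \<open>g\<^sub>n(\<xi>) o\<close> near the point of the ray \<open>\<xi>\<close>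
  at time \<open>n\<close>. Since the pairing of \<open>c(g)\<close> and \<open>c(h)\<close> exceeds a Gromov product at most by a constant,
  the averages of \<open>\<psi>(\<xi>) c(g\<^sub>n(\<xi>))\<close> stay bounded in the Hilbert space, and they converge weakly to
  \<open>-\<psi>\<close> when \<open>\<psi>\<close> has mean zero. Hence a functional that converges along the \<open>c(g)\<close> vanishes. By mixing
  this applies to a functional that kills all \<open>c(g) + w - \<pi>\<^sub>1(g) w\<close>, and to the functionals
  \<open>h \<mapsto> \<langle>(L - 1) h, z\<rangle>\<close> where \<open>L\<close> is the linear part of an element of the affine commutant.
\<close>

section \<open>Comparison geometry\<close>

text \<open>In terms of measures, \<open>c(g)\<close> is the density of the boundary measure minus
  its image under \<open>g\<close>. As \<open>g o\<close> goes to \<zeta> this approaches the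
  boundary measure minus a unit mass at \<zeta>, and averaging over \<zeta> with a weight \<psi> of
  mean zero leaves -\<psi>. The obstacle is that the Gromov product is infinite on the diagonal: the
  formal limit for a single \<zeta> need not be a vector of the Hilbert space, and the pairing bound
  says nothing about the norm of a single \<open>c(g)\<close>. Averaging removes this, because the
  shadow estimate makes the Gromov product integrable in one variable, uniformly in the other. The
  norm bound in turn allows weak convergence to be tested on classes of continuous functions only. A
  functional that converges along the \<open>c(g)\<close> to one number, the same for all \<zeta>,
  yields that number times the mean of \<psi>, that is 0. Cocompactness enters through one constant
  \<open>R\<close>, the distance within which every point of a ray towards a limit point meets the
  orbit; it governs both the shadow estimate and the choice of \<open>g\<close>.\<close>

definition iso_on :: "(real \<Rightarrow> 'a::metric_space) \<Rightarrow> real set \<Rightarrow> bool" where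
  "iso_on \<gamma> S \<longleftrightarrow> (\<forall>s\<in>S. \<forall>t\<in>S. dist (\<gamma> s) (\<gamma> t) = \<bar>s - t\<bar>)"

lemma iso_onD: "iso_on \<gamma> S \<Longrightarrow> s \<in> S \<Longrightarrow> t \<in> S \<Longrightarrow> dist (\<gamma> s) (\<gamma> t) = \<bar>s - t\<bar>"
  by (simp add: iso_on_def)

lemma iso_on_subset: "iso_on \<gamma> S \<Longrightarrow> T \<subseteq> S \<Longrightarrow> iso_on \<gamma> T"
  by (auto simp: iso_on_def)

lemma iso_on_reverse: "iso_on \<gamma> {0..T} \<Longrightarrow> iso_on (\<lambda>s. \<gamma> (T - s)) {0..T}"
  by (auto simp: iso_on_def)

lemma sinh_half_sq: "cosh x - 1 = 2 * (sinh (x/2))\<^sup>2" for x :: real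
  using cosh_double_cosh[of "x/2"] cosh_square_eq[of "x/2"] by simp

lemma exp_half_le_cosh: "exp x / 2 \<le> cosh x" for x :: real
  by (simp add: cosh_field_def)

lemma sinh_le_exp_half: "sinh x \<le> exp x / 2" for x :: real
  by (simp add: sinh_field_def)

lemma le_sinh: "0 \<le> x \<Longrightarrow> x \<le> sinh x" for x :: real
  using real_le_x_sinh[of x] by (simp add: sinh_field_def exp_minus)

locale cat_m1_space =
  fixes x0 :: "'a::metric_space"
  assumes CAT: "proper_geodesic_CAT_m1 TYPE('a)"
begin

lemma compact_cball': "compact (cball (x::'a) r)"
  using CAT unfolding proper_geodesic_CAT_m1_def by blast

lemma ex_geodesic: "\<exists>\<gamma>. \<gamma> 0 = x \<and> \<gamma> (dist x y) = y \<and> iso_on \<gamma> {0..dist x y}" for x y :: 'a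
  using CAT unfolding proper_geodesic_CAT_m1_def geodesic_seg_def iso_on_def by blast

lemma stewart:
  fixes x :: 'a
  assumes "iso_on \<gamma> {0..T}" "0 < T" "0 \<le> s" "s \<le> T"
  shows "cosh (dist x (\<gamma> s)) * sinh T
       \<le> cosh (dist x (\<gamma> 0)) * sinh (T - s) + cosh (dist x (\<gamma> T)) * sinh s"
proof -
  have T: "dist (\<gamma> 0) (\<gamma> T) = T" using iso_onD[OF assms(1), of 0 T] assms by auto
  then have "geodesic_seg \<gamma> (\<gamma> 0) (\<gamma> T)"
    using assms(1) unfolding geodesic_seg_def iso_on_def by auto
  then show ?thesis using CAT T assms unfolding proper_geodesic_CAT_m1_def by metis
qed

text \<open>In the hyperbolic plane \<open>sinh (d/2) / sinh s\<close> is the sine of half the angle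
  at the common endpoint, hence constant in \<open>s\<close>. Here Stewart's inequality is used
  twice, along \<open>\<gamma>\<close> with vertex \<open>\<gamma>' s\<close> and along
  \<open>\<gamma>'\<close> with vertex \<open>\<gamma> T\<close>, and shows that the ratio is
  nondecreasing.\<close>

lemma comparison:
  fixes \<gamma> \<gamma>' :: "real \<Rightarrow> 'a"
  assumes g: "iso_on \<gamma> {0..T}" and g': "iso_on \<gamma>' {0..T}" and eq: "\<gamma> 0 = \<gamma>' 0"
    and s: "0 \<le> s" "s \<le> T"
  shows "sinh (dist (\<gamma> s) (\<gamma>' s) / 2) * sinh T \<le> sinh (dist (\<gamma> T) (\<gamma>' T) / 2) * sinh s"
proof (cases "T = 0")
  case True then show ?thesis using s by simp
next
  case False
  then have T: "0 < T" using s by simp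
  define a b m where "a = cosh (dist (\<gamma> s) (\<gamma>' s))" and "b = cosh (dist (\<gamma> T) (\<gamma>' T))"
    and "m = cosh (dist (\<gamma>' s) (\<gamma> T))"
  have d0: "dist (\<gamma>' s) (\<gamma> 0) = s" "dist (\<gamma> T) (\<gamma>' 0) = T"
      "dist (\<gamma> 0) (\<gamma>' s) = s" "dist (\<gamma>' 0) (\<gamma> T) = T"
    using iso_onD[OF g', of s 0] iso_onD[OF g, of T 0] eq s by (auto simp: dist_commute)
  have 1: "a * sinh T \<le> cosh s * sinh (T - s) + m * sinh s"
    using stewart[OF g T s, of "\<gamma>' s"] by (simp add: a_def m_def d0 dist_commute)
  have 2: "m * sinh T \<le> cosh T * sinh (T - s) + b * sinh s"
    using stewart[OF g' T s, of "\<gamma> T"] by (simp add: b_def m_def d0 dist_commute)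
  have "a * sinh T * sinh T \<le> (cosh s * sinh (T - s) + m * sinh s) * sinh T"
    using 1 T by (intro mult_right_mono) auto
  also have "\<dots> = cosh s * sinh (T - s) * sinh T + (m * sinh T) * sinh s"
    by (simp add: algebra_simps)
  also have "\<dots> \<le> cosh s * sinh (T - s) * sinh T + (cosh T * sinh (T - s) + b * sinh s) * sinh s"
    using 2 s by (intro add_left_mono mult_right_mono) auto
  also have "\<dots> = sinh (T - s) * sinh (T + s) + b * (sinh s)\<^sup>2"
    by (simp add: sinh_add algebra_simps power2_eq_square)
  also have "sinh (T - s) * sinh (T + s) = (sinh T)\<^sup>2 - (sinh s)\<^sup>2"
  proof -
    have "sinh (T - s) * sinh (T + s) = (sinh T)\<^sup>2 * (cosh s)\<^sup>2 - (cosh T)\<^sup>2 * (sinh s)\<^sup>2"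
      by (simp add: sinh_add sinh_diff algebra_simps power2_eq_square)
    then show ?thesis by (simp add: cosh_square_eq algebra_simps)
  qed
  finally have "(a - 1) * (sinh T)\<^sup>2 \<le> (b - 1) * (sinh s)\<^sup>2"
    by (simp add: algebra_simps power2_eq_square)
  then have "(sinh (dist (\<gamma> s) (\<gamma>' s) / 2) * sinh T)\<^sup>2 \<le> (sinh (dist (\<gamma> T) (\<gamma>' T) / 2) * sinh s)\<^sup>2"
    by (simp add: a_def b_def sinh_half_sq power_mult_distrib)
  then show ?thesis by (rule power2_le_imp_le) (use s in auto)
qed

lemma comparison_mono:
  fixes \<gamma> \<gamma>' :: "real \<Rightarrow> 'a"
  assumes "iso_on \<gamma> {0..T}" "iso_on \<gamma>' {0..T}" "\<gamma> 0 = \<gamma>' 0" "0 \<le> s" "s \<le> T"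
  shows "dist (\<gamma> s) (\<gamma>' s) \<le> dist (\<gamma> T) (\<gamma>' T)"
proof (cases "T = 0")
  case True then show ?thesis using assms by simp
next
  case False
  then have T: "0 < T" using assms by simp
  have "sinh (dist (\<gamma> T) (\<gamma>' T) / 2) * sinh s \<le> sinh (dist (\<gamma> T) (\<gamma>' T) / 2) * sinh T"
    using assms by (intro mult_left_mono) auto
  then have "sinh (dist (\<gamma> s) (\<gamma>' s) / 2) * sinh T \<le> sinh (dist (\<gamma> T) (\<gamma>' T) / 2) * sinh T"
    using comparison[OF assms] by linarith
  then show ?thesis using T by simp
qed

abbreviation bd :: "(real \<Rightarrow> 'a) set" where "bd \<equiv> bd_rays x0"

lemma bd_iff: "\<xi> \<in> bd \<longleftrightarrow> \<xi> 0 = x0 \<and> iso_on \<xi> {0..} \<and> (\<forall>t<0. \<xi> t = x0)"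
  by (auto simp: bd_rays_def iso_on_def)

lemma bd_dist: "\<xi> \<in> bd \<Longrightarrow> 0 \<le> s \<Longrightarrow> 0 \<le> t \<Longrightarrow> dist (\<xi> s) (\<xi> t) = \<bar>s - t\<bar>"
  by (simp add: bd_rays_def)

lemma bd_dist0: "\<xi> \<in> bd \<Longrightarrow> 0 \<le> t \<Longrightarrow> dist x0 (\<xi> t) = t" "\<xi> \<in> bd \<Longrightarrow> 0 \<le> t \<Longrightarrow> dist (\<xi> t) x0 = t"
  using bd_dist[of \<xi> 0 t] by (simp_all add: bd_rays_def dist_commute)

lemma bd_iso: "\<xi> \<in> bd \<Longrightarrow> iso_on \<xi> {0..T}"
  by (auto simp: bd_iff intro: iso_on_subset)

lemma bd_0: "\<xi> \<in> bd \<Longrightarrow> \<xi> 0 = x0"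
  by (simp add: bd_rays_def)

lemma bd_eqI:
  assumes "\<xi> \<in> bd" "\<eta> \<in> bd" "\<And>t. 0 < t \<Longrightarrow> \<xi> t = \<eta> t"
  shows "\<xi> = \<eta>"
proof
  fix t show "\<xi> t = \<eta> t" using assms unfolding bd_rays_def by (cases "0 < t"; cases "t = 0") auto
qed

lemma closed_iso_conditions: "closed {\<gamma>::real \<Rightarrow> 'a. iso_on \<gamma> S}"
proof -
  have "{\<gamma>::real \<Rightarrow> 'a. iso_on \<gamma> S} = (\<Inter>s\<in>S. \<Inter>t\<in>S. {\<gamma>. dist (\<gamma> s) (\<gamma> t) = \<bar>s - t\<bar>})"
    by (auto simp: iso_on_def)
  also have "closed \<dots>"
    by (intro closed_INT ballI closed_Collect_eq continuous_on_dist continuous_on_const continuous_on_product_coordinates)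
  finally show ?thesis .
qed

text \<open>Tychonoff's theorem, with balls compact by properness. The function type carries the
  topology of pointwise convergence, so all limits of geodesics below are pointwise and preserve
  closed conditions on the values.\<close>

lemma compact_paths: "compact {\<gamma>::real \<Rightarrow> 'a. \<forall>t. dist x0 (\<gamma> t) \<le> r t}"
proof -
  have "compactin (product_topology (\<lambda>_. euclidean) UNIV) (PiE UNIV (\<lambda>t. cball x0 (r t)))"
    unfolding compactin_PiE using compact_cball' by auto
  moreover have "PiE UNIV (\<lambda>t. cball x0 (r t)) = {\<gamma>. \<forall>t. dist x0 (\<gamma> t) \<le> r t}"
    by (auto simp: PiE_UNIV_domain)
  ultimately show ?thesis
    by (simp add: euclidean_product_topology)
qed

lemma bd_bound: "\<xi> \<in> bd \<Longrightarrow> dist x0 (\<xi> t) \<le> \<bar>t\<bar>"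
  using bd_dist0[of \<xi> t] by (cases "0 \<le> t") (auto simp: bd_rays_def)

lemma compact_bd: "compact bd"
proof -
  have "closed bd"
  proof -
    have "bd = {\<gamma>. \<gamma> 0 = x0} \<inter> {\<gamma>. iso_on \<gamma> {0..}} \<inter> (\<Inter>t\<in>{..<0}. {\<gamma>. \<gamma> t = x0})"
      by (rule set_eqI) (subst bd_iff, blast)
    also have "closed \<dots>"
      by (intro closed_Int closed_INT ballI closed_iso_conditions closed_Collect_eq continuous_on_const continuous_on_product_coordinates)
    finally show ?thesis .
  qed
  moreover have "bd \<subseteq> {\<gamma>. \<forall>t. dist x0 (\<gamma> t) \<le> \<bar>t\<bar>}" using bd_bound by auto
  ultimately show ?thesis using compact_Int_closed[OF compact_paths[of "\<lambda>t. \<bar>t\<bar>"], of bd]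
    by (simp add: Int_absorb2 Int_commute)
qed

section \<open>The Gromov product on the boundary\<close>

text \<open>The Gromov product, based at \<open>x0\<close>, of the two points reached at time
  \<open>t\<close>. For two rays it increases with \<open>t\<close>, and for distinct rays its limit
  is the product of the endpoints.\<close>

definition trunc :: "real \<Rightarrow> (real \<Rightarrow> 'a) \<Rightarrow> (real \<Rightarrow> 'a) \<Rightarrow> real" where
  "trunc t \<xi> \<eta> = t - dist (\<xi> t) (\<eta> t) / 2"

lemma bd_comparison:
  assumes "\<xi> \<in> bd" "\<eta> \<in> bd" "0 \<le> s" "s \<le> T"
  shows "sinh (dist (\<xi> s) (\<eta> s) / 2) * sinh T \<le> sinh (dist (\<xi> T) (\<eta> T) / 2) * sinh s"
  using assms by (intro comparison bd_iso) (auto simp: bd_0)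

lemma trunc_mono:
  assumes "\<xi> \<in> bd" "\<eta> \<in> bd" "0 \<le> s" "s \<le> t"
  shows "trunc s \<xi> \<eta> \<le> trunc t \<xi> \<eta>"
proof -
  have "dist (\<xi> t) (\<eta> t) \<le> dist (\<xi> t) (\<xi> s) + dist (\<xi> s) (\<eta> s) + dist (\<eta> s) (\<eta> t)"
    by metric
  then show ?thesis using bd_dist[OF assms(1), of t s] bd_dist[OF assms(2), of s t] assms
    by (simp add: trunc_def)
qed

lemma trunc_nonneg: "\<xi> \<in> bd \<Longrightarrow> \<eta> \<in> bd \<Longrightarrow> 0 \<le> t \<Longrightarrow> 0 \<le> trunc t \<xi> \<eta>"
  using trunc_mono[of \<xi> \<eta> 0 t] by (simp add: trunc_def bd_0)

text \<open>The number \<open>q\<close> acts as the sine of half the angle between the rays.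
  \<open>bd_comparison\<close> carries it from time \<open>s\<close> to all later times, so the rays
  separate at speed 2 up to a constant.\<close>

lemma trunc_bounded:
  assumes "\<xi> \<in> bd" "\<eta> \<in> bd" "\<xi> \<noteq> \<eta>"
  shows "\<exists>C. \<forall>t\<ge>0. trunc t \<xi> \<eta> \<le> C"
proof -
  obtain s where s: "0 < s" "\<xi> s \<noteq> \<eta> s" using bd_eqI assms by blast
  define q where "q = sinh (dist (\<xi> s) (\<eta> s) / 2) / sinh s"
  have q: "0 < q" using s by (simp add: q_def)
  have big: "trunc t \<xi> \<eta> \<le> ln 2 - ln q" if t: "s \<le> t" "1 \<le> t" for t
  proof -
    have "q * sinh t \<le> sinh (dist (\<xi> t) (\<eta> t) / 2)"
      using bd_comparison[OF assms(1,2), of s t] s t by (simp add: q_def field_simps)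
    also have "\<dots> \<le> exp (dist (\<xi> t) (\<eta> t) / 2) / 2" by (rule sinh_le_exp_half)
    finally have 1: "q * sinh t \<le> exp (dist (\<xi> t) (\<eta> t) / 2) / 2" .
    have "exp t / 4 \<le> sinh t"
    proof -
      have "2 * exp (-t) \<le> exp t"
      proof -
        have "2 \<le> exp t" using t exp_ge_add_one_self[of t] by linarith
        moreover have "exp (-t) \<le> 1" using t by simp
        ultimately show ?thesis by linarith
      qed
      then show ?thesis by (simp add: sinh_field_def)
    qed
    then have "q * (exp t / 4) \<le> exp (dist (\<xi> t) (\<eta> t) / 2) / 2"
      using q 1 by (meson mult_left_mono order_trans less_imp_le)
    then have "exp (ln q + t) \<le> exp (ln 2 + dist (\<xi> t) (\<eta> t) / 2)"
      using q by (simp add: exp_add)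
    then show ?thesis by (simp add: trunc_def)
  qed
  have "trunc t \<xi> \<eta> \<le> ln 2 - ln q" if "0 \<le> t" for t
    using trunc_mono[OF assms(1,2) that, of "max t (max s 1)"] big[of "max t (max s 1)"]
    by (meson max.cobounded1 max.cobounded2 order_trans)
  then show ?thesis by blast
qed

lemma gromov_bb_eq_Sup:
  assumes "\<xi> \<in> bd" "\<eta> \<in> bd" "\<xi> \<noteq> \<eta>"
  shows "gromov_bb \<xi> \<eta> = (SUP t\<in>{0..}. trunc t \<xi> \<eta>)"
proof -
  obtain C where C: "\<forall>t\<ge>0. trunc t \<xi> \<eta> \<le> C" using trunc_bounded[OF assms] by blast
  have "(SUP t\<in>{0..}. ereal (trunc t \<xi> \<eta>)) = ereal (SUP t\<in>{0..}. trunc t \<xi> \<eta>)"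
  proof (rule ereal_SUP[symmetric])
    have "(SUP t\<in>{0..}. ereal (trunc t \<xi> \<eta>)) \<le> ereal C" using C by (intro SUP_least) auto
    moreover have "(SUP t\<in>{0..}. ereal (trunc t \<xi> \<eta>)) \<ge> ereal (trunc 0 \<xi> \<eta>)" by (intro SUP_upper) auto
    ultimately show "\<bar>SUP t\<in>{0..}. ereal (trunc t \<xi> \<eta>)\<bar> \<noteq> \<infinity>" by auto
  qed
  then show ?thesis by (simp add: gromov_bb_def trunc_def)
qed

lemma trunc_le:
  assumes "\<xi> \<in> bd" "\<eta> \<in> bd" "\<xi> \<noteq> \<eta>" "0 \<le> t"
  shows "trunc t \<xi> \<eta> \<le> gromov_bb \<xi> \<eta>"
proof -
  obtain C where "\<forall>t\<ge>0. trunc t \<xi> \<eta> \<le> C" using trunc_bounded[OF assms(1-3)] by blast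
  then have "bdd_above ((\<lambda>t. trunc t \<xi> \<eta>) ` {0..})" by (auto intro!: bdd_aboveI)
  then show ?thesis using gromov_bb_eq_Sup[OF assms(1-3)] assms(4) by (auto intro: cSUP_upper)
qed

text \<open>The supremum is infinite and \<open>real_of_ereal\<close> sends it to 0. Because of this
  default, closeness of boundary points is later phrased as
  \<open>\<xi> = \<eta> \<or> N \<le> gromov_bb \<xi> \<eta>\<close>.\<close>

lemma gromov_bb_self: "\<xi> \<in> bd \<Longrightarrow> gromov_bb \<xi> \<xi> = 0"
proof -
  have "(SUP t\<in>{0::real..}. ereal t) = \<infinity>"
  proof (rule SUP_PInfty)
    fix n show "\<exists>i\<in>{0::real..}. ereal (real n) \<le> ereal i" by (rule bexI[of _ "real n"]) auto
  qed
  then show ?thesis by (simp add: gromov_bb_def)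
qed

lemma gromov_bb_commute: "gromov_bb \<xi> \<eta> = gromov_bb \<eta> \<xi>"
  by (simp add: gromov_bb_def dist_commute)

lemma gromov_bb_nonneg: "\<xi> \<in> bd \<Longrightarrow> \<eta> \<in> bd \<Longrightarrow> 0 \<le> gromov_bb \<xi> \<eta>"
  using trunc_le[of \<xi> \<eta> 0] gromov_bb_self[of \<xi>]
  by (cases "\<xi> = \<eta>") (auto simp: trunc_def bd_0)

lemma trunc_tendsto:
  assumes "\<xi> \<in> bd" "\<eta> \<in> bd" "\<xi> \<noteq> \<eta>"
  shows "((\<lambda>t. trunc t \<xi> \<eta>) \<longlongrightarrow> gromov_bb \<xi> \<eta>) at_top"
proof (rule order_tendstoI)
  fix a assume "a < gromov_bb \<xi> \<eta>"
  moreover obtain C where "\<forall>t\<ge>0. trunc t \<xi> \<eta> \<le> C" using trunc_bounded[OF assms] by blast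
  then have "bdd_above ((\<lambda>t. trunc t \<xi> \<eta>) ` {0..})" by (auto intro!: bdd_aboveI)
  ultimately obtain t where t: "0 \<le> t" "a < trunc t \<xi> \<eta>"
    unfolding gromov_bb_eq_Sup[OF assms]
    by (subst (asm) less_cSUP_iff) auto
  show "eventually (\<lambda>t. a < trunc t \<xi> \<eta>) at_top"
    using eventually_ge_at_top[of t] by eventually_elim (use t trunc_mono[OF assms(1,2)] in force)
next
  fix a assume a: "gromov_bb \<xi> \<eta> < a"
  show "eventually (\<lambda>t. trunc t \<xi> \<eta> < a) at_top"
    using eventually_ge_at_top[of "0::real"] by eventually_elim (use a trunc_le[OF assms] in force)
qed

lemma exp_over_2sinh_tendsto: "((\<lambda>t::real. exp t / (2 * sinh t)) \<longlongrightarrow> 1) at_top"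
  unfolding sinh_field_def by real_asymp

text \<open>The limit of \<open>bd_comparison\<close> as the later time goes to infinity:
  \<open>exp (- gromov_bb \<xi> \<eta>)\<close> replaces the sine of half the angle and controls how
  long the two rays stay together.\<close>

lemma sinh_dist_le:
  assumes "\<xi> \<in> bd" "\<eta> \<in> bd" "\<xi> \<noteq> \<eta>" "0 \<le> s"
  shows "sinh (dist (\<xi> s) (\<eta> s) / 2) \<le> sinh s * exp (- gromov_bb \<xi> \<eta>)"
proof -
  have "((\<lambda>t. exp (- trunc t \<xi> \<eta>) * (exp t / (2 * sinh t)) * sinh s) \<longlongrightarrow> exp (- gromov_bb \<xi> \<eta>) * 1 * sinh s) at_top"
    by (intro tendsto_intros trunc_tendsto exp_over_2sinh_tendsto assms)
  then have "sinh (dist (\<xi> s) (\<eta> s) / 2) \<le> exp (- gromov_bb \<xi> \<eta>) * 1 * sinh s"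
  proof (rule tendsto_lowerbound)
    show "\<forall>\<^sub>F t in at_top. sinh (dist (\<xi> s) (\<eta> s) / 2) \<le> exp (- trunc t \<xi> \<eta>) * (exp t / (2 * sinh t)) * sinh s"
      using eventually_ge_at_top[of s] eventually_gt_at_top[of 0]
    proof eventually_elim
      case (elim t)
      have "sinh (dist (\<xi> s) (\<eta> s) / 2) * sinh t \<le> sinh (dist (\<xi> t) (\<eta> t) / 2) * sinh s"
        using bd_comparison assms elim by blast
      also have "\<dots> \<le> exp (dist (\<xi> t) (\<eta> t) / 2) / 2 * sinh s"
        using assms by (intro mult_right_mono sinh_le_exp_half) auto
      finally have "sinh (dist (\<xi> s) (\<eta> s) / 2) \<le> exp (dist (\<xi> t) (\<eta> t) / 2) / (2 * sinh t) * sinh s"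
        using elim by (simp add: field_simps)
      also have "exp (dist (\<xi> t) (\<eta> t) / 2) = exp (- trunc t \<xi> \<eta>) * exp t"
        by (simp add: trunc_def flip: exp_add)
      finally show ?case by simp
    qed
  qed simp
  then show ?thesis by (simp add: mult.commute)
qed

text \<open>Rays fellow-travel up to the time given by their Gromov product, because
  \<open>sinh s * exp (- s)\<close> is at most 1/2.\<close>

lemma dist_le_1:
  assumes "\<xi> \<in> bd" "\<eta> \<in> bd" "0 \<le> s" "\<xi> = \<eta> \<or> s \<le> gromov_bb \<xi> \<eta>"
  shows "dist (\<xi> s) (\<eta> s) \<le> 1"
proof (cases "\<xi> = \<eta>")
  case False
  have "sinh (dist (\<xi> s) (\<eta> s) / 2) \<le> sinh s * exp (- gromov_bb \<xi> \<eta>)"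
    using sinh_dist_le assms False by blast
  also have "\<dots> \<le> exp s / 2 * exp (- s)"
    using assms False by (intro mult_mono sinh_le_exp_half) auto
  also have "\<dots> = 1/2" by (simp add: exp_minus)
  finally have "sinh (dist (\<xi> s) (\<eta> s) / 2) \<le> 1/2" .
  moreover have "dist (\<xi> s) (\<eta> s) / 2 \<le> sinh (dist (\<xi> s) (\<eta> s) / 2)"
    by (rule le_sinh) simp
  ultimately show ?thesis by linarith
qed simp

text \<open>Distinct rays separate linearly, so a point at infinity determines its ray from
  \<open>x0\<close>. This makes the \<open>THE\<close> in \<open>bd_act\<close> meaningful.\<close>

lemma bd_unique:
  assumes "\<xi> \<in> bd" "\<eta> \<in> bd" "\<And>t. 0 \<le> t \<Longrightarrow> dist (\<xi> t) (\<eta> t) \<le> C"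
  shows "\<xi> = \<eta>"
proof (rule ccontr)
  assume ne: "\<xi> \<noteq> \<eta>"
  obtain D where D: "\<forall>t\<ge>0. trunc t \<xi> \<eta> \<le> D" using trunc_bounded[OF assms(1,2) ne] by blast
  define t where "t = max 0 (D + C/2 + 1)"
  have "trunc t \<xi> \<eta> \<le> D" using D by (auto simp: t_def)
  moreover have "dist (\<xi> t) (\<eta> t) \<le> C" using assms(3) by (auto simp: t_def)
  ultimately show False by (auto simp: trunc_def t_def)
qed

end

lemma antimono_tendsto_at_top:
  fixes f :: "real \<Rightarrow> real"
  assumes "\<And>s t. 0 \<le> s \<Longrightarrow> s \<le> t \<Longrightarrow> f t \<le> f s" "\<And>t. 0 \<le> t \<Longrightarrow> b \<le> f t"
  shows "\<exists>l. (f \<longlongrightarrow> l) at_top \<and> (\<forall>t\<ge>0. l \<le> f t) \<and> b \<le> l"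
proof -
  define l where "l = (INF t\<in>{0..}. f t)"
  have bb: "bdd_below (f ` {0..})" using assms(2) by (auto intro!: bdd_belowI)
  have le: "l \<le> f t" if "0 \<le> t" for t unfolding l_def using bb that by (auto intro: cINF_lower)
  have "(f \<longlongrightarrow> l) at_top"
  proof (rule order_tendstoI)
    fix a assume a: "a < l"
    show "eventually (\<lambda>t. a < f t) at_top"
      using eventually_ge_at_top[of "0::real"] by eventually_elim (use a le in force)
  next
    fix a assume "l < a"
    then obtain t where t: "0 \<le> t" "f t < a"
      unfolding l_def using bb by (subst (asm) cINF_less_iff) auto
    show "eventually (\<lambda>t. f t < a) at_top"
      using eventually_ge_at_top[of t] by eventually_elim (use t assms(1) in force)
  qed
  moreover have "b \<le> l" unfolding l_def using assms(2) by (intro cINF_greatest) auto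
  ultimately show ?thesis using le by blast
qed

context cat_m1_space
begin

section \<open>Busemann functions\<close>

definition bz :: "(real \<Rightarrow> 'a) \<Rightarrow> 'a \<Rightarrow> real" where
  "bz \<xi> x = busemann \<xi> x x0"

lemma ray_dist_antimono:
  assumes "iso_on \<rho> {0..}" "0 \<le> s" "s \<le> t"
  shows "dist x (\<rho> t) - t \<le> dist x (\<rho> s) - s"
  using iso_onD[OF assms(1), of s t] dist_triangle[of x "\<rho> t" "\<rho> s"] assms by simp

lemma ray_dist_ge:
  assumes "iso_on \<rho> {0..}" "0 \<le> t"
  shows "- dist x (\<rho> 0) \<le> dist x (\<rho> t) - t"
  using iso_onD[OF assms(1), of 0 t] dist_triangle[of "\<rho> 0" "\<rho> t" x] assms by (simp add: dist_commute)

lemma ray_bz: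
  fixes \<rho> :: "real \<Rightarrow> 'a"
  assumes "iso_on \<rho> {0..}"
  shows "\<exists>l. ((\<lambda>t. dist x (\<rho> t) - t) \<longlongrightarrow> l) at_top \<and> (\<forall>t\<ge>0. l \<le> dist x (\<rho> t) - t)
           \<and> - dist x (\<rho> 0) \<le> l"
  by (rule antimono_tendsto_at_top) (use ray_dist_antimono[OF assms] ray_dist_ge[OF assms] in auto)

lemma bd_isoray: "\<xi> \<in> bd \<Longrightarrow> iso_on \<xi> {0..}"
  by (simp add: bd_iff)

lemma bz_tendsto:
  assumes "\<xi> \<in> bd"
  shows "((\<lambda>t. dist x (\<xi> t) - t) \<longlongrightarrow> bz \<xi> x) at_top"
proof -
  obtain l where l: "((\<lambda>t. dist x (\<xi> t) - t) \<longlongrightarrow> l) at_top"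
    using ray_bz[OF bd_isoray[OF assms]] by blast
  have "((\<lambda>t. dist x (\<xi> t) - dist x0 (\<xi> t)) \<longlongrightarrow> l) at_top"
  proof (rule Lim_transform_eventually[OF l])
    show "\<forall>\<^sub>F t in at_top. dist x (\<xi> t) - t = dist x (\<xi> t) - dist x0 (\<xi> t)"
      using eventually_ge_at_top[of "0::real"] by eventually_elim (simp add: bd_dist0 assms)
  qed
  then have "bz \<xi> x = l" unfolding bz_def busemann_def by (intro tendsto_Lim) auto
  then show ?thesis using l by simp
qed

lemma bz_le:
  assumes "\<xi> \<in> bd" "0 \<le> t"
  shows "bz \<xi> x \<le> dist x (\<xi> t) - t"
  using ray_bz[OF bd_isoray[OF assms(1)], of x] tendsto_unique[OF _ bz_tendsto[OF assms(1), of x]] assms(2)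
  by (metis trivial_limit_at_top_linorder)

lemma bz_diff:
  assumes "\<xi> \<in> bd"
  shows "busemann \<xi> x y = bz \<xi> x - bz \<xi> y"
proof -
  have "((\<lambda>t. (dist x (\<xi> t) - t) - (dist y (\<xi> t) - t)) \<longlongrightarrow> bz \<xi> x - bz \<xi> y) at_top"
    by (intro tendsto_intros bz_tendsto assms)
  then show ?thesis unfolding busemann_def by (intro tendsto_Lim) auto
qed

lemma bz_0: "\<xi> \<in> bd \<Longrightarrow> bz \<xi> x0 = 0"
  using bz_diff[of \<xi> x0 x0] by (simp add: bz_def)

lemma bz_lipschitz:
  assumes "\<xi> \<in> bd"
  shows "\<bar>bz \<xi> x - bz \<xi> y\<bar> \<le> dist x y"
proof -
  have "((\<lambda>t. \<bar>(dist x (\<xi> t) - t) - (dist y (\<xi> t) - t)\<bar>) \<longlongrightarrow> \<bar>bz \<xi> x - bz \<xi> y\<bar>) at_top"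
    by (intro tendsto_intros bz_tendsto assms)
  then show ?thesis
  proof (rule tendsto_upperbound)
    have "\<bar>dist x z - dist y z\<bar> \<le> dist x y" for z by (metis abs_dist_diff_le dist_commute)
    then show "\<forall>\<^sub>F t in at_top. \<bar>(dist x (\<xi> t) - t) - (dist y (\<xi> t) - t)\<bar> \<le> dist x y" by simp
  qed simp
qed

lemma bz_abs_le: "\<xi> \<in> bd \<Longrightarrow> \<bar>bz \<xi> x\<bar> \<le> dist x x0"
  using bz_lipschitz[of \<xi> x x0] by (simp add: bz_0)

text \<open>Stewart's inequality for the vertex \<open>x\<close> and the piece of the ray up to time
  \<open>T\<close>, divided by \<open>sinh T\<close>, in the limit of large
  \<open>T\<close>.\<close>

lemma stewart_ray:
  assumes "\<xi> \<in> bd" "0 \<le> t"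
  shows "cosh (dist x (\<xi> t)) \<le> cosh (dist x x0) * exp (-t) + exp (bz \<xi> x) * sinh t"
proof -
  have "((\<lambda>T. cosh (dist x x0) * exp (-t) + (exp (dist x (\<xi> T) - T) * (exp T / (2 * sinh T)) + 1 / (2 * sinh T)) * sinh t)
     \<longlongrightarrow> cosh (dist x x0) * exp (-t) + (exp (bz \<xi> x) * 1 + 0) * sinh t) at_top"
    by (intro tendsto_intros bz_tendsto exp_over_2sinh_tendsto assms) (simp add: sinh_field_def; real_asymp)
  then have "cosh (dist x (\<xi> t)) \<le> cosh (dist x x0) * exp (-t) + (exp (bz \<xi> x) * 1 + 0) * sinh t"
  proof (rule tendsto_lowerbound)
    show "\<forall>\<^sub>F T in at_top. cosh (dist x (\<xi> t)) \<le> cosh (dist x x0) * exp (-t) + (exp (dist x (\<xi> T) - T) * (exp T / (2 * sinh T)) + 1 / (2 * sinh T)) * sinh t"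
      using eventually_ge_at_top[of t] eventually_gt_at_top[of "0::real"]
    proof eventually_elim
      case (elim T)
      have "cosh (dist x (\<xi> t)) * sinh T \<le> cosh (dist x x0) * sinh (T - t) + cosh (dist x (\<xi> T)) * sinh t"
        using stewart[OF bd_iso[OF assms(1), of T] elim(2) assms(2) elim(1), of x] by (simp add: bd_0 assms)
      \<comment> \<open>These two upper bounds make the quotient by \<open>sinh T\<close> explicit
        and lose only terms that vanish as \<open>T\<close> grows.\<close>
      also have "\<dots> \<le> cosh (dist x x0) * (exp (-t) * sinh T) + (exp (dist x (\<xi> T)) + 1) / 2 * sinh t"
      proof (intro add_mono mult_left_mono mult_right_mono)
        have e: "exp (-t) * sinh T = (exp (T - t) - exp (-t - T)) / 2"
          by (simp add: sinh_field_def exp_diff exp_minus field_simps)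
        have e': "sinh (T - t) = (exp (T - t) - exp (t - T)) / 2"
          by (simp add: sinh_field_def)
        show "sinh (T - t) \<le> exp (-t) * sinh T"
          unfolding e e' using assms by (intro divide_right_mono diff_left_mono) auto
        show "cosh (dist x (\<xi> T)) \<le> (exp (dist x (\<xi> T)) + 1) / 2" by (simp add: cosh_field_def)
      qed (use assms in auto)
      finally have "cosh (dist x (\<xi> t)) \<le> (cosh (dist x x0) * (exp (-t) * sinh T) + (exp (dist x (\<xi> T)) + 1) / 2 * sinh t) / sinh T"
        using elim by (subst pos_le_divide_eq) auto
      also have "\<dots> = cosh (dist x x0) * exp (-t) + (exp (dist x (\<xi> T) - T) * (exp T / (2 * sinh T)) + 1 / (2 * sinh T)) * sinh t"
        using elim by (simp add: exp_diff field_simps)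
      finally show ?case .
    qed
  qed simp
  then show ?thesis by simp
qed

text \<open>One inequality is \<open>bz_le\<close>; the other is negative curvature in the form of
  \<open>stewart_ray\<close>. The error is uniform in \<open>\<xi>\<close>, so
  \<open>exp (bz \<xi> x)\<close> is a uniform limit of continuous functions of
  \<open>\<xi>\<close>; this gives continuity of Busemann functions on the boundary.\<close>

lemma exp_bz_approx:
  assumes "\<xi> \<in> bd" "0 \<le> t"
  shows "\<bar>exp (dist x (\<xi> t) - t) - exp (bz \<xi> x)\<bar> \<le> 2 * cosh (dist x x0) * exp (- 2 * t)"
proof -
  have "exp (bz \<xi> x) * sinh t \<le> exp (bz \<xi> x) * (exp t / 2)"
    by (intro mult_left_mono sinh_le_exp_half) auto
  then have "exp (dist x (\<xi> t)) \<le> 2 * cosh (dist x x0) * exp (-t) + exp (bz \<xi> x) * exp t"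
    using stewart_ray[OF assms, of x] exp_half_le_cosh[of "dist x (\<xi> t)"] by linarith
  then have "exp (dist x (\<xi> t)) * exp (-t) \<le> (2 * cosh (dist x x0) * exp (-t) + exp (bz \<xi> x) * exp t) * exp (-t)"
    by (intro mult_right_mono) auto
  moreover have "exp (-t) * exp (-t) = exp (- 2 * t)" "exp t * exp (-t) = 1" 
      "exp (dist x (\<xi> t)) * exp (-t) = exp (dist x (\<xi> t) - t)"
    by (simp_all flip: exp_add)
  ultimately have "exp (dist x (\<xi> t) - t) \<le> 2 * cosh (dist x x0) * exp (- 2 * t) + exp (bz \<xi> x)"
    by (simp add: distrib_right mult.assoc)
  moreover have "exp (bz \<xi> x) \<le> exp (dist x (\<xi> t) - t)" using bz_le[OF assms] by simp
  ultimately show ?thesis by simp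
qed

lemma continuous_on_eval: "continuous_on S (\<lambda>\<xi>::real \<Rightarrow> 'a. \<xi> t)"
  by (rule continuous_on_subset[OF continuous_on_product_coordinates]) simp

lemma continuous_on_bz: "continuous_on bd (\<lambda>\<xi>. bz \<xi> x)"
proof -
  have "continuous_on bd (\<lambda>\<xi>. exp (bz \<xi> x))"
  proof (rule uniform_limit_theorem)
    show "\<forall>\<^sub>F t in at_top. continuous_on bd (\<lambda>\<xi>. exp (dist x (\<xi> t) - t))"
      by (intro always_eventually allI continuous_intros continuous_on_eval)
    show "uniform_limit bd (\<lambda>t \<xi>. exp (dist x (\<xi> t) - t)) (\<lambda>\<xi>. exp (bz \<xi> x)) at_top"
    proof (rule uniform_limitI)
      fix e :: real assume "0 < e"
      have "((\<lambda>t. 2 * cosh (dist x x0) * exp (- 2 * t)) \<longlongrightarrow> 0) at_top" by real_asymp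
      then have "\<forall>\<^sub>F t in at_top. 2 * cosh (dist x x0) * exp (- 2 * t) < e"
        using \<open>0 < e\<close> by (rule order_tendstoD)
      then show "\<forall>\<^sub>F t in at_top. \<forall>\<xi>\<in>bd. dist (exp (dist x (\<xi> t) - t)) (exp (bz \<xi> x)) < e"
        using eventually_ge_at_top[of "0::real"]
      proof eventually_elim
        case (elim t)
        show ?case
        proof
          fix \<xi> assume "\<xi> \<in> bd"
          then show "dist (exp (dist x (\<xi> t) - t)) (exp (bz \<xi> x)) < e"
            using exp_bz_approx[of \<xi> t x] elim by (simp add: dist_real_def)
        qed
      qed
    qed
  qed simp
  then have "continuous_on bd (\<lambda>\<xi>. ln (exp (bz \<xi> x)))" by (intro continuous_on_ln) auto
  then show ?thesis by simp
qed

section \<open>Asymptotic rays\<close>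

text \<open>Both rays are compared with the diagonal geodesic from \<open>\<xi> 0\<close> to \<open>\<rho> T\<close>.\<close>
lemma asymptotic_estimate:
  fixes \<rho> \<xi> :: "real \<Rightarrow> 'a"
  assumes r: "iso_on \<rho> {0..}" and x: "iso_on \<xi> {0..}"
    and C: "\<And>t. 0 \<le> t \<Longrightarrow> dist (\<rho> t) (\<xi> t) \<le> C" and T: "2 * C \<le> T" "0 < T" "C < T"
  defines "L \<equiv> dist (\<xi> 0) (\<rho> T)"
  shows "dist (\<rho> (T/2)) (\<xi> (L - T/2)) \<le> 2 * sinh C * (sinh (T/2) + sinh (T/2 + C)) / sinh (T - C)"
proof -
  have C0: "0 \<le> C" using C[of 0] zero_le_dist[of "\<rho> 0" "\<xi> 0"] by linarith
  have LT: "\<bar>L - T\<bar> \<le> C"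
    using C[of 0] iso_onD[OF r, of 0 T] T dist_triangle[of "\<xi> 0" "\<rho> T" "\<rho> 0"]
      dist_triangle[of "\<rho> 0" "\<rho> T" "\<xi> 0"] by (simp add: L_def dist_commute)
  \<comment> \<open>Each comparison starts at an endpoint of the diagonal and needs two sides of
    equal length \<open>m\<close>. The piece that is cut off has length at most
    \<open>C\<close>.\<close>
  define m where "m = min L T"
  have m: "T - C \<le> m" "m \<le> L" "m \<le> T" "0 < m" "L - m + (T - m) \<le> C" using LT T by (auto simp: m_def)
  obtain \<sigma> where \<sigma>: "\<sigma> 0 = \<xi> 0" "\<sigma> L = \<rho> T" "iso_on \<sigma> {0..L}"
    using ex_geodesic[of "\<xi> 0" "\<rho> T"] by (auto simp: L_def)
  have sm: "sinh (T - C) \<le> sinh m" "0 < sinh (T - C)" using m T by auto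
  have key: "dist (\<gamma> s) (\<gamma>' s) \<le> 2 * sinh C * sinh s / sinh (T - C)"
    if "iso_on \<gamma> {0..m}" "iso_on \<gamma>' {0..m}" "\<gamma> 0 = \<gamma>' 0" "0 \<le> s" "s \<le> m"
      "dist (\<gamma> m) (\<gamma>' m) \<le> 2 * C" for \<gamma> \<gamma>' :: "real \<Rightarrow> 'a" and s
  proof -
    have "sinh (dist (\<gamma> s) (\<gamma>' s) / 2) * sinh (T - C) \<le> sinh (dist (\<gamma> s) (\<gamma>' s) / 2) * sinh m"
      using sm by (intro mult_left_mono) auto
    also have "\<dots> \<le> sinh (dist (\<gamma> m) (\<gamma>' m) / 2) * sinh s" using comparison that by blast
    also have "\<dots> \<le> sinh C * sinh s" using that by (intro mult_right_mono) auto
    finally have "sinh (dist (\<gamma> s) (\<gamma>' s) / 2) \<le> sinh C * sinh s / sinh (T - C)"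
      using sm by (simp add: field_simps)
    moreover have "dist (\<gamma> s) (\<gamma>' s) / 2 \<le> sinh (dist (\<gamma> s) (\<gamma>' s) / 2)"
      by (rule le_sinh) simp
    ultimately have "dist (\<gamma> s) (\<gamma>' s) \<le> 2 * (sinh C * sinh s / sinh (T - C))" by linarith
    then show ?thesis by (simp add: mult.assoc)
  qed
  have "dist (\<sigma> (L - T/2)) (\<xi> (L - T/2)) \<le> 2 * sinh C * sinh (L - T/2) / sinh (T - C)"
  proof (rule key)
    show "dist (\<sigma> m) (\<xi> m) \<le> 2 * C"
    proof -
      have "dist (\<sigma> m) (\<xi> m) \<le> dist (\<sigma> m) (\<sigma> L) + dist (\<rho> T) (\<xi> T) + dist (\<xi> T) (\<xi> m)"
        unfolding \<sigma>(2) by metric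
      also have "dist (\<sigma> m) (\<sigma> L) = L - m" using iso_onD[OF \<sigma>(3), of m L] m by simp
      also have "dist (\<xi> T) (\<xi> m) = T - m" using iso_onD[OF x, of T m] m T by simp
      finally show ?thesis using C[of T] m T by simp
    qed
  qed (use \<sigma> m LT T x in \<open>auto intro: iso_on_subset\<close>)
  also have "\<dots> \<le> 2 * sinh C * sinh (T/2 + C) / sinh (T - C)"
    using LT sm C0 by (intro divide_right_mono mult_left_mono) auto
  finally have 1: "dist (\<sigma> (L - T/2)) (\<xi> (L - T/2)) \<le> 2 * sinh C * sinh (T/2 + C) / sinh (T - C)" .
  have 2: "dist (\<sigma> (L - T/2)) (\<rho> (T - T/2)) \<le> 2 * sinh C * sinh (T/2) / sinh (T - C)"
  proof (rule key[of "\<lambda>\<tau>. \<sigma> (L - \<tau>)" "\<lambda>\<tau>. \<rho> (T - \<tau>)" "T/2"])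
    show "iso_on (\<lambda>\<tau>. \<sigma> (L - \<tau>)) {0..m}"
      using iso_on_reverse[OF \<sigma>(3)] m by (auto intro: iso_on_subset)
    show "iso_on (\<lambda>\<tau>. \<rho> (T - \<tau>)) {0..m}"
      using iso_on_reverse[OF iso_on_subset[OF r, of "{0..T}"]] m by (auto intro: iso_on_subset)
    show "dist (\<sigma> (L - m)) (\<rho> (T - m)) \<le> 2 * C"
    proof -
      have "dist (\<sigma> (L - m)) (\<rho> (T - m)) \<le> dist (\<sigma> (L - m)) (\<sigma> 0) + dist (\<xi> 0) (\<rho> 0) + dist (\<rho> 0) (\<rho> (T - m))"
        unfolding \<sigma>(1) by metric
      also have "dist (\<sigma> (L - m)) (\<sigma> 0) = L - m" using iso_onD[OF \<sigma>(3), of "L - m" 0] m by simp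
      also have "dist (\<rho> 0) (\<rho> (T - m)) = T - m" using iso_onD[OF r, of 0 "T - m"] m T by simp
      finally show ?thesis using C[of 0] m by (simp add: dist_commute)
    qed
  qed (use \<sigma> m LT T in auto)
  have "dist (\<rho> (T/2)) (\<xi> (L - T/2)) \<le> dist (\<sigma> (L - T/2)) (\<rho> (T/2)) + dist (\<sigma> (L - T/2)) (\<xi> (L - T/2))"
    by metric
  also have "\<dots> \<le> 2 * sinh C * sinh (T/2) / sinh (T - C) + 2 * sinh C * sinh (T/2 + C) / sinh (T - C)"
    using 1 2 by (intro add_mono) auto
  finally show ?thesis by (simp add: algebra_simps add_divide_distrib)
qed

text \<open>The shift is the Busemann value \<open>b\<close> of \<open>\<xi> 0\<close> along
  \<open>\<rho>\<close>. The estimate is used with \<open>T = 2 * t\<close>, where its error decays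
  like \<open>exp (- t)\<close>; there time \<open>t\<close> of \<open>\<rho>\<close> faces time
  \<open>L - t\<close> of \<open>\<xi>\<close>, and \<open>L - 2 * t\<close> tends to
  \<open>b\<close>.\<close>

lemma asymptotic_rays:
  fixes \<rho> \<xi> :: "real \<Rightarrow> 'a"
  assumes r: "iso_on \<rho> {0..}" and x: "iso_on \<xi> {0..}"
    and C: "\<And>t. 0 \<le> t \<Longrightarrow> dist (\<rho> t) (\<xi> t) \<le> C"
  shows "\<exists>c. ((\<lambda>t. dist (\<rho> t) (\<xi> (t + c))) \<longlongrightarrow> 0) at_top"
proof -
  obtain b where b: "((\<lambda>t. dist (\<xi> 0) (\<rho> t) - t) \<longlongrightarrow> b) at_top" "\<forall>t\<ge>0. b \<le> dist (\<xi> 0) (\<rho> t) - t"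
    using ray_bz[OF r] by blast
  have f2: "filterlim (\<lambda>t::real. 2 * t) at_top at_top" by real_asymp
  have lim: "((\<lambda>t. 2 * sinh C * (sinh t + sinh (t + C)) / sinh (2 * t - C) + \<bar>(dist (\<xi> 0) (\<rho> (2 * t)) - 2 * t) - b\<bar>)
      \<longlongrightarrow> 0 + \<bar>b - b\<bar>) at_top"
  proof (intro tendsto_add tendsto_rabs tendsto_diff tendsto_const)
    show "((\<lambda>t. 2 * sinh C * (sinh t + sinh (t + C)) / sinh (2 * t - C)) \<longlongrightarrow> 0) at_top"
      unfolding sinh_field_def[of "_ + _"] sinh_field_def[of "_ - _"] sinh_field_def[of t for t] by real_asymp
    show "((\<lambda>t. dist (\<xi> 0) (\<rho> (2 * t)) - 2 * t) \<longlongrightarrow> b) at_top"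
      using filterlim_compose[OF b(1) f2] by simp
  qed
  have "((\<lambda>t. dist (\<rho> t) (\<xi> (t + b))) \<longlongrightarrow> 0) at_top"
  proof (rule tendsto_sandwich[OF _ _ tendsto_const])
    show "((\<lambda>t. 2 * sinh C * (sinh t + sinh (t + C)) / sinh (2 * t - C) + \<bar>(dist (\<xi> 0) (\<rho> (2 * t)) - 2 * t) - b\<bar>)
      \<longlongrightarrow> 0) at_top" using lim by simp
    show "\<forall>\<^sub>F t in at_top. dist (\<rho> t) (\<xi> (t + b)) \<le> 2 * sinh C * (sinh t + sinh (t + C)) / sinh (2 * t - C) + \<bar>(dist (\<xi> 0) (\<rho> (2 * t)) - 2 * t) - b\<bar>"
      using eventually_gt_at_top[of "0::real"] eventually_gt_at_top[of C] eventually_ge_at_top[of "-b"]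
    proof eventually_elim
      case (elim t)
      define L where "L = dist (\<xi> 0) (\<rho> (2 * t))"
      have "b \<le> L - 2 * t" using b(2) elim by (simp add: L_def)
      have "dist (\<rho> t) (\<xi> (L - t)) \<le> 2 * sinh C * (sinh t + sinh (t + C)) / sinh (2 * t - C)"
        using asymptotic_estimate[OF r x C, of "2 * t"] elim by (simp add: L_def)
      moreover have "dist (\<xi> (L - t)) (\<xi> (t + b)) = \<bar>(L - 2 * t) - b\<bar>"
        using iso_onD[OF x, of "L - t" "t + b"] elim \<open>b \<le> L - 2 * t\<close> by simp
      moreover have "dist (\<rho> t) (\<xi> (t + b)) \<le> dist (\<rho> t) (\<xi> (L - t)) + dist (\<xi> (L - t)) (\<xi> (t + b))"
        by (rule dist_triangle)
      ultimately show ?case by (simp add: L_def)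
    qed
  qed simp
  then show ?thesis by blast
qed

text \<open>A diagonal argument in the form of the finite intersection property: in the applications
  \<open>F n\<close> imposes the wanted conditions on a window of times that grows with
  \<open>n\<close>.\<close>

lemma path_limit:
  fixes F :: "nat \<Rightarrow> (real \<Rightarrow> 'a) set"
  assumes "\<And>n. closed (F n)" "\<And>m n. m \<le> n \<Longrightarrow> F n \<subseteq> F m" "\<And>n. \<exists>\<gamma>\<in>F n. \<forall>t. dist x0 (\<gamma> t) \<le> r t"
  shows "\<exists>\<gamma>. \<forall>n. \<gamma> \<in> F n"
proof -
  have "{\<gamma>. \<forall>t. dist x0 (\<gamma> t) \<le> r t} \<inter> \<Inter> (F ` UNIV) \<noteq> {}"
  proof (rule compact_imp_fip_image[OF compact_paths])
    fix I :: "nat set" assume "finite I"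
    then obtain n where "\<forall>i\<in>I. i \<le> n" using finite_nat_set_iff_bounded_le by blast
    then have "F n \<subseteq> \<Inter> (F ` I)" using assms(2) by blast
    then show "{\<gamma>. \<forall>t. dist x0 (\<gamma> t) \<le> r t} \<inter> \<Inter> (F ` I) \<noteq> {}" using assms(3)[of n] by blast
  qed (use assms in auto)
  then show ?thesis by blast
qed

lemma ray_exists:
  fixes \<rho> :: "real \<Rightarrow> 'a"
  assumes r: "iso_on \<rho> {0..}"
  shows "\<exists>\<xi>\<in>bd. \<forall>t\<ge>0. dist (\<xi> t) (\<rho> t) \<le> 3 * dist x0 (\<rho> 0)"
proof -
  define D where "D = dist x0 (\<rho> 0)"
  define F where "F n = {\<gamma>. \<gamma> 0 = x0} \<inter> (\<Inter>t\<in>{..<0}. {\<gamma>. \<gamma> t = x0}) \<inter> {\<gamma>. iso_on \<gamma> {0..real n}}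
      \<inter> (\<Inter>t\<in>{0..real n}. {\<gamma>. dist (\<gamma> t) (\<rho> t) \<le> 3 * D})" for n
  have "\<exists>\<gamma>. \<forall>n. \<gamma> \<in> F n"
  proof (rule path_limit[where r = "\<lambda>t. \<bar>t\<bar>"])
    show "closed (F n)" for n unfolding F_def
      by (intro closed_Int closed_INT ballI closed_iso_conditions closed_Collect_eq closed_Collect_le
           continuous_on_const continuous_on_dist continuous_on_product_coordinates)
    show "F n \<subseteq> F m" if "m \<le> n" for m n
      using that unfolding F_def by (auto elim!: iso_on_subset)
    fix n
    \<comment> \<open>The surplus \<open>D\<close> ensures that the geodesic from \<open>x0\<close>
      to \<open>\<rho> T\<close> has length at least \<open>n\<close>.\<close>
    define T where "T = real n + D"
    define L where "L = dist x0 (\<rho> T)"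
    have D0: "0 \<le> D" by (simp add: D_def)
    have LT: "\<bar>L - T\<bar> \<le> D"
      using iso_onD[OF r, of 0 T] dist_triangle[of x0 "\<rho> T" "\<rho> 0"] D0
        dist_triangle[of "\<rho> 0" "\<rho> T" x0] by (simp add: L_def T_def D_def dist_commute)
    then have nL: "real n \<le> L" by (simp add: T_def)
    obtain \<sigma> where \<sigma>: "\<sigma> 0 = x0" "\<sigma> L = \<rho> T" "iso_on \<sigma> {0..L}"
      using ex_geodesic[of x0 "\<rho> T"] by (auto simp: L_def)
    define \<gamma> where "\<gamma> = (\<lambda>t. if 0 \<le> t \<and> t \<le> L then \<sigma> t else x0)"
    have d0: "dist x0 (\<sigma> t) = t" if "0 \<le> t" "t \<le> L" for t
      using iso_onD[OF \<sigma>(3), of 0 t] that by (simp add: \<sigma>)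
    \<comment> \<open>Up to time \<open>D\<close> the triangle inequality gives
      \<open>D + 2 * t\<close>. Later, comparison from the common far end gives
      \<open>2 * D\<close>, and aligning the two parametrisations costs at most another
      \<open>D\<close>.\<close>
    have near: "dist (\<sigma> t) (\<rho> t) \<le> 3 * D" if t: "0 \<le> t" "t \<le> real n" for t
    proof (cases "t \<le> D")
      case True
      have "dist (\<sigma> t) (\<rho> t) \<le> dist (\<sigma> t) x0 + dist x0 (\<rho> 0) + dist (\<rho> 0) (\<rho> t)" by metric
      then show ?thesis using d0[of t] iso_onD[OF r, of 0 t] t nL True by (simp add: D_def dist_commute)
    next
      case False
      define m where "m = min L T"
      have m: "m \<le> L" "m \<le> T" "0 \<le> m" "L - m + (T - m) \<le> D" "L - t \<le> m"
        using LT nL D0 t False by (auto simp: m_def T_def min_def abs_le_iff)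
      have "dist (\<sigma> (L - (L - t))) (\<rho> (T - (L - t))) \<le> dist (\<sigma> (L - m)) (\<rho> (T - m))"
      proof (rule comparison_mono[of "\<lambda>\<tau>. \<sigma> (L - \<tau>)" m "\<lambda>\<tau>. \<rho> (T - \<tau>)" "L - t"])
        show "iso_on (\<lambda>\<tau>. \<sigma> (L - \<tau>)) {0..m}"
          using iso_on_reverse[OF \<sigma>(3)] m by (auto intro: iso_on_subset)
        show "iso_on (\<lambda>\<tau>. \<rho> (T - \<tau>)) {0..m}"
          using iso_on_reverse[OF iso_on_subset[OF r, of "{0..T}"]] m by (auto intro: iso_on_subset)
      qed (use \<sigma> t nL m in auto)
      also have "\<dots> \<le> dist (\<sigma> (L - m)) x0 + dist x0 (\<rho> 0) + dist (\<rho> 0) (\<rho> (T - m))" by metric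
      also have "\<dots> = (L - m) + D + (T - m)"
        using d0[of "L - m"] iso_onD[OF r, of 0 "T - m"] m by (simp add: D_def dist_commute)
      finally have "dist (\<sigma> t) (\<rho> (t + T - L)) \<le> 2 * D" using m by (simp add: algebra_simps)
      moreover have "dist (\<rho> (t + T - L)) (\<rho> t) = \<bar>T - L\<bar>"
        using iso_onD[OF r, of "t + T - L" t] t LT False by simp
      moreover have "dist (\<sigma> t) (\<rho> t) \<le> dist (\<sigma> t) (\<rho> (t + T - L)) + dist (\<rho> (t + T - L)) (\<rho> t)"
        by (rule dist_triangle)
      ultimately show ?thesis using LT by simp
    qed
    have "\<gamma> \<in> F n"
      unfolding F_def \<gamma>_def using nL near \<sigma> by (auto simp: iso_on_def)
    moreover have "dist x0 (\<gamma> t) \<le> \<bar>t\<bar>" for t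
      using d0 by (auto simp: \<gamma>_def)
    ultimately show "\<exists>\<gamma>\<in>F n. \<forall>t. dist x0 (\<gamma> t) \<le> \<bar>t\<bar>" by blast
  qed
  then obtain \<xi> where \<xi>: "\<And>n. \<xi> \<in> F n" by blast
  have ex: "\<exists>n. t \<le> real n" for t by (rule real_arch_simple)
  have "iso_on \<xi> {0..}"
    unfolding iso_on_def
  proof (intro ballI)
    fix s t :: real assume st: "s \<in> {0..}" "t \<in> {0..}"
    obtain n where "max s t \<le> real n" using ex by blast
    then show "dist (\<xi> s) (\<xi> t) = \<bar>s - t\<bar>" using \<xi>[of n] st by (auto simp: F_def iso_on_def)
  qed
  moreover have "dist (\<xi> t) (\<rho> t) \<le> 3 * D" if "0 \<le> t" for t
  proof -
    obtain n where "t \<le> real n" using ex by blast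
    then show ?thesis using \<xi>[of n] that by (auto simp: F_def)
  qed
  ultimately show ?thesis using \<xi>[of 0] unfolding D_def
    by (intro bexI[of _ \<xi>]) (auto simp: bd_iff F_def)
qed

end

section \<open>Isometries\<close>

definition isometry :: "('a::metric_space \<Rightarrow> 'a) \<Rightarrow> bool" where
  "isometry g \<longleftrightarrow> bij g \<and> (\<forall>x y. dist (g x) (g y) = dist x y)"

lemma isometry_dist: "isometry g \<Longrightarrow> dist (g x) (g y) = dist x y"
  by (simp add: isometry_def)

lemma isometry_inv_app: "isometry g \<Longrightarrow> inv g (g x) = x" "isometry g \<Longrightarrow> g (inv g x) = x"
  by (simp_all add: isometry_def bij_is_inj bij_is_surj surj_f_inv_f)

lemma isometry_inv:
  assumes "isometry g" shows "isometry (inv g)"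
proof -
  have "dist (inv g x) (inv g y) = dist x y" for x y
    using isometry_dist[OF assms, of "inv g x" "inv g y"] by (simp add: isometry_inv_app assms)
  then show ?thesis using assms by (simp add: isometry_def bij_imp_bij_inv)
qed

lemma isometry_comp: "isometry g \<Longrightarrow> isometry h \<Longrightarrow> isometry (g \<circ> h)"
  by (simp add: isometry_def bij_comp)

lemma iso_on_isometry: "isometry g \<Longrightarrow> iso_on \<rho> S \<Longrightarrow> iso_on (\<lambda>t. g (\<rho> t)) S"
  by (simp add: iso_on_def isometry_dist)

context cat_m1_space
begin

section \<open>The action on the boundary\<close>

abbreviation act :: "('a \<Rightarrow> 'a) \<Rightarrow> (real \<Rightarrow> 'a) \<Rightarrow> (real \<Rightarrow> 'a)" where
  "act \<equiv> bd_act x0"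

lemma bdd_above_dist_iff:
  "bdd_above ((\<lambda>t. dist (\<eta> t) (\<rho> t)) ` {0..}) \<longleftrightarrow> (\<exists>C. \<forall>t\<ge>(0::real). dist (\<eta> t) (\<rho> t) \<le> C)"
  by (auto simp: bdd_above_def)

lemma bd_unique_near:
  assumes "\<xi> \<in> bd" "\<eta> \<in> bd" "\<And>t. 0 \<le> t \<Longrightarrow> dist (\<xi> t) (\<rho> t) \<le> C" "\<And>t. 0 \<le> t \<Longrightarrow> dist (\<eta> t) (\<rho> t) \<le> D"
  shows "\<xi> = \<eta>"
proof (rule bd_unique[OF assms(1,2)])
  fix t :: real assume "0 \<le> t"
  then show "dist (\<xi> t) (\<eta> t) \<le> C + D"
    using assms(3)[of t] assms(4)[of t] dist_triangle2[of "\<xi> t" "\<eta> t" "\<rho> t"] by simp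
qed

lemma act_props:
  assumes "isometry g" "\<xi> \<in> bd"
  shows "act g \<xi> \<in> bd \<and> (\<exists>C. \<forall>t\<ge>0. dist (act g \<xi> t) (g (\<xi> t)) \<le> C)"
proof -
  have ex: "\<exists>!\<eta>. \<eta> \<in> bd \<and> (\<exists>C. \<forall>t\<ge>0. dist (\<eta> t) (g (\<xi> t)) \<le> C)"
  proof (rule ex_ex1I)
    show "\<exists>\<eta>. \<eta> \<in> bd \<and> (\<exists>C. \<forall>t\<ge>0. dist (\<eta> t) (g (\<xi> t)) \<le> C)"
      using ray_exists[OF iso_on_isometry[OF assms(1) bd_isoray[OF assms(2)]]] by blast
    fix \<eta> \<eta>' assume "\<eta> \<in> bd \<and> (\<exists>C. \<forall>t\<ge>0. dist (\<eta> t) (g (\<xi> t)) \<le> C)"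
      "\<eta>' \<in> bd \<and> (\<exists>C. \<forall>t\<ge>0. dist (\<eta>' t) (g (\<xi> t)) \<le> C)"
    then obtain C D where "\<eta> \<in> bd" "\<eta>' \<in> bd" "\<And>t. 0 \<le> t \<Longrightarrow> dist (\<eta> t) (g (\<xi> t)) \<le> C"
      "\<And>t. 0 \<le> t \<Longrightarrow> dist (\<eta>' t) (g (\<xi> t)) \<le> D" by blast
    then show "\<eta> = \<eta>'" by (rule bd_unique_near[where \<rho> = "\<lambda>t. g (\<xi> t)"])
  qed
  show ?thesis using theI'[OF ex] unfolding bd_act_def bdd_above_dist_iff .
qed

lemma act_bd: "isometry g \<Longrightarrow> \<xi> \<in> bd \<Longrightarrow> act g \<xi> \<in> bd"
  using act_props by blast

lemma act_eqI:
  assumes "isometry g" "\<xi> \<in> bd" "\<eta> \<in> bd" "\<And>t. 0 \<le> t \<Longrightarrow> dist (\<eta> t) (g (\<xi> t)) \<le> C"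
  shows "act g \<xi> = \<eta>"
proof -
  obtain D where "\<And>t. 0 \<le> t \<Longrightarrow> dist (act g \<xi> t) (g (\<xi> t)) \<le> D" using act_props[OF assms(1,2)] by blast
  then show ?thesis
    by (rule bd_unique_near[OF act_bd[OF assms(1,2)] assms(3) _ assms(4)])
qed

lemma act_comp:
  assumes "isometry g" "isometry h" "\<xi> \<in> bd"
  shows "act (g \<circ> h) \<xi> = act g (act h \<xi>)"
proof -
  obtain C where C: "\<forall>t\<ge>0. dist (act h \<xi> t) (h (\<xi> t)) \<le> C" using act_props assms by blast
  obtain D where D: "\<forall>t\<ge>0. dist (act g (act h \<xi>) t) (g (act h \<xi> t)) \<le> D"
    using act_props[OF assms(1) act_bd[OF assms(2,3)]] by blast
  show ?thesis
  proof (rule act_eqI)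
    fix t :: real assume t: "0 \<le> t"
    have "dist (act g (act h \<xi>) t) ((g \<circ> h) (\<xi> t))
        \<le> dist (act g (act h \<xi>) t) (g (act h \<xi> t)) + dist (g (act h \<xi> t)) (g (h (\<xi> t)))"
      unfolding o_def by (rule dist_triangle)
    then show "dist (act g (act h \<xi>) t) ((g \<circ> h) (\<xi> t)) \<le> D + C"
      using C D t isometry_dist[OF assms(1), of "act h \<xi> t" "h (\<xi> t)"] by force
  qed (use assms in \<open>auto intro: act_bd isometry_comp\<close>)
qed

lemma act_id: "\<xi> \<in> bd \<Longrightarrow> act id \<xi> = \<xi>"
  by (rule act_eqI[where C = 0]) (auto simp: isometry_def)

lemma act_inv_act: "isometry g \<Longrightarrow> \<xi> \<in> bd \<Longrightarrow> act (inv g) (act g \<xi>) = \<xi>"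
  using act_comp[OF isometry_inv, of g g \<xi>] isometry_inv_app(1)[of g]
  by (simp add: act_id o_def flip: id_def)

lemma act_act_inv: "isometry g \<Longrightarrow> \<xi> \<in> bd \<Longrightarrow> act g (act (inv g) \<xi>) = \<xi>"
  using act_comp[OF _ isometry_inv, of g g \<xi>] isometry_inv_app(2)[of g]
  by (simp add: act_id o_def flip: id_def)

lemma tendsto_real_shift: "((\<lambda>t::real. f t) \<longlongrightarrow> l) at_top \<Longrightarrow> ((\<lambda>t. f (t + c)) \<longlongrightarrow> l) at_top" for l :: real
  by (rule filterlim_compose[of f "nhds l" at_top "\<lambda>t. t + c"]) (auto, real_asymp)

text \<open>By \<open>asymptotic_rays\<close> the image ray \<open>\<lambda>t. g (\<xi> t)\<close>
  merges with \<open>act g \<xi>\<close> after a time shift, so Busemann functions computed along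
  the two rays differ by that shift.\<close>

lemma act_shift:
  assumes g: "isometry g" and \<xi>: "\<xi> \<in> bd"
  shows "((\<lambda>t. dist (g (\<xi> t)) (act g \<xi> (t + bz \<xi> (inv g x0)))) \<longlongrightarrow> 0) at_top"
    and "bz (act g \<xi>) (g x) = bz \<xi> x - bz \<xi> (inv g x0)"
proof -
  obtain c where c: "((\<lambda>t. dist (g (\<xi> t)) (act g \<xi> (t + c))) \<longlongrightarrow> 0) at_top"
  proof -
    obtain C where C: "\<forall>t\<ge>0. dist (act g \<xi> t) (g (\<xi> t)) \<le> C" using act_props[OF g \<xi>] by blast
    then show ?thesis
      using asymptotic_rays[OF iso_on_isometry[OF g bd_isoray[OF \<xi>]] bd_isoray[OF act_bd[OF g \<xi>]], of C]
      by (auto simp: dist_commute intro: that)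
  qed
  have key: "bz \<xi> x = bz (act g \<xi>) (g x) + c" for x
  proof -
    have 1: "((\<lambda>t. dist (g x) (act g \<xi> (t + c)) - (t + c) + c) \<longlongrightarrow> bz (act g \<xi>) (g x) + c) at_top"
      by (intro tendsto_intros tendsto_real_shift[OF bz_tendsto[OF act_bd[OF g \<xi>]], of "g x" c])
    have "((\<lambda>t. dist (g x) (g (\<xi> t)) - dist (g x) (act g \<xi> (t + c))) \<longlongrightarrow> 0) at_top"
    proof (rule Lim_null_comparison[OF _ c])
      have "norm (dist z p - dist z q) \<le> dist p q" for z p q :: 'a
        by (simp, metis abs_dist_diff_le dist_commute)
      then show "\<forall>\<^sub>F t in at_top. norm (dist (g x) (g (\<xi> t)) - dist (g x) (act g \<xi> (t + c))) \<le> dist (g (\<xi> t)) (act g \<xi> (t + c))"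
        by simp
    qed
    from tendsto_add[OF this 1] have "((\<lambda>t. dist x (\<xi> t) - t) \<longlongrightarrow> bz (act g \<xi>) (g x) + c) at_top"
      by (simp add: isometry_dist[OF g])
    then show ?thesis by (rule tendsto_unique[OF trivial_limit_at_top_linorder bz_tendsto[OF \<xi>]])
  qed
  \<comment> \<open>\<open>g\<close> sends \<open>inv g x0\<close> to \<open>x0\<close>, where the
    Busemann function vanishes; this identifies the shift.\<close>
  have "c = bz \<xi> (inv g x0)"
    using key[of "inv g x0"] by (simp add: isometry_inv_app g bz_0 act_bd \<xi>)
  then show "((\<lambda>t. dist (g (\<xi> t)) (act g \<xi> (t + bz \<xi> (inv g x0)))) \<longlongrightarrow> 0) at_top"
    "bz (act g \<xi>) (g x) = bz \<xi> x - bz \<xi> (inv g x0)" using c key[of x] by auto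
qed

lemma bz_act_neg:
  assumes "isometry g" "\<xi> \<in> bd"
  shows "bz (act g \<xi>) (g x0) = - bz \<xi> (inv g x0)"
  using act_shift(2)[OF assms, of x0] by (simp add: bz_0 assms)

text \<open>An isometry shifts the two rays by different times, so Gromov products at unequal times
  are needed. They are monotone in each time and lie between the truncations at the smaller and at
  the larger shift.\<close>

lemma trunc_shift_tendsto:
  assumes "\<xi> \<in> bd" "\<eta> \<in> bd" "\<xi> \<noteq> \<eta>"
  shows "((\<lambda>u. ((u + c) + (u + e) - dist (\<xi> (u + c)) (\<eta> (u + e))) / 2) \<longlongrightarrow> gromov_bb \<xi> \<eta>) at_top"
proof (rule tendsto_sandwich)
  define m M where "m = min c e" and "M = max c e"
  show "((\<lambda>u. trunc (u + m) \<xi> \<eta>) \<longlongrightarrow> gromov_bb \<xi> \<eta>) at_top"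
    "((\<lambda>u. trunc (u + M) \<xi> \<eta>) \<longlongrightarrow> gromov_bb \<xi> \<eta>) at_top"
    by (intro tendsto_real_shift trunc_tendsto assms)+
  have mono: "(a + b - dist (\<xi> a) (\<eta> b)) / 2 \<le> (a' + b' - dist (\<xi> a') (\<eta> b')) / 2"
    if "0 \<le> a" "a \<le> a'" "0 \<le> b" "b \<le> b'" for a a' b b'
  proof -
    have "dist (\<xi> a') (\<eta> b') \<le> dist (\<xi> a') (\<xi> a) + dist (\<xi> a) (\<eta> b) + dist (\<eta> b) (\<eta> b')" by metric
    then show ?thesis using bd_dist[OF assms(1), of a' a] bd_dist[OF assms(2), of b b'] that by simp
  qed
  have trunc': "trunc a \<xi> \<eta> = (a + a - dist (\<xi> a) (\<eta> a)) / 2" for a by (simp add: trunc_def)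
  show "\<forall>\<^sub>F u in at_top. trunc (u + m) \<xi> \<eta> \<le> ((u + c) + (u + e) - dist (\<xi> (u + c)) (\<eta> (u + e))) / 2"
    using eventually_ge_at_top[of "-m"]
    by eventually_elim (unfold trunc', rule mono, auto simp: m_def)
  show "\<forall>\<^sub>F u in at_top. ((u + c) + (u + e) - dist (\<xi> (u + c)) (\<eta> (u + e))) / 2 \<le> trunc (u + M) \<xi> \<eta>"
    using eventually_ge_at_top[of "-m"]
    by eventually_elim (unfold trunc', rule mono, auto simp: m_def M_def)
qed

text \<open>Since \<open>g\<close> preserves distances, only the two time shifts of
  \<open>act_shift\<close> change the truncated product, each with weight one half. The formula can
  fail on the diagonal, where the default value 0 does not transform this way.\<close>

lemma gromov_act:
  assumes g: "isometry g" and \<xi>: "\<xi> \<in> bd" and \<eta>: "\<eta> \<in> bd" and ne: "\<xi> \<noteq> \<eta>"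
  shows "gromov_bb (act g \<xi>) (act g \<eta>) = gromov_bb \<xi> \<eta> + (bz \<xi> (inv g x0) + bz \<eta> (inv g x0)) / 2"
proof -
  define c e where "c = bz \<xi> (inv g x0)" and "e = bz \<eta> (inv g x0)"
  have ne': "act g \<xi> \<noteq> act g \<eta>" using act_inv_act[OF g] \<xi> \<eta> ne by metis
  have "((\<lambda>u. (dist (act g \<xi> (u + c)) (act g \<eta> (u + e)) - dist (g (\<xi> u)) (g (\<eta> u))) / 2) \<longlongrightarrow> 0) at_top"
  proof (rule Lim_null_comparison)
    show "((\<lambda>u. dist (g (\<xi> u)) (act g \<xi> (u + c)) + dist (g (\<eta> u)) (act g \<eta> (u + e))) \<longlongrightarrow> 0) at_top"
      using tendsto_add[OF act_shift(1)[OF g \<xi>] act_shift(1)[OF g \<eta>]] by (simp add: c_def e_def)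
    have q: "norm ((dist p q - dist p' q') / 2) \<le> dist p' p + dist q' q" for p q p' q' :: 'a
    proof -
      have "dist p q \<le> dist p' p + dist p' q' + dist q' q" "dist p' q' \<le> dist p' p + dist p q + dist q' q"
        by metric+
      then show ?thesis by (simp add: abs_le_iff)
    qed
    show "\<forall>\<^sub>F u in at_top. norm ((dist (act g \<xi> (u + c)) (act g \<eta> (u + e)) - dist (g (\<xi> u)) (g (\<eta> u))) / 2)
      \<le> dist (g (\<xi> u)) (act g \<xi> (u + c)) + dist (g (\<eta> u)) (act g \<eta> (u + e))"
      by (intro always_eventually allI q)
  qed
  from tendsto_add[OF this trunc_shift_tendsto[OF act_bd[OF g \<xi>] act_bd[OF g \<eta>] ne', of c e]]
  have "((\<lambda>u. trunc u \<xi> \<eta> + (c + e) / 2) \<longlongrightarrow> gromov_bb (act g \<xi>) (act g \<eta>)) at_top"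
    by (simp add: trunc_def isometry_dist[OF g] field_simps)
  moreover have "((\<lambda>u. trunc u \<xi> \<eta> + (c + e) / 2) \<longlongrightarrow> gromov_bb \<xi> \<eta> + (c + e) / 2) at_top"
    by (intro tendsto_intros trunc_tendsto \<xi> \<eta> ne)
  ultimately show ?thesis using tendsto_unique by (force simp: c_def e_def)
qed

text \<open>A ray close to \<open>\<xi>\<close> at a large time \<open>s\<close> has Gromov product
  at least \<open>s - 1\<close> with it, \<open>g\<close> lowers the product by at most
  \<open>D\<close>, and \<open>sinh_dist_le\<close> converts the result into closeness at time
  \<open>t\<close>.\<close>

lemma continuous_on_act:
  assumes g: "isometry g"
  shows "continuous_on bd (act g)"
proof (rule continuous_on_coordinatewise_then_product, unfold continuous_on_def, intro ballI tendstoI)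
  fix t \<xi> and e :: real assume \<xi>: "\<xi> \<in> bd" and e: "0 < e"
  define D where "D = dist (inv g x0) x0"
  obtain s where s: "0 \<le> s" "2 * (\<bar>sinh t\<bar> * exp (D + 1 - s)) < e"
  proof -
    have "((\<lambda>s. 2 * (\<bar>sinh t\<bar> * exp (D + 1 - s))) \<longlongrightarrow> 0) at_top" by real_asymp
    then have "\<forall>\<^sub>F s in at_top. 2 * (\<bar>sinh t\<bar> * exp (D + 1 - s)) < e" using e by (rule order_tendstoD)
    then have "\<forall>\<^sub>F s in at_top. 0 \<le> s \<and> 2 * (\<bar>sinh t\<bar> * exp (D + 1 - s)) < e"
      using eventually_ge_at_top[of "0::real"] by eventually_elim simp
    then show ?thesis using that by (metis (no_types, lifting) eventually_at_top_linorder order_refl)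
  qed
  have "((\<lambda>\<xi>. \<xi> s) \<longlongrightarrow> \<xi> s) (at \<xi> within bd)"
    using continuous_on_eval[of bd s] \<xi> unfolding continuous_on_def by blast
  from tendstoD[OF this, of 1] have "\<forall>\<^sub>F \<eta> in at \<xi> within bd. dist (\<eta> s) (\<xi> s) < 1" by simp
  moreover have "\<forall>\<^sub>F \<eta> in at \<xi> within bd. \<eta> \<in> bd \<and> \<eta> \<noteq> \<xi>"
    by (auto simp: eventually_at_filter)
  ultimately show "\<forall>\<^sub>F \<eta> in at \<xi> within bd. dist (act g \<eta> t) (act g \<xi> t) < e"
  proof eventually_elim
    case (elim \<eta>)
    then have \<eta>: "\<eta> \<in> bd" "\<xi> \<noteq> \<eta>" by auto
    show ?case
    proof (cases "0 \<le> t")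
      case False
      then show ?thesis using act_bd[OF g \<xi>] act_bd[OF g \<eta>(1)] e by (simp add: bd_rays_def)
    next
      case True
      have ne': "act g \<eta> \<noteq> act g \<xi>" using act_inv_act[OF g] \<xi> \<eta> by metis
      have "s - 1 \<le> gromov_bb \<xi> \<eta>"
        using trunc_le[OF \<xi> \<eta>, of s] s elim by (simp add: trunc_def dist_commute)
      moreover have "gromov_bb (act g \<eta>) (act g \<xi>) \<ge> gromov_bb \<xi> \<eta> - D"
        using gromov_act[OF g \<eta>(1) \<xi>] \<eta> bz_abs_le[OF \<xi>, of "inv g x0"] bz_abs_le[OF \<eta>(1), of "inv g x0"]
        by (simp add: D_def gromov_bb_commute[of \<eta>])
      ultimately have le: "exp (- gromov_bb (act g \<eta>) (act g \<xi>)) \<le> exp (D + 1 - s)" by simp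
      define d where "d = dist (act g \<eta> t) (act g \<xi> t)"
      have "d / 2 \<le> sinh (d / 2)"
        by (rule le_sinh) (simp add: d_def)
      also have "\<dots> \<le> sinh t * exp (- gromov_bb (act g \<eta>) (act g \<xi>))"
        unfolding d_def by (rule sinh_dist_le[OF act_bd[OF g \<eta>(1)] act_bd[OF g \<xi>] ne' True])
      also have "\<dots> \<le> \<bar>sinh t\<bar> * exp (D + 1 - s)"
        using le True by (intro mult_mono) auto
      finally show ?thesis using s by (simp add: d_def)
    qed
  qed
qed

section \<open>Geodesic lines and cocompactness\<close>

text \<open>Stewart's inequality at the midpoint. The ratio of \<open>cosh (h + 1)\<close> to
  \<open>cosh h\<close> is at most \<open>exp 1\<close>, so the bound does not depend on
  \<open>h\<close>; the 2 comes from \<open>2 * exp 1 \<le> exp 2\<close>.\<close>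

lemma midpoint_near:
  fixes x :: 'a
  assumes \<sigma>: "iso_on \<sigma> {0..2 * h}" and h: "0 < h" and x: "dist x (\<sigma> 0) \<le> h + 1" "dist x (\<sigma> (2 * h)) \<le> h + 1"
  shows "dist x (\<sigma> h) \<le> 2"
proof -
  have "cosh (dist x (\<sigma> h)) * (2 * sinh h * cosh h)
      \<le> cosh (dist x (\<sigma> 0)) * sinh h + cosh (dist x (\<sigma> (2 * h))) * sinh h"
    using stewart[OF \<sigma>, of h x] h by (simp add: sinh_double mult.assoc)
  also have "\<dots> \<le> cosh (h + 1) * sinh h + cosh (h + 1) * sinh h"
    using x h by (intro add_mono mult_right_mono iffD2[OF cosh_real_nonneg_le_iff]) auto
  finally have "(cosh (dist x (\<sigma> h)) * cosh h) * (2 * sinh h) \<le> cosh (h + 1) * (2 * sinh h)"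
    by (simp add: algebra_simps)
  then have "cosh (dist x (\<sigma> h)) * cosh h \<le> cosh (h + 1)" using h by simp
  also have "\<dots> \<le> exp 1 * cosh h"
  proof -
    have "exp (- h - 1) \<le> exp (1 - h)" by simp
    moreover have "exp 1 * cosh h = (exp (h + 1) + exp (1 - h)) / 2"
      by (simp add: cosh_field_def exp_add exp_diff exp_minus field_simps)
    moreover have "cosh (h + 1) = (exp (h + 1) + exp (- h - 1)) / 2"
      by (simp add: cosh_field_def)
    ultimately show ?thesis by argo
  qed
  finally have "cosh (dist x (\<sigma> h)) \<le> exp 1" by simp
  then have "exp (dist x (\<sigma> h)) \<le> 2 * exp 1" using exp_half_le_cosh[of "dist x (\<sigma> h)"] by linarith
  also have "\<dots> \<le> exp 1 * exp (1::real)" using exp_ge_add_one_self[of "1::real"] by (intro mult_right_mono) auto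
  also have "\<dots> = exp (2::real)" by (simp flip: exp_add)
  finally show ?thesis by simp
qed

text \<open>Geodesics between points far out on the two rays, parametrised from their midpoints, subconverge.\<close>
lemma line_exists:
  assumes a: "a \<in> bd" and b: "b \<in> bd" and ne: "a \<noteq> b"
  defines "k \<equiv> gromov_bb a b"
  shows "\<exists>\<gamma>. geodesic_line \<gamma> \<and> (\<forall>s\<ge>0. dist (\<gamma> s) (b (s + k)) \<le> 3 \<and> dist (\<gamma> (- s)) (a (s + k)) \<le> 3)"
proof -
  have k0: "0 \<le> k" using gromov_bb_nonneg a b by (simp add: k_def)
  define F where "F n = {\<gamma>. iso_on \<gamma> {- real n..real n}}
      \<inter> (\<Inter>s\<in>{0..real n}. {\<gamma>. dist (\<gamma> s) (b (s + k)) \<le> 3} \<inter> {\<gamma>. dist (\<gamma> (- s)) (a (s + k)) \<le> 3})" for n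
  have "\<exists>\<gamma>. \<forall>n. \<gamma> \<in> F n"
  proof (rule path_limit[where r = "\<lambda>t. \<bar>t\<bar> + k + 3"])
    show "closed (F n)" for n unfolding F_def
      by (intro closed_Int closed_INT ballI closed_iso_conditions closed_Collect_le
           continuous_on_const continuous_on_dist continuous_on_product_coordinates)
    show "F n \<subseteq> F m" if "m \<le> n" for m n
      using that unfolding F_def by (auto elim!: iso_on_subset)
    fix N
    have "\<forall>\<^sub>F n in at_top. k - 1 < trunc n a b"
      using order_tendstoD(1)[OF trunc_tendsto[OF a b ne], of "k - 1"] by (simp add: k_def)
    then have "\<forall>\<^sub>F n in at_top. k - 1 < trunc n a b \<and> real N + k + 1 \<le> n"
      using eventually_ge_at_top[of "real N + k + 1"] by eventually_elim simp
    then obtain n where n: "k - 1 < trunc n a b" "real N + k + 1 \<le> n"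
      by (metis (no_types, lifting) eventually_at_top_linorder order_refl)
    \<comment> \<open>\<open>a \<kappa>\<close> and \<open>b \<kappa>\<close> correspond to the
      centre of the comparison tripod. Each is at distance \<open>h\<close>, half the length of
      \<open>\<sigma>\<close>, from the end of its own ray segment and, being within 1 of the other,
      within \<open>h + 1\<close> of the opposite end.\<close>
    define \<kappa> h where "\<kappa> = trunc n a b" and "h = n - \<kappa>"
    have \<kappa>: "0 \<le> \<kappa>" "\<kappa> \<le> k" "k - 1 < \<kappa>"
      using trunc_nonneg[OF a b, of n] trunc_le[OF a b ne, of n] n k0 by (auto simp: \<kappa>_def k_def)
    have h: "real N + 1 \<le> h" "0 < h" "n = h + \<kappa>" using \<kappa> n by (auto simp: h_def)
    have l: "dist (a n) (b n) = 2 * h" by (simp add: h_def \<kappa>_def trunc_def)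
    obtain \<sigma> where \<sigma>: "\<sigma> 0 = a n" "\<sigma> (2 * h) = b n" "iso_on \<sigma> {0..2 * h}"
      using ex_geodesic[of "a n" "b n"] l by auto
    have ab: "dist (a \<kappa>) (b \<kappa>) \<le> 1" using dist_le_1[OF a b \<kappa>(1)] \<kappa>(2) by (simp add: k_def)
    have ends: "dist (a \<kappa>) (a n) = h" "dist (b \<kappa>) (b n) = h"
      using bd_dist[OF a, of \<kappa> n] bd_dist[OF b, of \<kappa> n] \<kappa> h by auto
    have ends': "dist (a \<kappa>) (b n) \<le> h + 1" "dist (b \<kappa>) (a n) \<le> h + 1"
      using ab ends dist_triangle[of "a \<kappa>" "b n" "b \<kappa>"] dist_triangle[of "b \<kappa>" "a n" "a \<kappa>"]
      by (simp_all add: dist_commute)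
    have "dist (a \<kappa>) (\<sigma> h) \<le> 2"
      by (rule midpoint_near[OF \<sigma>(3) h(2)]) (use ends' ends in \<open>simp_all add: \<sigma>\<close>)
    moreover have "dist (b \<kappa>) (\<sigma> h) \<le> 2"
      by (rule midpoint_near[OF \<sigma>(3) h(2)]) (use ends' ends in \<open>simp_all add: \<sigma>\<close>)
    ultimately
    have mid: "dist (\<sigma> h) (a \<kappa>) \<le> 2" "dist (\<sigma> h) (b \<kappa>) \<le> 2" by (simp_all add: dist_commute)
    \<comment> \<open>The bound 2 at the midpoint carries over to the rest of each half by
      comparison from the endpoint that \<open>\<sigma>\<close> and the ray share. The third unit
      pays for replacing \<open>\<kappa>\<close>, which varies with \<open>n\<close>, by its limit
      \<open>k\<close>.\<close>
    have near_b: "dist (\<sigma> (h + s)) (b (s + k)) \<le> 3" if s: "0 \<le> s" "s \<le> h" for s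
    proof -
      have "dist (\<sigma> (2 * h - (h - s))) (b (n - (h - s))) \<le> dist (\<sigma> (2 * h - h)) (b (n - h))"
      proof (rule comparison_mono[of "\<lambda>\<tau>. \<sigma> (2 * h - \<tau>)" h "\<lambda>\<tau>. b (n - \<tau>)" "h - s"])
        show "iso_on (\<lambda>\<tau>. \<sigma> (2 * h - \<tau>)) {0..h}"
          using iso_on_reverse[OF \<sigma>(3)] h by (auto intro: iso_on_subset)
        show "iso_on (\<lambda>\<tau>. b (n - \<tau>)) {0..h}"
          using iso_on_reverse[OF bd_iso[OF b, of n]] h \<kappa> by (auto intro: iso_on_subset)
      qed (use \<sigma> s in auto)
      also have "\<dots> \<le> 2" using mid h by simp
      finally have "dist (\<sigma> (h + s)) (b (s + \<kappa>)) \<le> 2" using h by (simp add: algebra_simps)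
      moreover have "dist (b (s + \<kappa>)) (b (s + k)) \<le> 1" using bd_dist[OF b, of "s + \<kappa>" "s + k"] s \<kappa> by simp
      ultimately show ?thesis using dist_triangle[of "\<sigma> (h + s)" "b (s + k)" "b (s + \<kappa>)"] by simp
    qed
    have near_a: "dist (\<sigma> (h - s)) (a (s + k)) \<le> 3" if s: "0 \<le> s" "s \<le> h" for s
    proof -
      have "dist (\<sigma> (h - s)) (a (n - (h - s))) \<le> dist (\<sigma> h) (a (n - h))"
      proof (rule comparison_mono[of \<sigma> h "\<lambda>\<tau>. a (n - \<tau>)" "h - s"])
        show "iso_on \<sigma> {0..h}" using \<sigma>(3) h by (auto intro: iso_on_subset)
        show "iso_on (\<lambda>\<tau>. a (n - \<tau>)) {0..h}"
          using iso_on_reverse[OF bd_iso[OF a, of n]] h \<kappa> by (auto intro: iso_on_subset)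
      qed (use \<sigma> s in auto)
      also have "\<dots> \<le> 2" using mid h by simp
      finally have "dist (\<sigma> (h - s)) (a (s + \<kappa>)) \<le> 2" using h by (simp add: algebra_simps)
      moreover have "dist (a (s + \<kappa>)) (a (s + k)) \<le> 1" using bd_dist[OF a, of "s + \<kappa>" "s + k"] s \<kappa> by simp
      ultimately show ?thesis using dist_triangle[of "\<sigma> (h - s)" "a (s + k)" "a (s + \<kappa>)"] by simp
    qed
    define \<gamma> where "\<gamma> s = (if \<bar>s\<bar> \<le> h then \<sigma> (h + s) else x0)" for s
    have "iso_on \<gamma> {- real N..real N}"
      using iso_onD[OF \<sigma>(3)] h by (auto simp: iso_on_def \<gamma>_def)
    moreover have "dist (\<gamma> s) (b (s + k)) \<le> 3" "dist (\<gamma> (- s)) (a (s + k)) \<le> 3" if "s \<in> {0..real N}" for s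
      using near_a[of s] near_b[of s] that h by (auto simp: \<gamma>_def)
    ultimately have "\<gamma> \<in> F N" by (auto simp: F_def)
    moreover have "dist x0 (\<gamma> t) \<le> \<bar>t\<bar> + k + 3" for t
    proof (cases "\<bar>t\<bar> \<le> h")
      case True
      show ?thesis
      proof (cases "0 \<le> t")
        case t: True
        then show ?thesis using True near_b[of t] bd_dist0[OF b, of "t + k"] k0
            dist_triangle[of x0 "\<gamma> t" "b (t + k)"] by (simp add: \<gamma>_def dist_commute)
      next
        case t: False
        then show ?thesis using True near_a[of "- t"] bd_dist0[OF a, of "- t + k"] k0
            dist_triangle[of x0 "\<gamma> t" "a (- t + k)"] by (simp add: \<gamma>_def dist_commute)
      qed
    qed (use k0 in \<open>simp add: \<gamma>_def\<close>)
    ultimately show "\<exists>\<gamma>\<in>F N. \<forall>t. dist x0 (\<gamma> t) \<le> \<bar>t\<bar> + k + 3" by blast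
  qed
  then obtain \<gamma> where \<gamma>: "\<And>n. \<gamma> \<in> F n" by blast
  have "geodesic_line \<gamma>"
    unfolding geodesic_line_def
  proof (intro allI)
    fix s t :: real
    obtain n where "max \<bar>s\<bar> \<bar>t\<bar> \<le> real n" using real_arch_simple by blast
    then show "dist (\<gamma> s) (\<gamma> t) = \<bar>s - t\<bar>"
      using \<gamma>[of n] iso_onD[of \<gamma> "{- real n..real n}" s t] by (simp add: F_def abs_le_iff)
  qed
  moreover have "dist (\<gamma> s) (b (s + k)) \<le> 3 \<and> dist (\<gamma> (- s)) (a (s + k)) \<le> 3" if "0 \<le> s" for s
  proof -
    obtain n where "s \<le> real n" using real_arch_simple by blast
    then show ?thesis using \<gamma>[of n] that by (auto simp: F_def)
  qed
  ultimately show ?thesis by blast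
qed

text \<open>The base point lies on a line of the hull, and the half of this line starting at
  \<open>x0\<close> is the ray \<open>a\<close>; so that ray stays in the hull. Any other
  \<open>\<zeta>\<close> follows \<open>a\<close> up to time \<open>k\<close> by
  \<open>dist_le_1\<close> and afterwards the line joining \<open>a\<close> to
  \<open>\<zeta>\<close> from \<open>line_exists\<close>.\<close>

lemma radial_near_hull:
  assumes L: "L \<subseteq> bd" and o: "x0 \<in> join_hull x0 L" and \<zeta>: "\<zeta> \<in> L" and t: "0 \<le> t"
  shows "\<exists>y\<in>join_hull x0 L. dist (\<zeta> t) y \<le> 3"
proof -
  obtain \<gamma> t0 a b where \<gamma>: "x0 = \<gamma> t0" "geodesic_line \<gamma>" "a \<in> L" "b \<in> L"
     and a: "bdd_above ((\<lambda>s. dist (\<gamma> s) (a s)) ` {0..})" and b: "bdd_above ((\<lambda>s. dist (\<gamma> (- s)) (b s)) ` {0..})"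
    using o unfolding join_hull_def by auto
  define \<eta> where "\<eta> s = (if s < 0 then x0 else \<gamma> (t0 + s))" for s
  have "\<eta> \<in> bd" using \<gamma> by (auto simp: bd_rays_def \<eta>_def geodesic_line_def)
  moreover obtain C where C: "\<forall>s\<ge>0. dist (\<gamma> s) (a s) \<le> C" using a by (auto simp: bdd_above_dist_iff)
  ultimately have "\<eta> = a"
  proof (intro bd_unique[of \<eta> a "\<bar>t0\<bar> + C"])
    fix s :: real assume s: "0 \<le> s"
    have "dist (\<eta> s) (a s) \<le> dist (\<eta> s) (\<gamma> s) + dist (\<gamma> s) (a s)" by (rule dist_triangle)
    then show "dist (\<eta> s) (a s) \<le> \<bar>t0\<bar> + C"
      using C s \<gamma>(2) by (force simp: \<eta>_def geodesic_line_def)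
  qed (use \<gamma> L in auto)
  then have aH: "a s \<in> join_hull x0 L" if "0 \<le> s" for s
  proof -
    have "a s = \<gamma> (t0 + s)" using fun_cong[OF \<open>\<eta> = a\<close>, of s] that by (simp add: \<eta>_def)
    then show ?thesis using \<gamma>(2-4) a b unfolding join_hull_def by blast
  qed
  show ?thesis
  proof (cases "\<zeta> = a")
    case True
    then show ?thesis using aH[OF t] by (intro bexI[of _ "a t"]) auto
  next
    case False
    define k where "k = gromov_bb a \<zeta>"
    have bds: "a \<in> bd" "\<zeta> \<in> bd" using L \<gamma> \<zeta> by auto
    show ?thesis
    proof (cases "t \<le> k")
      case True
      then show ?thesis using aH[OF t] dist_le_1[OF bds(2,1) t]
        by (intro bexI[of _ "a t"]) (auto simp: k_def gromov_bb_commute)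
    next
      case t': False
      obtain \<gamma>' where \<gamma>': "geodesic_line \<gamma>'"
        "\<And>s. 0 \<le> s \<Longrightarrow> dist (\<gamma>' s) (\<zeta> (s + k)) \<le> 3" "\<And>s. 0 \<le> s \<Longrightarrow> dist (\<gamma>' (- s)) (a (s + k)) \<le> 3"
        using line_exists[OF bds] False unfolding k_def by blast
      have k0: "0 \<le> k" using gromov_bb_nonneg bds by (simp add: k_def)
      have "dist (\<gamma>' s) (\<zeta> s) \<le> 3 + k" "dist (\<gamma>' (- s)) (a s) \<le> 3 + k" if "0 \<le> s" for s
        using \<gamma>'(2,3)[OF that] bd_dist[OF bds(2), of "s + k" s] bd_dist[OF bds(1), of "s + k" s] that k0
          dist_triangle[of "\<gamma>' s" "\<zeta> s" "\<zeta> (s + k)"] dist_triangle[of "\<gamma>' (- s)" "a s" "a (s + k)"] by auto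
      then have "bdd_above ((\<lambda>s. dist (\<gamma>' s) (\<zeta> s)) ` {0..})" "bdd_above ((\<lambda>s. dist (\<gamma>' (- s)) (a s)) ` {0..})"
        by (auto intro!: bdd_aboveI[of _ "3 + k"])
      then have "\<gamma>' (t - k) \<in> join_hull x0 L"
        using \<gamma>'(1) \<zeta> \<gamma>(3) unfolding join_hull_def by blast
      moreover have "dist (\<zeta> t) (\<gamma>' (t - k)) \<le> 3" using \<gamma>'(2)[of "t - k"] t' by (simp add: dist_commute)
      ultimately show ?thesis by blast
    qed
  qed
qed

section \<open>The limit set and its uniform radial approximation by the orbit\<close>

lemma limit_set_bd: "limit_set x0 G \<subseteq> bd"
  by (auto simp: limit_set_def)

text \<open>Cocompactness moves the nearby hull point into \<open>K\<close>, which lies in a ball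
  around \<open>x0\<close>. One constant serves all limit points and all times.\<close>

lemma radial_cocompact:
  assumes "convex_cocompact x0 G" "x0 \<in> join_hull x0 (limit_set x0 G)" "\<And>g. g \<in> G \<Longrightarrow> isometry g"
  shows "\<exists>R\<ge>0. \<forall>\<zeta>\<in>limit_set x0 G. \<forall>t\<ge>0. \<exists>g\<in>G. dist (\<zeta> t) (g x0) \<le> R"
proof -
  obtain K where K: "compact K" "join_hull x0 (limit_set x0 G) \<subseteq> (\<Union>g\<in>G. g ` K)"
    using assms(1) unfolding convex_cocompact_def by blast
  obtain r where r: "\<And>y. y \<in> K \<Longrightarrow> dist x0 y \<le> r"
    using compact_imp_bounded[OF K(1)] unfolding bounded_any_center[of K x0] by blast
  have "\<exists>g\<in>G. dist (\<zeta> t) (g x0) \<le> \<bar>r\<bar> + 3" if \<zeta>: "\<zeta> \<in> limit_set x0 G" "0 \<le> t" for \<zeta> t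
  proof -
    obtain y where y: "y \<in> join_hull x0 (limit_set x0 G)" "dist (\<zeta> t) y \<le> 3"
      using radial_near_hull[OF limit_set_bd assms(2) \<zeta>] by blast
    then obtain g p where g: "g \<in> G" "p \<in> K" "y = g p" using K by blast
    have "dist y (g x0) \<le> r" using r[of p] g isometry_dist[OF assms(3)[OF g(1)], of p x0] by (simp add: dist_commute)
    then show ?thesis using g(1) y dist_triangle[of "\<zeta> t" "g x0" y] by (intro bexI[of _ g]) auto
  qed
  then show ?thesis by (intro exI[of _ "\<bar>r\<bar> + 3"]) auto
qed

lemma gromov_pb_eq:
  assumes "\<xi> \<in> bd"
  shows "gromov_pb x0 x \<xi> = ereal ((dist x x0 - bz \<xi> x) / 2)"
  unfolding gromov_pb_def
proof (rule SUP_eqI)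
  fix t :: real assume "t \<in> {0..}"
  then show "ereal ((dist x x0 + t - dist x (\<xi> t)) / 2) \<le> ereal ((dist x x0 - bz \<xi> x) / 2)"
    using bz_le[OF assms, of t x] by simp
next
  fix y :: ereal assume y: "\<And>t. t \<in> {0..} \<Longrightarrow> ereal ((dist x x0 + t - dist x (\<xi> t)) / 2) \<le> y"
  have "((\<lambda>t. ereal ((dist x x0 - (dist x (\<xi> t) - t)) / 2)) \<longlongrightarrow> ereal ((dist x x0 - bz \<xi> x) / 2)) at_top"
    by (intro tendsto_intros bz_tendsto assms) auto
  then show "ereal ((dist x x0 - bz \<xi> x) / 2) \<le> y"
  proof (rule tendsto_upperbound)
    show "\<forall>\<^sub>F t in at_top. ereal ((dist x x0 - (dist x (\<xi> t) - t)) / 2) \<le> y"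
      using eventually_ge_at_top[of "0::real"] by eventually_elim (use y in \<open>simp add: algebra_simps\<close>)
  qed simp
qed

text \<open>Eliminates the sequence from the definition. For countable \<open>G\<close> the right
  side is a countable combination of conditions on the functions
  \<open>\<xi> \<mapsto> bz \<xi> (g x0)\<close>, which yields measurability of the limit
  set.\<close>

lemma limit_set_iff:
  "\<xi> \<in> limit_set x0 G \<longleftrightarrow> \<xi> \<in> bd \<and> (\<forall>n::nat. \<exists>g\<in>G. real n < (dist (g x0) x0 - bz \<xi> (g x0)) / 2)"
proof (cases "\<xi> \<in> bd")
  case True
  define q where "q g = (dist (g x0) x0 - bz \<xi> (g x0)) / 2" for g
  have *: "\<xi> \<in> limit_set x0 G \<longleftrightarrow> (\<exists>gs. (\<forall>n. gs n \<in> G) \<and> (\<lambda>n. ereal (q (gs n))) \<longlonglongrightarrow> \<infinity>)"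
    using True by (simp add: limit_set_def gromov_pb_eq q_def)
  show ?thesis
  proof
    assume "\<xi> \<in> limit_set x0 G"
    then obtain gs where gs: "\<And>n. gs n \<in> G" "(\<lambda>n. ereal (q (gs n))) \<longlonglongrightarrow> \<infinity>" using * by blast
    have "\<exists>g\<in>G. real n < q g" for n
      using gs(2) unfolding tendsto_PInfty eventually_sequentially
      by (metis gs(1) ereal_less(1) less_ereal.simps(1) order_refl)
    then show "\<xi> \<in> bd \<and> (\<forall>n::nat. \<exists>g\<in>G. real n < (dist (g x0) x0 - bz \<xi> (g x0)) / 2)"
      using True by (simp add: q_def)
  next
    assume "\<xi> \<in> bd \<and> (\<forall>n::nat. \<exists>g\<in>G. real n < (dist (g x0) x0 - bz \<xi> (g x0)) / 2)"
    then obtain gs where gs: "\<And>n. gs n \<in> G" "\<And>n. real n < q (gs n)" unfolding q_def by metis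
    have "(\<lambda>n. ereal (q (gs n))) \<longlonglongrightarrow> \<infinity>"
      unfolding tendsto_PInfty
    proof
      fix r
      show "\<forall>\<^sub>F n in sequentially. ereal r < ereal (q (gs n))"
        using eventually_gt_at_top[of "nat \<lceil>r\<rceil>"]
        by eventually_elim (use gs(2) in \<open>simp, smt (verit) of_nat_ceiling of_nat_less_iff real_nat_ceiling_ge\<close>)
    qed
    then show "\<xi> \<in> limit_set x0 G" using * gs by blast
  qed
qed (use limit_set_bd in auto)

text \<open>Passing from \<open>\<xi>\<close> and \<open>h\<close> to \<open>act g \<xi>\<close> and
  \<open>g \<circ> h\<close> lowers the Gromov product by at most the displacement \<open>D\<close>
  of \<open>x0\<close> under \<open>g\<close>.\<close>

lemma limit_set_act:
  assumes g: "isometry g" "g \<in> G" "\<And>h. h \<in> G \<Longrightarrow> g \<circ> h \<in> G" and \<xi>: "\<xi> \<in> limit_set x0 G"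
  shows "act g \<xi> \<in> limit_set x0 G"
  unfolding limit_set_iff
proof (intro conjI allI)
  have b: "\<xi> \<in> bd" using \<xi> limit_set_bd by auto
  show "act g \<xi> \<in> bd" using act_bd g b by blast
  fix n :: nat
  define D where "D = dist (g x0) x0"
  obtain N :: nat where N: "real n + D \<le> real N" using real_arch_simple by blast
  obtain h where h: "h \<in> G" "real N < (dist (h x0) x0 - bz \<xi> (h x0)) / 2" using \<xi> unfolding limit_set_iff by blast
  have "dist (inv g x0) x0 = D"
    using isometry_dist[OF g(1), of "inv g x0" x0] by (simp add: isometry_inv_app g D_def dist_commute)
  then have "\<bar>bz \<xi> (inv g x0)\<bar> \<le> D" using bz_abs_le[OF b, of "inv g x0"] by simp
  moreover have "dist (g (h x0)) x0 \<ge> dist (h x0) x0 - D"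
    using isometry_dist[OF g(1), of "h x0" x0] dist_triangle[of "g (h x0)" "g x0" x0] by (simp add: D_def dist_commute)
  moreover have "bz (act g \<xi>) (g (h x0)) = bz \<xi> (h x0) - bz \<xi> (inv g x0)" by (rule act_shift(2)[OF g(1) b])
  ultimately have "real n < (dist (g (h x0)) x0 - bz (act g \<xi>) (g (h x0))) / 2"
    using h(2) N by (simp add: abs_le_iff)
  then show "\<exists>g'\<in>G. real n < (dist (g' x0) x0 - bz (act g \<xi>) (g' x0)) / 2"
    using g(3)[OF h(1)] by (intro bexI[of _ "g \<circ> h"]) auto
qed

end

section \<open>The Patterson--Sullivan measure\<close>

locale ps_space = cat_m1_space x0 for x0 :: "'a::metric_space" +
  fixes G :: "('a \<Rightarrow> 'a) set" and \<delta> :: real and \<mu> :: "'a \<Rightarrow> (real \<Rightarrow> 'a) measure"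
  assumes group: "isom_group G" and discr: "discrete_group x0 G" and cc: "convex_cocompact x0 G"
    and o_in: "x0 \<in> join_hull x0 (limit_set x0 G)" and PS: "PS_density x0 G \<delta> \<mu>" and \<delta>: "0 < \<delta>"
begin

definition M where "M = \<mu> x0"
abbreviation Bd :: "(real \<Rightarrow> 'a) measure" where "Bd \<equiv> restrict_space borel bd"
abbreviation \<Lambda> :: "(real \<Rightarrow> 'a) set" where "\<Lambda> \<equiv> limit_set x0 G"

lemma isom: "g \<in> G \<Longrightarrow> isometry g"
  using group by (simp add: isom_group_def isometry_def)

lemma G_inv: "g \<in> G \<Longrightarrow> inv g \<in> G"
  using group by (simp add: isom_group_def)

lemma G_comp: "g \<in> G \<Longrightarrow> h \<in> G \<Longrightarrow> g \<circ> h \<in> G"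
  using group by (simp add: isom_group_def)

lemma \<Lambda>_bd: "\<xi> \<in> \<Lambda> \<Longrightarrow> \<xi> \<in> bd"
  using limit_set_bd by auto

lemma act_\<Lambda>: "g \<in> G \<Longrightarrow> \<xi> \<in> \<Lambda> \<Longrightarrow> act g \<xi> \<in> \<Lambda>"
  by (rule limit_set_act) (auto simp: isom G_comp)

lemma G_act_bd: "g \<in> G \<Longrightarrow> \<xi> \<in> bd \<Longrightarrow> act g \<xi> \<in> bd"
  by (simp add: act_bd isom)

lemma \<Lambda>_nonempty: "\<Lambda> \<noteq> {}"
  using o_in by (auto simp: join_hull_def)

lemma sets_\<mu>: "sets (\<mu> x) = sets Bd"
  using PS by (simp add: PS_density_def)

lemma sets_M [measurable_cong]: "sets M = sets Bd"
  by (simp add: M_def sets_\<mu>)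

lemma measurable_M: "measurable M N = measurable Bd N"
  by (rule measurable_cong_sets[OF sets_M refl])

lemma space_M: "space M = bd"
  using sets_eq_imp_space_eq[OF sets_M] by (simp add: space_restrict_space)

lemma space_Bd: "space Bd = bd"
  by (simp add: space_restrict_space)

lemma prob_M: "prob_space M"
  using PS by (simp add: PS_density_def M_def)

sublocale M: prob_space M by (rule prob_M)

lemma continuous_borel: "continuous_on bd f \<Longrightarrow> f \<in> borel_measurable Bd"
  by (rule borel_measurable_continuous_on_restrict)

lemma act_measurable: "g \<in> G \<Longrightarrow> act g \<in> measurable Bd Bd"
  by (intro measurable_restrict_space2 continuous_borel continuous_on_act isom)
     (auto simp: space_restrict_space G_act_bd)

lemma distr_M: "g \<in> G \<Longrightarrow> distr M Bd (act g) = \<mu> (g x0)"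
  using PS by (simp add: PS_density_def M_def)

lemma density_M: "\<mu> x = density M (\<lambda>\<xi>. ennreal (exp (- \<delta> * bz \<xi> x)))"
  using PS unfolding PS_density_def M_def bz_def by blast

lemma bz_measurable: "(\<lambda>\<xi>. bz \<xi> x) \<in> borel_measurable Bd"
  by (intro continuous_borel continuous_on_bz)

text \<open>Both sides integrate \<open>f\<close> against \<open>\<mu> (g x0)\<close>, written once
  as a density over \<open>M\<close> and once as the image of \<open>M\<close>.\<close>

lemma change_of_base:
  fixes f :: "(real \<Rightarrow> 'a) \<Rightarrow> real"
  assumes g: "g \<in> G" and f: "f \<in> borel_measurable Bd"
  shows "(\<integral>\<xi>. exp (- \<delta> * bz \<xi> (g x0)) * f \<xi> \<partial>M) = (\<integral>\<xi>. f (act g \<xi>) \<partial>M)" (is ?A)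
    and "integrable M (\<lambda>\<xi>. exp (- \<delta> * bz \<xi> (g x0)) * f \<xi>) \<longleftrightarrow> integrable M (\<lambda>\<xi>. f (act g \<xi>))" (is ?B)
proof -
  note [measurable] = bz_measurable f act_measurable[OF g]
  have e: "density M (\<lambda>\<xi>. ennreal (exp (- \<delta> * bz \<xi> (g x0)))) = distr M Bd (act g)"
    using density_M[of "g x0"] distr_M[OF g] by simp
  have 1: "integral\<^sup>L (density M (\<lambda>\<xi>. ennreal (exp (- \<delta> * bz \<xi> (g x0))))) f = (\<integral>\<xi>. exp (- \<delta> * bz \<xi> (g x0)) * f \<xi> \<partial>M)"
    by (subst integral_density) auto
  have 2: "integral\<^sup>L (distr M Bd (act g)) f = (\<integral>\<xi>. f (act g \<xi>) \<partial>M)"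
    by (rule integral_distr) measurable
  show ?A by (rule trans[OF sym[OF 1[unfolded e]] 2])
  have 3: "integrable (density M (\<lambda>\<xi>. ennreal (exp (- \<delta> * bz \<xi> (g x0))))) f \<longleftrightarrow> integrable M (\<lambda>\<xi>. exp (- \<delta> * bz \<xi> (g x0)) * f \<xi>)"
    by (subst integrable_density) auto
  have 4: "integrable (distr M Bd (act g)) f = integrable M (\<lambda>\<xi>. f (act g \<xi>))"
    by (rule integrable_distr_eq) measurable
  show ?B by (rule trans[OF sym[OF 3[unfolded e]] 4])
qed

lemma G_countable: "countable G"
proof -
  have "G = (\<Union>n::nat. {g\<in>G. dist x0 (g x0) \<le> real n})"
    using real_arch_simple by auto
  moreover have "countable \<dots>"
    using discr by (intro countable_UN[OF countableI_type] countable_finite) (auto simp: discrete_group_def)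
  ultimately show ?thesis by simp
qed

text \<open>Needed because non-measurable sets have \<open>emeasure\<close> 0: without it the support condition in
  \<open>PS_density\<close> would say nothing.\<close>
lemma \<Lambda>_sets: "\<Lambda> \<in> sets Bd"
proof -
  note [measurable] = bz_measurable
  have "\<Lambda> = (\<Inter>n::nat. \<Union>g\<in>G. {\<xi>\<in>space Bd. real n < (dist (g x0) x0 - bz \<xi> (g x0)) / 2})"
    by (rule set_eqI) (auto simp: limit_set_iff space_Bd)
  also have "\<dots> \<in> sets Bd"
  proof (intro sets.countable_INT image_subsetI sets.countable_UN' G_countable)
    fix n :: nat and g show "{\<xi>\<in>space Bd. real n < (dist (g x0) x0 - bz \<xi> (g x0)) / 2} \<in> sets Bd"
      by measurable
  qed simp
  finally show ?thesis .
qed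

lemma AE_\<Lambda>: "AE \<xi> in M. \<xi> \<in> \<Lambda>"
proof (rule AE_I)
  show "emeasure M (bd - \<Lambda>) = 0" using PS by (simp add: PS_density_def M_def)
  show "bd - \<Lambda> \<in> sets M" unfolding sets_M using \<Lambda>_sets
    by (metis sets.compl_sets space_Bd)
qed (auto simp: space_M)

lemma AE_bd: "AE \<xi> in M. \<xi> \<in> bd"
  using AE_\<Lambda> by eventually_elim (rule \<Lambda>_bd)

section \<open>Separability and joint measurability of the Gromov product\<close>

lemma countable_dense: "\<exists>D::'a set. countable D \<and> D \<noteq> {} \<and> (\<forall>x. \<forall>e>0. \<exists>q\<in>D. dist x q < e)"
proof -
  have ex: "\<exists>k. finite k \<and> cball x0 (real n) \<subseteq> (\<Union>x\<in>k. ball x (1 / real (Suc m)))" for n m :: nat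
  proof -
    have "0 < 1 / real (Suc m)" by simp
    then show ?thesis using compact_cball'[of x0 "real n"] unfolding compact_eq_totally_bounded by blast
  qed
  define k where "k n m = (SOME k. finite k \<and> cball x0 (real n) \<subseteq> (\<Union>x\<in>k. ball x (1 / real (Suc m))))" for n m :: nat
  have k: "finite (k n m)" "cball x0 (real n) \<subseteq> (\<Union>x\<in>k n m. ball x (1 / real (Suc m)))" for n m
    using someI_ex[OF ex[of n m]] unfolding k_def by blast+
  define D where "D = (\<Union>n m. k n m)"
  have "countable D" unfolding D_def by (intro countable_UN[OF countableI_type] countable_finite k)
  moreover have dense: "\<exists>q\<in>D. dist x q < e" if e: "0 < e" for x e
  proof -
    obtain n :: nat where "dist x0 x \<le> real n" using real_arch_simple by blast
    then have "x \<in> cball x0 (real n)" by simp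
    moreover obtain m :: nat where m: "1 / real (Suc m) < e" using nat_approx_posE[OF e] by blast
    ultimately have "x \<in> (\<Union>x\<in>k n m. ball x (1 / real (Suc m)))" using k(2)[of n m] by blast
    then obtain q where q: "q \<in> k n m" "dist q x < 1 / real (Suc m)" by auto
    then have "q \<in> D" unfolding D_def by blast
    moreover have "dist x q < e" using q m by (simp add: dist_commute)
    ultimately show ?thesis by blast
  qed
  moreover have "D \<noteq> {}" using dense[of 1 x0] by auto
  ultimately show ?thesis by blast
qed

text \<open>The space is separable but its type is not in class \<open>second_countable_topology\<close>, so \<open>dist\<close> is
  written as a countable infimum to be measurable for the product \<open>\<sigma>\<close>-algebra.\<close>
lemma dist_measurable:
  assumes u: "u \<in> measurable N Bd" and v: "v \<in> measurable N Bd"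
  shows "(\<lambda>\<omega>. dist (u \<omega> t) (v \<omega> t)) \<in> borel_measurable N"
proof -
  obtain D :: "'a set" where D: "countable D" "D \<noteq> {}" "\<And>x e. 0 < e \<Longrightarrow> \<exists>q\<in>D. dist x q < e"
    using countable_dense by blast
  have ev: "(\<lambda>\<xi>. dist (\<xi> t) q) \<in> borel_measurable Bd" for q
    by (intro continuous_borel continuous_intros continuous_on_eval)
  have bb: "bdd_below ((\<lambda>q. dist x q + dist y q) ` D)" for x y
    by (rule bdd_belowI[of _ 0]) auto
  have INF_eq: "dist x y = (INF q\<in>D. dist x q + dist y q)" for x y :: 'a
  proof (rule antisym)
    show "dist x y \<le> (INF q\<in>D. dist x q + dist y q)"
      by (intro cINF_greatest dist_triangle2 D(2))
    show "(INF q\<in>D. dist x q + dist y q) \<le> dist x y"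
    proof (rule field_le_epsilon)
      fix e :: real assume "0 < e"
      then obtain q where q: "q \<in> D" "dist x q < e / 2" using D(3)[of "e/2" x] by auto
      have "(INF q\<in>D. dist x q + dist y q) \<le> dist x q + dist y q" using bb q by (intro cINF_lower) auto
      also have "\<dots> \<le> dist x y + e"
        using q dist_triangle[of y q x] by (simp add: dist_commute)
      finally show "(INF q\<in>D. dist x q + dist y q) \<le> dist x y + e" .
    qed
  qed
  have "(\<lambda>\<omega>. dist (u \<omega> t) (v \<omega> t)) = (\<lambda>\<omega>. INF q\<in>D. dist (u \<omega> t) q + dist (v \<omega> t) q)"
    by (rule ext) (rule INF_eq)
  also have "\<dots> \<in> borel_measurable N"
    by (intro borel_measurable_cINF borel_measurable_add D(1) bb
        measurable_compose[OF u ev] measurable_compose[OF v ev])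
  finally show ?thesis .
qed

text \<open>Monotonicity in time reduces the supremum to integer times, hence to a countable
  one.\<close>

lemma gromov_bb_SUP_nat:
  assumes "\<xi> \<in> bd" "\<eta> \<in> bd"
  shows "gromov_bb \<xi> \<eta> = real_of_ereal (SUP n. ereal (real n - dist (\<xi> (real n)) (\<eta> (real n)) / 2))"
proof -
  have "(SUP t\<in>{0..}. ereal (trunc t \<xi> \<eta>)) = (SUP n. ereal (trunc (real n) \<xi> \<eta>))"
  proof (rule antisym; rule SUP_least)
    fix t :: real assume t: "t \<in> {0..}"
    obtain n :: nat where "t \<le> real n" using real_arch_simple by blast
    then have "ereal (trunc t \<xi> \<eta>) \<le> ereal (trunc (real n) \<xi> \<eta>)" using trunc_mono[OF assms] t by simp
    also have "\<dots> \<le> (SUP n. ereal (trunc (real n) \<xi> \<eta>))" by (rule SUP_upper) simp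
    finally show "ereal (trunc t \<xi> \<eta>) \<le> (SUP n. ereal (trunc (real n) \<xi> \<eta>))" .
  next
    fix n show "ereal (trunc (real n) \<xi> \<eta>) \<le> (SUP t\<in>{0..}. ereal (trunc t \<xi> \<eta>))"
      by (rule SUP_upper) simp
  qed
  then show ?thesis by (simp only: gromov_bb_def trunc_def)
qed

lemma gromov_measurable [measurable]:
  assumes u: "u \<in> measurable N Bd" and v: "v \<in> measurable N Bd"
  shows "(\<lambda>\<omega>. gromov_bb (u \<omega>) (v \<omega>)) \<in> borel_measurable N"
proof -
  have "gromov_bb (u \<omega>) (v \<omega>) = real_of_ereal (SUP n. ereal (real n - dist (u \<omega> (real n)) (v \<omega> (real n)) / 2))"
    if "\<omega> \<in> space N" for \<omega>
    using gromov_bb_SUP_nat[of "u \<omega>" "v \<omega>"] measurable_space[OF u that] measurable_space[OF v that]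
    by (simp add: space_Bd)
  then have "(\<lambda>\<omega>. gromov_bb (u \<omega>) (v \<omega>)) \<in> borel_measurable N \<longleftrightarrow>
     (\<lambda>\<omega>. real_of_ereal (SUP n. ereal (real n - dist (u \<omega> (real n)) (v \<omega> (real n)) / 2))) \<in> borel_measurable N"
    by (rule measurable_cong)
  moreover have "(\<lambda>\<omega>. real_of_ereal (SUP n. ereal (real n - dist (u \<omega> (real n)) (v \<omega> (real n)) / 2))) \<in> borel_measurable N"
    by (intro borel_measurable_real_of_ereal borel_measurable_SUP borel_measurable_ereal borel_measurable_diff
        borel_measurable_divide borel_measurable_const dist_measurable[OF u v] countableI_type)
  ultimately show ?thesis by blast
qed

lemma gromov_borel: "\<zeta> \<in> bd \<Longrightarrow> gromov_bb \<zeta> \<in> borel_measurable Bd"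
  by (rule gromov_measurable[of "\<lambda>_. \<zeta>" Bd "\<lambda>x. x", OF measurable_const measurable_ident_sets[OF refl]])
     (simp only: space_Bd)

definition R where "R = (SOME R. 0 \<le> R \<and> (\<forall>\<zeta>\<in>\<Lambda>. \<forall>t\<ge>0. \<exists>g\<in>G. dist (\<zeta> t) (g x0) \<le> R))"

lemma R: "0 \<le> R" "\<And>\<zeta> t. \<zeta> \<in> \<Lambda> \<Longrightarrow> 0 \<le> t \<Longrightarrow> \<exists>g\<in>G. dist (\<zeta> t) (g x0) \<le> R"
  using someI_ex[OF radial_cocompact[OF cc o_in isom]] unfolding R_def by auto

section \<open>The shadow estimate\<close>

definition C0 where "C0 = exp (\<delta> * (R + 1))"

text \<open>The upper half of Sullivan's shadow lemma. Choose \<open>g\<close> with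
  \<open>g x0\<close> near \<open>\<xi> t\<close>: on the shadow the density of
  \<open>\<mu> (g x0)\<close> is at least \<open>exp (\<delta> * (t - R - 1))\<close>, whereas its
  total mass is 1. The 1 in \<open>C0\<close> is the radius of the shadow.\<close>

lemma shadow_estimate:
  assumes \<xi>: "\<xi> \<in> \<Lambda>" and t: "0 \<le> t"
  shows "{\<eta>\<in>bd. dist (\<xi> t) (\<eta> t) \<le> 1} \<in> sets M"
    and "emeasure M {\<eta>\<in>bd. dist (\<xi> t) (\<eta> t) \<le> 1} \<le> ennreal (C0 * exp (- \<delta> * t))"
proof -
  have b: "\<xi> \<in> bd" using \<xi> by (rule \<Lambda>_bd)
  define S where "S = {\<eta>\<in>bd. dist (\<xi> t) (\<eta> t) \<le> 1}"
  have "(\<lambda>\<eta>. dist (\<xi> t) (\<eta> t)) \<in> borel_measurable Bd"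
    by (intro continuous_borel continuous_intros continuous_on_eval)
  then have "{\<eta>\<in>space Bd. dist (\<xi> t) (\<eta> t) \<le> 1} \<in> sets Bd" by measurable
  then have S: "S \<in> sets Bd" by (simp add: S_def space_Bd)
  then show "{\<eta>\<in>bd. dist (\<xi> t) (\<eta> t) \<le> 1} \<in> sets M" by (simp add: S_def sets_M)
  obtain g where g: "g \<in> G" "dist (\<xi> t) (g x0) \<le> R" using R(2)[OF \<xi> t] by blast
  note [measurable] = act_measurable[OF g(1)] S bz_measurable
  have "prob_space (distr M Bd (act g))" by (rule M.prob_space_distr) measurable
  then have 1: "emeasure (\<mu> (g x0)) S \<le> 1" unfolding distr_M[OF g(1)] by (rule prob_space.emeasure_le_1)
  define c where "c = exp (\<delta> * (t - R - 1))"
  have "ennreal c * emeasure M S = (\<integral>\<^sup>+\<eta>. ennreal c * indicator S \<eta> \<partial>M)"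
    by (simp add: nn_integral_cmult_indicator)
  also have "\<dots> \<le> (\<integral>\<^sup>+\<eta>. ennreal (exp (- \<delta> * bz \<eta> (g x0))) * indicator S \<eta> \<partial>M)"
  proof (intro nn_integral_mono)
    fix \<eta>
    have "c \<le> exp (- \<delta> * bz \<eta> (g x0))" if "\<eta> \<in> S"
    proof -
      have \<eta>: "\<eta> \<in> bd" "dist (\<xi> t) (\<eta> t) \<le> 1" using that by (auto simp: S_def)
      have "bz \<eta> (g x0) \<le> dist (g x0) (\<eta> t) - t" by (rule bz_le[OF \<eta>(1) t])
      also have "\<dots> \<le> R + 1 - t"
        using g(2) \<eta>(2) dist_triangle[of "g x0" "\<eta> t" "\<xi> t"] by (simp add: dist_commute)
      finally have "\<delta> * bz \<eta> (g x0) \<le> \<delta> * (R + 1 - t)" using \<delta> by (intro mult_left_mono) auto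
      then show ?thesis by (simp add: c_def algebra_simps)
    qed
    then show "ennreal c * indicator S \<eta> \<le> ennreal (exp (- \<delta> * bz \<eta> (g x0))) * indicator S \<eta>"
      by (auto simp: indicator_def intro!: ennreal_leI)
  qed
  also have "\<dots> = emeasure (\<mu> (g x0)) S"
    unfolding density_M[of "g x0"] by (subst emeasure_density) auto
  finally have 2: "ennreal c * emeasure M S \<le> 1" using 1 by (rule order_trans)
  have inv: "ennreal (1 / c) * ennreal c = 1" by (simp add: c_def flip: ennreal_mult)
  have "emeasure M S = ennreal (1 / c) * (ennreal c * emeasure M S)"
    by (simp only: mult.assoc[symmetric] inv mult_1_left)
  also have "\<dots> \<le> ennreal (1 / c) * 1" using 2 by (rule mult_left_mono) simp
  also have "1 / c = C0 * exp (- \<delta> * t)"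
  proof -
    have "1 / c = exp (- (\<delta> * (t - R - 1)))" by (simp only: c_def exp_minus inverse_eq_divide)
    also have "- (\<delta> * (t - R - 1)) = \<delta> * (R + 1) + - \<delta> * t" by (simp add: algebra_simps)
    finally show ?thesis by (simp only: C0_def exp_add)
  qed
  finally show "emeasure M {\<eta>\<in>bd. dist (\<xi> t) (\<eta> t) \<le> 1} \<le> ennreal (C0 * exp (- \<delta> * t))" by (simp add: S_def)
qed

text \<open>The shadows around \<open>\<xi>\<close> have mass tending to 0, so limit points are not
  atoms. Hence the default value of the Gromov product on the diagonal does not affect integrals
  against \<open>M\<close>.\<close>

lemma AE_neq:
  assumes "\<xi> \<in> \<Lambda>" shows "AE \<eta> in M. \<eta> \<noteq> \<xi>"
proof (rule AE_I')
  have b: "\<xi> \<in> bd" using assms by (rule \<Lambda>_bd)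
  have "closed {\<xi>}"
  proof -
    have "{\<xi>} = (\<Inter>t. {\<eta>. \<eta> t = \<xi> t})" by (auto simp: fun_eq_iff)
    moreover have "closed \<dots>"
      by (intro closed_INT ballI closed_Collect_eq continuous_on_const continuous_on_product_coordinates)
    ultimately show ?thesis by simp
  qed
  then have "{\<xi>} \<in> sets borel" by (rule borel_closed)
  then have "bd \<inter> {\<xi>} \<in> sets Bd" unfolding sets_restrict_space by (rule imageI)
  then have s: "{\<xi>} \<in> sets M" using b by (simp add: sets_M)
  have "emeasure M {\<xi>} \<le> 0"
  proof (rule tendsto_lowerbound)
    have "((\<lambda>t. C0 * exp (- \<delta> * t)) \<longlongrightarrow> 0) at_top" using \<delta> by real_asymp
    from tendsto_ennrealI[OF this]
    show "((\<lambda>t. ennreal (C0 * exp (- \<delta> * t))) \<longlongrightarrow> 0) at_top" by simp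
    show "\<forall>\<^sub>F t in at_top. emeasure M {\<xi>} \<le> ennreal (C0 * exp (- \<delta> * t))"
      using eventually_ge_at_top[of "0::real"]
    proof eventually_elim
      case (elim t)
      have "emeasure M {\<xi>} \<le> emeasure M {\<eta>\<in>bd. dist (\<xi> t) (\<eta> t) \<le> 1}"
        using shadow_estimate(1)[OF assms elim] b by (intro emeasure_mono) auto
      then show ?case using shadow_estimate(2)[OF assms elim] by (rule order_trans)
    qed
  qed simp
  then show "{\<xi>} \<in> null_sets M" using s by (intro null_setsI) simp_all
qed blast

definition C1 where "C1 = C0 / (1 - exp (- \<delta>))"

lemma C1_nonneg: "0 \<le> C1"
  using \<delta> by (simp add: C1_def C0_def)

text \<open>A layer-cake estimate: by \<open>dist_le_1\<close> the excess over \<open>m\<close> is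
  at most the number of shadows \<open>S n\<close>, taken at the times \<open>m + n\<close>, that
  contain \<open>\<eta>\<close>. Their masses are bounded by a geometric series of ratio
  \<open>exp (- \<delta>)\<close>, which is the origin of \<open>C1\<close>.\<close>

lemma nn_tail:
  assumes \<xi>: "\<xi> \<in> \<Lambda>" and m: "0 \<le> m"
  shows "(\<integral>\<^sup>+\<eta>. ennreal (max 0 (gromov_bb \<xi> \<eta> - m)) \<partial>M) \<le> ennreal (C1 * exp (- \<delta> * m))"
proof -
  have b: "\<xi> \<in> bd" using \<xi> by (rule \<Lambda>_bd)
  define S where "S n = {\<eta>\<in>bd. dist (\<xi> (m + real n)) (\<eta> (m + real n)) \<le> 1}" for n
  have S [measurable]: "S n \<in> sets M" for n unfolding S_def using shadow_estimate(1)[OF \<xi>] m by simp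
  have "(\<integral>\<^sup>+\<eta>. ennreal (max 0 (gromov_bb \<xi> \<eta> - m)) \<partial>M) \<le> (\<integral>\<^sup>+\<eta>. (\<Sum>n. indicator (S n) \<eta>) \<partial>M)"
  proof (rule nn_integral_mono_AE, use AE_bd in eventually_elim)
    fix \<eta> assume \<eta>: "\<eta> \<in> bd"
    show "ennreal (max 0 (gromov_bb \<xi> \<eta> - m)) \<le> (\<Sum>n. indicator (S n) \<eta>)"
    proof (cases "m \<le> gromov_bb \<xi> \<eta>")
      case False then show ?thesis by simp
    next
      case True
      define n0 where "n0 = nat \<lfloor>gromov_bb \<xi> \<eta> - m\<rfloor>"
      have n0: "gromov_bb \<xi> \<eta> - m \<le> real (Suc n0)" "real n0 \<le> gromov_bb \<xi> \<eta> - m"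
        using True by (auto simp: n0_def) linarith
      have inS: "\<eta> \<in> S n" if "n < Suc n0" for n
        unfolding S_def using dist_le_1[OF b \<eta>, of "m + real n"] \<eta> m n0 that by force
      have "ennreal (max 0 (gromov_bb \<xi> \<eta> - m)) \<le> ennreal (real (Suc n0))" using n0 by (intro ennreal_leI) auto
      also have "\<dots> = (\<Sum>n<Suc n0. indicator (S n) \<eta>)"
        using inS by (simp add: ennreal_of_nat_eq_real_of_nat)
      also have "\<dots> \<le> (\<Sum>n. indicator (S n) \<eta>)" by (intro sum_le_suminf) auto
      finally show ?thesis .
    qed
  qed
  also have "\<dots> = (\<Sum>n. emeasure M (S n))"
    by (subst nn_integral_suminf) (auto intro!: suminf_cong nn_integral_indicator)
  also have "\<dots> \<le> (\<Sum>n. ennreal (C0 * exp (- \<delta> * m) * exp (- \<delta>) ^ n))"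
  proof (intro suminf_le summableI)
    fix n
    have "exp (- \<delta> * (m + real n)) = exp (- \<delta> * m) * exp (- \<delta>) ^ n"
      by (simp only: distrib_left exp_add exp_of_nat_mult[symmetric] mult.commute[of "real n"])
    then show "emeasure M (S n) \<le> ennreal (C0 * exp (- \<delta> * m) * exp (- \<delta>) ^ n)"
      unfolding S_def using shadow_estimate(2)[OF \<xi>, of "m + real n"] m by (simp add: mult.assoc)
  qed
  also have "\<dots> = ennreal (\<Sum>n. C0 * exp (- \<delta> * m) * exp (- \<delta>) ^ n)"
    using \<delta> by (intro suminf_ennreal2 summable_mult summable_geometric) (auto simp: C0_def)
  also have "(\<Sum>n. C0 * exp (- \<delta> * m) * exp (- \<delta>) ^ n) = C1 * exp (- \<delta> * m)"
    using \<delta> by (subst suminf_mult) (auto simp: suminf_geometric C1_def)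
  finally show ?thesis .
qed

lemma tail:
  assumes \<xi>: "\<xi> \<in> \<Lambda>" and m: "0 \<le> m"
  shows "integrable M (\<lambda>\<eta>. max 0 (gromov_bb \<xi> \<eta> - m))"
    and "(\<integral>\<eta>. max 0 (gromov_bb \<xi> \<eta> - m) \<partial>M) \<le> C1 * exp (- \<delta> * m)"
proof -
  have [measurable]: "gromov_bb \<xi> \<in> borel_measurable M"
    using gromov_borel[OF \<Lambda>_bd[OF \<xi>]] by (simp add: measurable_M)
  show i: "integrable M (\<lambda>\<eta>. max 0 (gromov_bb \<xi> \<eta> - m))"
  proof (rule integrableI_nonneg)
    show "(\<integral>\<^sup>+\<eta>. ennreal (max 0 (gromov_bb \<xi> \<eta> - m)) \<partial>M) < \<infinity>"
      using le_less_trans[OF nn_tail[OF assms] ennreal_less_top] by simp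
  qed simp_all
  have "ennreal (\<integral>\<eta>. max 0 (gromov_bb \<xi> \<eta> - m) \<partial>M) \<le> ennreal (C1 * exp (- \<delta> * m))"
    using nn_tail[OF assms] nn_integral_eq_integral[OF i] by simp
  then show "(\<integral>\<eta>. max 0 (gromov_bb \<xi> \<eta> - m) \<partial>M) \<le> C1 * exp (- \<delta> * m)"
    using C1_nonneg by (simp add: ennreal_le_iff)
qed

lemma gromov_integrable:
  assumes \<xi>: "\<xi> \<in> \<Lambda>"
  shows "integrable M (gromov_bb \<xi>)" and "(\<integral>\<eta>. gromov_bb \<xi> \<eta> \<partial>M) \<le> C1" and "0 \<le> (\<integral>\<eta>. gromov_bb \<xi> \<eta> \<partial>M)"
proof -
  have [measurable]: "gromov_bb \<xi> \<in> borel_measurable M"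
    using gromov_borel[OF \<Lambda>_bd[OF \<xi>]] by (simp add: measurable_M)
  have ae: "AE \<eta> in M. max 0 (gromov_bb \<xi> \<eta> - 0) = gromov_bb \<xi> \<eta>"
    using AE_bd by eventually_elim (simp add: gromov_bb_nonneg \<Lambda>_bd[OF \<xi>])
  show "integrable M (gromov_bb \<xi>)"
    by (rule integrable_cong_AE_imp[OF tail(1)[OF \<xi>, of 0] _ ae]) measurable
  have "(\<integral>\<eta>. gromov_bb \<xi> \<eta> \<partial>M) = (\<integral>\<eta>. max 0 (gromov_bb \<xi> \<eta> - 0) \<partial>M)"
    by (intro integral_cong_AE AE_symmetric[OF ae]) measurable
  then show "(\<integral>\<eta>. gromov_bb \<xi> \<eta> \<partial>M) \<le> C1" using tail(2)[OF \<xi>, of 0] by simp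
  show "0 \<le> (\<integral>\<eta>. gromov_bb \<xi> \<eta> \<partial>M)"
    by (intro integral_nonneg_AE, use AE_bd in eventually_elim) (simp add: gromov_bb_nonneg \<Lambda>_bd[OF \<xi>])
qed

end

section \<open>Quantitative continuity of the Gromov product\<close>

context cat_m1_space
begin

text \<open>Reads \<open>sinh_dist_le\<close> backwards: the error of stopping at time
  \<open>s\<close> is bounded in terms of the distance reached by then.\<close>

lemma gromov_upper:
  assumes "\<xi> \<in> bd" "\<eta> \<in> bd" "\<xi> \<noteq> \<eta>" "0 \<le> s" "0 < dist (\<xi> s) (\<eta> s)"
  shows "gromov_bb \<xi> \<eta> \<le> trunc s \<xi> \<eta> - ln (1 - exp (- dist (\<xi> s) (\<eta> s)))"
proof -
  define d where "d = dist (\<xi> s) (\<eta> s)"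
  have "sinh (d / 2) \<le> sinh s * exp (- gromov_bb \<xi> \<eta>)"
    unfolding d_def by (rule sinh_dist_le[OF assms(1-4)])
  also have "\<dots> \<le> exp s / 2 * exp (- gromov_bb \<xi> \<eta>)"
    by (intro mult_right_mono sinh_le_exp_half) auto
  finally have "2 * sinh (d / 2) \<le> exp (s - gromov_bb \<xi> \<eta>)" by (simp add: exp_diff exp_minus field_simps)
  moreover have "2 * sinh (d / 2) = exp (d / 2) * (1 - exp (- d))"
  proof -
    have "exp (d / 2) * exp (- d) = exp (- (d / 2))" by (simp flip: exp_add)
    then show ?thesis by (simp add: sinh_field_def right_diff_distrib)
  qed
  ultimately have le: "exp (d / 2) * (1 - exp (- d)) \<le> exp (s - gromov_bb \<xi> \<eta>)" by simp
  have pos: "0 < 1 - exp (- d)" using assms(5) by (simp add: d_def)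
  then have "ln (exp (d / 2) * (1 - exp (- d))) \<le> ln (exp (s - gromov_bb \<xi> \<eta>))"
    using le by (subst ln_le_cancel_iff) auto
  then have "d / 2 + ln (1 - exp (- d)) \<le> s - gromov_bb \<xi> \<eta>" using pos by (simp add: ln_mult)
  then show ?thesis by (simp add: trunc_def d_def)
qed

lemma gromov_close:
  assumes "0 < e"
  shows "\<exists>N. \<forall>\<zeta>\<in>bd. \<forall>\<zeta>'\<in>bd. \<forall>\<eta>\<in>bd. \<zeta> \<noteq> \<zeta>' \<and> \<eta> \<noteq> \<zeta> \<and> \<eta> \<noteq> \<zeta>' \<and> gromov_bb \<zeta> \<eta> \<le> m \<and> gromov_bb \<zeta>' \<eta> \<le> m
      \<and> N \<le> gromov_bb \<zeta> \<zeta>' \<longrightarrow> \<bar>gromov_bb \<zeta> \<eta> - gromov_bb \<zeta>' \<eta>\<bar> \<le> e"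
proof -
  have "((\<lambda>s. - ln (1 - exp (- 2 * (s - m)))) \<longlongrightarrow> 0) at_top" by real_asymp
  then have "\<forall>\<^sub>F s in at_top. - ln (1 - exp (- 2 * (s - m))) < e / 2"
    using assms by (intro order_tendstoD) auto
  then have "\<forall>\<^sub>F s in at_top. - ln (1 - exp (- 2 * (s - m))) < e / 2 \<and> max 0 m < s"
    using eventually_gt_at_top[of "max 0 m"] by eventually_elim simp
  then obtain s where s: "- ln (1 - exp (- 2 * (s - m))) < e / 2" "0 < s" "m < s"
    by (metis (no_types, lifting) eventually_at_top_linorder order_refl max_less_iff_conj)
  \<comment> \<open>A product of at most \<open>m\<close> forces the distance at time
    \<open>s\<close> to be at least \<open>2 * (s - m)\<close>; by the choice of \<open>s\<close>
    the truncation error is then below \<open>e / 2\<close>.\<close>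
  have up: "gromov_bb \<zeta> \<eta> \<le> trunc s \<zeta> \<eta> + e / 2"
    if "\<zeta> \<in> bd" "\<eta> \<in> bd" "\<eta> \<noteq> \<zeta>" "gromov_bb \<zeta> \<eta> \<le> m" for \<zeta> \<eta>
  proof -
    have d: "2 * (s - m) \<le> dist (\<zeta> s) (\<eta> s)"
      using trunc_le[OF that(1,2), of s] that s by (simp add: trunc_def)
    then have "1 - exp (- 2 * (s - m)) \<le> 1 - exp (- dist (\<zeta> s) (\<eta> s))" by simp
    moreover have "0 < 1 - exp (- 2 * (s - m))" using s by simp
    ultimately have "ln (1 - exp (- 2 * (s - m))) \<le> ln (1 - exp (- dist (\<zeta> s) (\<eta> s)))"
      by (subst ln_le_cancel_iff) auto
    moreover have "gromov_bb \<zeta> \<eta> \<le> trunc s \<zeta> \<eta> - ln (1 - exp (- dist (\<zeta> s) (\<eta> s)))"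
      using that s d by (intro gromov_upper) auto
    ultimately show ?thesis using s by linarith
  qed
  \<comment> \<open>With this \<open>N\<close> the number \<open>exp (s - N)\<close> is
    \<open>e\<close>: the two rays are within \<open>e\<close> at time \<open>s\<close>, and the
    truncated products within \<open>e / 2\<close>.\<close>
  define N where "N = s - ln e"
  have "\<bar>gromov_bb \<zeta> \<eta> - gromov_bb \<zeta>' \<eta>\<bar> \<le> e"
    if b: "\<zeta> \<in> bd" "\<zeta>' \<in> bd" "\<eta> \<in> bd" and ne: "\<zeta> \<noteq> \<zeta>'" "\<eta> \<noteq> \<zeta>" "\<eta> \<noteq> \<zeta>'"
      and m: "gromov_bb \<zeta> \<eta> \<le> m" "gromov_bb \<zeta>' \<eta> \<le> m" and N: "N \<le> gromov_bb \<zeta> \<zeta>'" for \<zeta> \<zeta>' \<eta>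
  proof -
    have "dist (\<zeta> s) (\<zeta>' s) / 2 \<le> sinh (dist (\<zeta> s) (\<zeta>' s) / 2)"
      by (rule le_sinh) simp
    also have "\<dots> \<le> sinh s * exp (- gromov_bb \<zeta> \<zeta>')" using b ne s by (intro sinh_dist_le) auto
    also have "\<dots> \<le> exp s / 2 * exp (- N)" using N s by (intro mult_mono sinh_le_exp_half) auto
    also have "\<dots> = e / 2" using assms by (simp add: N_def exp_minus exp_diff field_simps)
    finally have "dist (\<zeta> s) (\<zeta>' s) / 2 \<le> e / 2" .
    moreover have "\<bar>trunc s \<zeta> \<eta> - trunc s \<zeta>' \<eta>\<bar> \<le> dist (\<zeta> s) (\<zeta>' s) / 2"
      using dist_triangle[of "\<zeta> s" "\<eta> s" "\<zeta>' s"] dist_triangle[of "\<zeta>' s" "\<eta> s" "\<zeta> s"]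
        dist_commute[of "\<zeta> s" "\<zeta>' s"] unfolding trunc_def by linarith
    moreover have "trunc s \<zeta> \<eta> \<le> gromov_bb \<zeta> \<eta>" "trunc s \<zeta>' \<eta> \<le> gromov_bb \<zeta>' \<eta>"
      using b ne s by (auto intro!: trunc_le)
    moreover have "gromov_bb \<zeta> \<eta> \<le> trunc s \<zeta> \<eta> + e / 2" "gromov_bb \<zeta>' \<eta> \<le> trunc s \<zeta>' \<eta> + e / 2"
      using b ne m by (auto intro!: up)
    ultimately show ?thesis by linarith
  qed
  then show ?thesis by blast
qed

text \<open>The left side is the Gromov product of \<open>\<xi>\<close> with the point
  \<open>\<zeta> n\<close>, and moving this point outwards along its ray cannot decrease the
  product.\<close>

lemma gromov_ge_point:
  assumes "\<xi> \<in> bd" "\<zeta> \<in> bd" "\<xi> \<noteq> \<zeta>" "0 \<le> n"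
  shows "(n - bz \<xi> (\<zeta> n)) / 2 \<le> gromov_bb \<xi> \<zeta>"
proof (rule tendsto_le[OF _ trunc_tendsto[OF assms(1-3)]])
  show "((\<lambda>t. (n - (dist (\<zeta> n) (\<xi> t) - t)) / 2) \<longlongrightarrow> (n - bz \<xi> (\<zeta> n)) / 2) at_top"
    by (intro tendsto_intros bz_tendsto assms) auto
  show "\<forall>\<^sub>F t in at_top. (n - (dist (\<zeta> n) (\<xi> t) - t)) / 2 \<le> trunc t \<xi> \<zeta>"
    using eventually_ge_at_top[of n]
  proof eventually_elim
    case (elim t)
    have "dist (\<zeta> t) (\<zeta> n) = t - n" using bd_dist[OF assms(2), of t n] elim assms by simp
    then have "dist (\<xi> t) (\<zeta> t) \<le> dist (\<zeta> n) (\<xi> t) + (t - n)"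
      using dist_triangle[of "\<xi> t" "\<zeta> t" "\<zeta> n"] by (simp add: dist_commute)
    then show ?case by (simp add: trunc_def)
  qed
qed simp

end

section \<open>Integrals of bounded functions against the boundary measure\<close>

context ps_space
begin

lemma continuous_bounded:
  fixes \<phi> :: "(real \<Rightarrow> 'a) \<Rightarrow> real"
  assumes "continuous_on bd \<phi>" shows "\<exists>C\<ge>0. \<forall>\<xi>\<in>bd. \<bar>\<phi> \<xi>\<bar> \<le> C"
proof -
  obtain C where C: "\<And>y. y \<in> \<phi> ` bd \<Longrightarrow> norm y \<le> C"
    using compact_imp_bounded[OF compact_continuous_image[OF assms compact_bd]] unfolding bounded_iff by blast
  then have "\<forall>\<xi>\<in>bd. \<bar>\<phi> \<xi>\<bar> \<le> \<bar>C\<bar>" by force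
  then show ?thesis by (intro exI[of _ "\<bar>C\<bar>"]) auto
qed

lemma abs_integral_le:
  fixes f g :: "(real \<Rightarrow> 'a) \<Rightarrow> real"
  assumes "f \<in> borel_measurable Bd" "integrable M g" "AE \<xi> in M. \<bar>f \<xi>\<bar> \<le> g \<xi>"
  shows "integrable M f" "\<bar>\<integral>\<xi>. f \<xi> \<partial>M\<bar> \<le> (\<integral>\<xi>. g \<xi> \<partial>M)"
proof -
  have f: "f \<in> borel_measurable M" using assms(1) by (simp add: measurable_M)
  show i: "integrable M f"
    by (rule Bochner_Integration.integrable_bound[OF assms(2) f]) (use assms(3) in eventually_elim, auto)
  have "\<bar>\<integral>\<xi>. f \<xi> \<partial>M\<bar> \<le> (\<integral>\<xi>. \<bar>f \<xi>\<bar> \<partial>M)" by (rule integral_abs_bound)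
  also have "\<dots> \<le> (\<integral>\<xi>. g \<xi> \<partial>M)" using i assms by (intro integral_mono_AE) auto
  finally show "\<bar>\<integral>\<xi>. f \<xi> \<partial>M\<bar> \<le> (\<integral>\<xi>. g \<xi> \<partial>M)" .
qed

lemma abs_integral_le_const:
  fixes f :: "(real \<Rightarrow> 'a) \<Rightarrow> real"
  assumes "f \<in> borel_measurable Bd" "AE \<xi> in M. \<bar>f \<xi>\<bar> \<le> C"
  shows "integrable M f" "\<bar>\<integral>\<xi>. f \<xi> \<partial>M\<bar> \<le> C"
  using abs_integral_le[of f "\<lambda>_. C"] assms by (auto simp: M.prob_space)

lemma continuous_integrable:
  fixes \<phi> :: "(real \<Rightarrow> 'a) \<Rightarrow> real"
  assumes "continuous_on bd \<phi>" shows "integrable M \<phi>"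
proof -
  obtain C where "\<forall>\<xi>\<in>bd. \<bar>\<phi> \<xi>\<bar> \<le> C" using continuous_bounded[OF assms] by blast
  then have "AE \<xi> in M. \<bar>\<phi> \<xi>\<bar> \<le> C" using AE_bd by auto
  then show ?thesis using abs_integral_le_const continuous_borel[OF assms] by blast
qed

section \<open>Potentials\<close>

definition potential :: "((real \<Rightarrow> 'a) \<Rightarrow> real) \<Rightarrow> (real \<Rightarrow> 'a) \<Rightarrow> real" where
  "potential \<phi> \<zeta> = (\<integral>\<eta>. \<phi> \<eta> * gromov_bb \<zeta> \<eta> \<partial>M)"

lemma potential_measurable:
  assumes "continuous_on bd \<phi>" shows "potential \<phi> \<in> borel_measurable Bd"
proof -
  note [measurable] = continuous_borel[OF assms]
  have "(\<lambda>\<zeta>. \<integral>\<eta>. \<phi> \<eta> * gromov_bb \<zeta> \<eta> \<partial>M) \<in> borel_measurable Bd"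
    by (rule M.borel_measurable_lebesgue_integral) measurable
  then show ?thesis by (simp add: potential_def[abs_def])
qed

lemma potential_bound:
  assumes \<phi>: "continuous_on bd \<phi>" and C: "\<forall>\<xi>\<in>bd. \<bar>\<phi> \<xi>\<bar> \<le> C" and \<zeta>: "\<zeta> \<in> \<Lambda>"
  shows "integrable M (\<lambda>\<eta>. \<phi> \<eta> * gromov_bb \<zeta> \<eta>)" "\<bar>potential \<phi> \<zeta>\<bar> \<le> C * C1"
proof -
  note [measurable] = continuous_borel[OF \<phi>] gromov_borel[OF \<Lambda>_bd[OF \<zeta>]]
  have ae: "AE \<eta> in M. \<bar>\<phi> \<eta> * gromov_bb \<zeta> \<eta>\<bar> \<le> C * gromov_bb \<zeta> \<eta>"
    using AE_bd by eventually_elim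
      (use C gromov_bb_nonneg[OF \<Lambda>_bd[OF \<zeta>]] in \<open>auto simp: abs_mult intro!: mult_mono\<close>)
  have i: "integrable M (\<lambda>\<eta>. C * gromov_bb \<zeta> \<eta>)" using gromov_integrable(1)[OF \<zeta>] by simp
  show "integrable M (\<lambda>\<eta>. \<phi> \<eta> * gromov_bb \<zeta> \<eta>)"
    by (rule abs_integral_le(1)[OF _ i ae]) measurable
  have C0: "0 \<le> C" using C \<Lambda>_bd[OF \<zeta>] by force
  have "\<bar>potential \<phi> \<zeta>\<bar> \<le> (\<integral>\<eta>. C * gromov_bb \<zeta> \<eta> \<partial>M)"
    unfolding potential_def by (rule abs_integral_le(2)[OF _ i ae]) measurable
  also have "\<dots> \<le> C * C1" using gromov_integrable(2)[OF \<zeta>] C0 by (simp add: mult_left_mono)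
  finally show "\<bar>potential \<phi> \<zeta>\<bar> \<le> C * C1" .
qed

text \<open>Where both products are at most \<open>m\<close> the kernel is uniformly continuous by
  \<open>gromov_close\<close>; elsewhere the tail estimate makes it small in the mean, uniformly
  over the limit set.\<close>

lemma potential_modulus:
  assumes \<phi>: "continuous_on bd \<phi>" and e: "0 < e"
  shows "\<exists>N. \<forall>\<zeta>\<in>\<Lambda>. \<forall>\<zeta>'\<in>\<Lambda>. \<zeta> = \<zeta>' \<or> N \<le> gromov_bb \<zeta> \<zeta>' \<longrightarrow> \<bar>potential \<phi> \<zeta> - potential \<phi> \<zeta>'\<bar> \<le> e"
proof -
  obtain C where C: "0 \<le> C" "\<forall>\<xi>\<in>bd. \<bar>\<phi> \<xi>\<bar> \<le> C" using continuous_bounded[OF \<phi>] by blast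
  have "((\<lambda>m. C * (2 * (m + 1) * (C1 * exp (- \<delta> * (m - 1))))) \<longlongrightarrow> 0) at_top" using \<delta> by real_asymp
  then have "\<forall>\<^sub>F m in at_top. C * (2 * (m + 1) * (C1 * exp (- \<delta> * (m - 1)))) < e / 2"
    using e by (intro order_tendstoD) auto
  then have "\<forall>\<^sub>F m in at_top. C * (2 * (m + 1) * (C1 * exp (- \<delta> * (m - 1)))) < e / 2 \<and> 1 \<le> m"
    using eventually_ge_at_top[of "1::real"] by eventually_elim simp
  then obtain m where m: "C * (2 * (m + 1) * (C1 * exp (- \<delta> * (m - 1)))) < e / 2" "1 \<le> m"
    by (metis (no_types, lifting) eventually_at_top_linorder order_refl)
  define e0 where "e0 = e / (2 * (C + 1))"
  have e0: "0 < e0" "C * e0 \<le> e / 2" using e C(1) by (auto simp: e0_def field_simps)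
  obtain N where N: "\<And>\<zeta> \<zeta>' \<eta>. \<zeta> \<in> bd \<Longrightarrow> \<zeta>' \<in> bd \<Longrightarrow> \<eta> \<in> bd \<Longrightarrow> \<zeta> \<noteq> \<zeta>' \<Longrightarrow> \<eta> \<noteq> \<zeta> \<Longrightarrow> \<eta> \<noteq> \<zeta>' \<Longrightarrow>
      gromov_bb \<zeta> \<eta> \<le> m \<Longrightarrow> gromov_bb \<zeta>' \<eta> \<le> m \<Longrightarrow> N \<le> gromov_bb \<zeta> \<zeta>' \<Longrightarrow>
      \<bar>gromov_bb \<zeta> \<eta> - gromov_bb \<zeta>' \<eta>\<bar> \<le> e0"
    using gromov_close[OF e0(1), of m] by (metis (no_types, lifting))
  have main: "\<bar>potential \<phi> \<zeta> - potential \<phi> \<zeta>'\<bar> \<le> e" if \<zeta>: "\<zeta> \<in> \<Lambda>" "\<zeta>' \<in> \<Lambda>" "\<zeta> \<noteq> \<zeta>'" "N \<le> gromov_bb \<zeta> \<zeta>'" for \<zeta> \<zeta>'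
  proof -
    note b = \<Lambda>_bd[OF \<zeta>(1)] \<Lambda>_bd[OF \<zeta>(2)]
    note [measurable] = continuous_borel[OF \<phi>] gromov_borel[OF b(1)] gromov_borel[OF b(2)]
    \<comment> \<open>An integrable majorant. If one of the products exceeds \<open>m\<close>, its
      excess over \<open>m - 1\<close> is at least 1, so \<open>m + 1\<close> times the sum of the
      excesses dominates both products.\<close>
    define g where "g \<eta> = C * (e0 + (m + 1) * (max 0 (gromov_bb \<zeta> \<eta> - (m - 1)) + max 0 (gromov_bb \<zeta>' \<eta> - (m - 1))))" for \<eta>
    have m1: "0 \<le> m - 1" using m by simp
    note t = tail[OF \<zeta>(1) m1] tail[OF \<zeta>(2) m1]
    have gi: "integrable M g" unfolding g_def using t by simp
    have ae: "AE \<eta> in M. \<bar>\<phi> \<eta> * gromov_bb \<zeta> \<eta> - \<phi> \<eta> * gromov_bb \<zeta>' \<eta>\<bar> \<le> g \<eta>"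
      using AE_bd AE_neq[OF \<zeta>(1)] AE_neq[OF \<zeta>(2)]
    proof eventually_elim
      case (elim \<eta>)
      define K K' where "K = gromov_bb \<zeta> \<eta>" and "K' = gromov_bb \<zeta>' \<eta>"
      have K0: "0 \<le> K" "0 \<le> K'" using elim b gromov_bb_nonneg by (auto simp: K_def K'_def)
      have "\<bar>K - K'\<bar> \<le> e0 + (m + 1) * (max 0 (K - (m - 1)) + max 0 (K' - (m - 1)))"
      proof (cases "K \<le> m \<and> K' \<le> m")
        case True
        then have "\<bar>K - K'\<bar> \<le> e0" unfolding K_def K'_def
          by (intro N[OF b elim(1) \<zeta>(3) elim(2,3) _ _ \<zeta>(4)]) auto
        moreover have "0 \<le> (m + 1) * (max 0 (K - (m - 1)) + max 0 (K' - (m - 1)))" using m by simp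
        ultimately show ?thesis by linarith
      next
        case False
        define u where "u = max 0 (K - (m - 1)) + max 0 (K' - (m - 1))"
        have u: "1 \<le> u" "max K K' - (m - 1) \<le> u" using False by (auto simp: u_def max_def)
        have "(m - 1) * 1 \<le> (m - 1) * u" using u m by (intro mult_left_mono) auto
        have "max K K' \<le> u + (m - 1)" using u(2) by (simp only: le_diff_eq diff_le_eq add.commute)
        also have "\<dots> \<le> u + (m - 1) * u"
          using \<open>(m - 1) * 1 \<le> (m - 1) * u\<close> by (intro add_left_mono) simp
        also have "\<dots> \<le> (m + 1) * u" using u(1) by (simp add: algebra_simps)
        finally have "max K K' \<le> (m + 1) * u" .
        moreover have "\<bar>K - K'\<bar> \<le> max K K'" using K0 by (auto simp: max_def)
        ultimately have "\<bar>K - K'\<bar> \<le> (m + 1) * u" by (rule order_trans[rotated])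
        also have "\<dots> \<le> e0 + (m + 1) * u" using e0(1) by simp
        finally show ?thesis by (simp only: u_def)
      qed
      moreover have "\<phi> \<eta> * gromov_bb \<zeta> \<eta> - \<phi> \<eta> * gromov_bb \<zeta>' \<eta> = \<phi> \<eta> * (K - K')"
        by (simp add: K_def K'_def algebra_simps)
      moreover have "\<bar>\<phi> \<eta>\<bar> \<le> C" using C(2) elim(1) by blast
      ultimately show ?case unfolding g_def K_def K'_def using C(1)
        by (simp only: abs_mult) (intro mult_mono, auto)
    qed
    have "potential \<phi> \<zeta> - potential \<phi> \<zeta>' = (\<integral>\<eta>. \<phi> \<eta> * gromov_bb \<zeta> \<eta> - \<phi> \<eta> * gromov_bb \<zeta>' \<eta> \<partial>M)"
      unfolding potential_def using potential_bound(1)[OF \<phi> C(2)] \<zeta> by simp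
    also have "\<bar>\<dots>\<bar> \<le> (\<integral>\<eta>. g \<eta> \<partial>M)"
      by (rule abs_integral_le(2)[OF _ gi ae]) measurable
    also have "\<dots> = C * (e0 + (m + 1) * ((\<integral>\<eta>. max 0 (gromov_bb \<zeta> \<eta> - (m - 1)) \<partial>M) + (\<integral>\<eta>. max 0 (gromov_bb \<zeta>' \<eta> - (m - 1)) \<partial>M)))"
      unfolding g_def using t(1,3) by (simp add: M.prob_space)
    also have "\<dots> \<le> C * (e0 + (m + 1) * (C1 * exp (- \<delta> * (m - 1)) + C1 * exp (- \<delta> * (m - 1))))"
      using t(2,4) C m by (intro mult_left_mono add_left_mono add_mono) auto
    also have "\<dots> = C * e0 + C * (2 * (m + 1) * (C1 * exp (- \<delta> * (m - 1))))"
      by (simp add: distrib_left)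
    also have "\<dots> \<le> e" using m e0 by linarith
    finally show ?thesis .
  qed
  show ?thesis
  proof (intro exI[of _ N] ballI impI)
    fix \<zeta> \<zeta>' assume "\<zeta> \<in> \<Lambda>" "\<zeta>' \<in> \<Lambda>" "\<zeta> = \<zeta>' \<or> N \<le> gromov_bb \<zeta> \<zeta>'"
    then show "\<bar>potential \<phi> \<zeta> - potential \<phi> \<zeta>'\<bar> \<le> e"
      using main[of \<zeta> \<zeta>'] e by (cases "\<zeta> = \<zeta>'") simp_all
  qed
qed

text \<open>The elements \<open>g\<^sub>n(\<xi>)\<close> of the overview, as a relation. All limits
  along them are uniform over the pairs \<open>\<zeta>\<close>, \<open>g\<close> at time
  \<open>n\<close>, so any measurable choice can be inserted later.\<close>

definition tracks :: "nat \<Rightarrow> (real \<Rightarrow> 'a) \<Rightarrow> ('a \<Rightarrow> 'a) \<Rightarrow> bool" where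
  "tracks n \<zeta> g \<longleftrightarrow> \<zeta> \<in> \<Lambda> \<and> g \<in> G \<and> dist (\<zeta> (real n)) (g x0) \<le> R"

lemma inv_dist: "g \<in> G \<Longrightarrow> dist (inv g x0) x0 = dist (g x0) x0"
  using isometry_dist[OF isom, of g "inv g x0" x0] by (simp add: isometry_inv_app isom dist_commute)

lemma tracks_dist:
  assumes "tracks n \<zeta> g" shows "\<bar>dist (g x0) x0 - real n\<bar> \<le> R"
  using assms bd_dist0[OF \<Lambda>_bd, of \<zeta> "real n"]
    dist_triangle[of "g x0" x0 "\<zeta> n"] dist_triangle[of "\<zeta> n" x0 "g x0"]
  by (auto simp: tracks_def dist_commute abs_le_iff)

lemma integral_density_1:
  assumes "g \<in> G"
  shows "integrable M (\<lambda>\<xi>. exp (- \<delta> * bz \<xi> (g x0)))" "(\<integral>\<xi>. exp (- \<delta> * bz \<xi> (g x0)) \<partial>M) = 1"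
  using change_of_base[OF assms, of "\<lambda>_. 1"] by (auto simp: M.prob_space)

text \<open>Off an exceptional set \<open>act g\<close> sends \<open>\<xi>\<close> close to
  \<open>\<zeta>\<close>, and \<open>potential_modulus\<close> applies. On the exceptional set
  \<open>bz \<xi> (inv g x0)\<close> is at most \<open>- (L / 2)\<close>, so the density of
  \<open>\<mu> (inv g x0)\<close> is at least \<open>exp (\<delta> * (L / 2))\<close> there; since
  its integral is 1, the set has mass at most \<open>exp (- \<delta> * (L / 2))\<close>.\<close>

lemma potential_along:
  assumes \<psi>: "continuous_on bd \<psi>" and \<phi>: "continuous_on bd \<phi>" and e: "0 < e"
  shows "\<exists>n0. \<forall>n\<ge>n0. \<forall>\<zeta> g. tracks n \<zeta> g \<longrightarrow>
     \<bar>(\<integral>\<xi>. \<psi> \<xi> * potential \<phi> (act g \<xi>) \<partial>M) - (\<integral>\<xi>. \<psi> \<xi> \<partial>M) * potential \<phi> \<zeta>\<bar> \<le> e"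
proof -
  obtain C where C: "0 \<le> C" "\<forall>\<xi>\<in>bd. \<bar>\<psi> \<xi>\<bar> \<le> C" using continuous_bounded[OF \<psi>] by blast
  obtain D where D: "0 \<le> D" "\<forall>\<xi>\<in>bd. \<bar>\<phi> \<xi>\<bar> \<le> D" using continuous_bounded[OF \<phi>] by blast
  define B where "B = 2 * (D * C1)"
  have B0: "0 \<le> B" using D C1_nonneg by (simp add: B_def)
  define e1 where "e1 = e / (2 * (C + 1))"
  have e1: "0 < e1" "C * e1 \<le> e / 2" using e C(1) by (auto simp: e1_def field_simps)
  obtain N where N: "\<And>\<zeta> \<zeta>'. \<zeta> \<in> \<Lambda> \<Longrightarrow> \<zeta>' \<in> \<Lambda> \<Longrightarrow> \<zeta> = \<zeta>' \<or> N \<le> gromov_bb \<zeta> \<zeta>' \<Longrightarrow> \<bar>potential \<phi> \<zeta> - potential \<phi> \<zeta>'\<bar> \<le> e1"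
    using potential_modulus[OF \<phi> e1(1)] by blast
  have "((\<lambda>t. C * (B * exp (- \<delta> * ((t - R) / 2)))) \<longlongrightarrow> 0) at_top" using \<delta> by real_asymp
  then have "\<forall>\<^sub>F t in at_top. C * (B * exp (- \<delta> * ((t - R) / 2))) < e / 2"
    using e by (intro order_tendstoD) auto
  \<comment> \<open>Off the exceptional set the Gromov product of \<open>act g \<xi>\<close> and
    \<open>\<zeta>\<close> is at least \<open>(n - L / 2 - R) / 2\<close> with
    \<open>L \<le> n + R\<close>; the bound \<open>4 * N + 3 * R\<close> for \<open>n\<close> makes
    this at least \<open>N\<close>.\<close>
  then have "\<forall>\<^sub>F t in at_top. C * (B * exp (- \<delta> * ((t - R) / 2))) < e / 2 \<and> 4 * N + 3 * R \<le> t"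
    using eventually_ge_at_top[of "4 * N + 3 * R"] by eventually_elim simp
  then obtain t0 where t0: "\<And>t. t0 \<le> t \<Longrightarrow> C * (B * exp (- \<delta> * ((t - R) / 2))) < e / 2 \<and> 4 * N + 3 * R \<le> t"
    unfolding eventually_at_top_linorder by blast
  obtain n0 :: nat where n0: "t0 \<le> real n0" using real_arch_simple by blast
  have "\<bar>(\<integral>\<xi>. \<psi> \<xi> * potential \<phi> (act g \<xi>) \<partial>M) - (\<integral>\<xi>. \<psi> \<xi> \<partial>M) * potential \<phi> \<zeta>\<bar> \<le> e"
    if n: "n0 \<le> n" and gd: "tracks n \<zeta> g" for n \<zeta> g
  proof -
    have g: "g \<in> G" "\<zeta> \<in> \<Lambda>" "dist (\<zeta> (real n)) (g x0) \<le> R" using gd by (auto simp: tracks_def)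
    have tn: "C * (B * exp (- \<delta> * ((real n - R) / 2))) < e / 2" "4 * N + 3 * R \<le> real n"
      using t0[of "real n"] n n0 by auto
    define L where "L = dist (g x0) x0"
    have L: "\<bar>L - real n\<bar> \<le> R" using tracks_dist[OF gd] by (simp add: L_def)
    note [measurable] = continuous_borel[OF \<psi>] potential_measurable[OF \<phi>] act_measurable[OF g(1)]
    define h where "h \<xi> = C * (e1 + B * exp (- \<delta> * (L / 2)) * exp (- \<delta> * bz \<xi> (inv g x0)))" for \<xi>
    note d1 = integral_density_1[OF G_inv[OF g(1)]]
    have hi: "integrable M h" unfolding h_def using d1 by simp
    have ae: "AE \<xi> in M. \<bar>\<psi> \<xi> * potential \<phi> (act g \<xi>) - \<psi> \<xi> * potential \<phi> \<zeta>\<bar> \<le> h \<xi>"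
      using AE_\<Lambda>
    proof eventually_elim
      case (elim \<xi>)
      note b = \<Lambda>_bd[OF elim]
      have g\<xi>: "act g \<xi> \<in> \<Lambda>" using act_\<Lambda> g elim by blast
      have "\<bar>potential \<phi> (act g \<xi>) - potential \<phi> \<zeta>\<bar> \<le> e1 + B * exp (- \<delta> * (L / 2)) * exp (- \<delta> * bz \<xi> (inv g x0))"
      proof (cases "- (L / 2) < bz \<xi> (inv g x0)")
        case True
        have "act g \<xi> = \<zeta> \<or> N \<le> gromov_bb (act g \<xi>) \<zeta>"
        proof (cases "act g \<xi> = \<zeta>")
          case False
          have "(real n - bz (act g \<xi>) (\<zeta> n)) / 2 \<le> gromov_bb (act g \<xi>) \<zeta>"
            using False by (intro gromov_ge_point \<Lambda>_bd g\<xi> g) auto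
          moreover have "bz (act g \<xi>) (\<zeta> n) \<le> bz (act g \<xi>) (g x0) + R"
            using bz_lipschitz[OF \<Lambda>_bd[OF g\<xi>], of "\<zeta> n" "g x0"] g(3) by simp
          moreover have "bz (act g \<xi>) (g x0) = - bz \<xi> (inv g x0)"
            by (rule bz_act_neg[OF isom[OF g(1)] b])
          ultimately show ?thesis using True L tn(2) by (simp add: abs_le_iff)
        qed simp
        then have "\<bar>potential \<phi> (act g \<xi>) - potential \<phi> \<zeta>\<bar> \<le> e1" using N g\<xi> g by blast
        then show ?thesis using B0 by (simp add: add_increasing2)
      next
        case False
        have "\<bar>potential \<phi> (act g \<xi>) - potential \<phi> \<zeta>\<bar> \<le> B"
          using potential_bound(2)[OF \<phi> D(2) g\<xi>] potential_bound(2)[OF \<phi> D(2) g(2)] by (simp add: B_def)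
        also have "B \<le> B * exp (- \<delta> * (L / 2) + - \<delta> * bz \<xi> (inv g x0))"
        proof -
          have "\<delta> * (L / 2 + bz \<xi> (inv g x0)) \<le> 0" using False \<delta> by (intro mult_nonneg_nonpos) auto
          then have "1 \<le> exp (- \<delta> * (L / 2) + - \<delta> * bz \<xi> (inv g x0))" by (simp add: algebra_simps)
          then have "B * 1 \<le> B * exp (- \<delta> * (L / 2) + - \<delta> * bz \<xi> (inv g x0))" using B0 by (rule mult_left_mono)
          then show ?thesis by simp
        qed
        finally have "\<bar>potential \<phi> (act g \<xi>) - potential \<phi> \<zeta>\<bar> \<le> B * exp (- \<delta> * (L / 2)) * exp (- \<delta> * bz \<xi> (inv g x0))"
          by (simp only: exp_add mult.assoc)
        then show ?thesis using e1(1) by linarith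
      qed
      moreover have "\<psi> \<xi> * potential \<phi> (act g \<xi>) - \<psi> \<xi> * potential \<phi> \<zeta> = \<psi> \<xi> * (potential \<phi> (act g \<xi>) - potential \<phi> \<zeta>)"
        by (simp add: algebra_simps)
      moreover have "\<bar>\<psi> \<xi>\<bar> \<le> C" using C b by blast
      ultimately show ?case unfolding h_def using C(1) by (simp add: abs_mult) (intro mult_mono, auto)
    qed
    have ip: "integrable M (\<lambda>\<xi>. \<psi> \<xi> * potential \<phi> (act g \<xi>))"
    proof (rule abs_integral_le_const(1))
      show "AE \<xi> in M. \<bar>\<psi> \<xi> * potential \<phi> (act g \<xi>)\<bar> \<le> C * (D * C1)"
        using AE_\<Lambda> by eventually_elim
         (use C D potential_bound(2)[OF \<phi> D(2) act_\<Lambda>[OF g(1)]] \<Lambda>_bd in \<open>auto simp: abs_mult intro!: mult_mono\<close>)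
    qed measurable
    have "(\<integral>\<xi>. \<psi> \<xi> * potential \<phi> (act g \<xi>) \<partial>M) - (\<integral>\<xi>. \<psi> \<xi> \<partial>M) * potential \<phi> \<zeta> = (\<integral>\<xi>. \<psi> \<xi> * potential \<phi> (act g \<xi>) - \<psi> \<xi> * potential \<phi> \<zeta> \<partial>M)"
      using ip continuous_integrable[OF \<psi>] by simp
    also have "\<bar>\<dots>\<bar> \<le> (\<integral>\<xi>. h \<xi> \<partial>M)"
      by (rule abs_integral_le(2)[OF _ hi ae]) measurable
    also have "\<dots> = C * e1 + C * (B * exp (- \<delta> * (L / 2)))"
      unfolding h_def using d1 by (simp add: M.prob_space algebra_simps)
    also have "\<dots> \<le> C * e1 + C * (B * exp (- \<delta> * ((real n - R) / 2)))"
      using C(1) B0 \<delta> L by (intro add_left_mono mult_left_mono) auto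
    also have "\<dots> \<le> e" using e1 tn by simp
    finally show ?thesis .
  qed
  then show ?thesis by blast
qed

section \<open>The form and the cocycle on real functions\<close>

definition zero_mean :: "((real \<Rightarrow> 'a) \<Rightarrow> real) set" where
  "zero_mean = {\<phi>. continuous_on bd \<phi> \<and> (\<integral>\<xi>. \<phi> \<xi> \<partial>M) = 0}"

text \<open>The kernel is real, so the complex form reduces to this one on real and imaginary parts,
  and the estimates need only be made for real functions.\<close>

definition Q_real :: "((real \<Rightarrow> 'a) \<Rightarrow> real) \<Rightarrow> ((real \<Rightarrow> 'a) \<Rightarrow> real) \<Rightarrow> real" where
  "Q_real \<psi> \<phi> = (\<integral>\<xi>. \<psi> \<xi> * potential \<phi> \<xi> \<partial>M)"

definition cocyc_real :: "('a \<Rightarrow> 'a) \<Rightarrow> (real \<Rightarrow> 'a) \<Rightarrow> real" where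
  "cocyc_real g \<xi> = exp (- \<delta> * bz \<xi> x0) - exp (- \<delta> * bz \<xi> (g x0))"

definition pi_real :: "('a \<Rightarrow> 'a) \<Rightarrow> ((real \<Rightarrow> 'a) \<Rightarrow> real) \<Rightarrow> (real \<Rightarrow> 'a) \<Rightarrow> real" where
  "pi_real g a \<xi> = exp (- \<delta> * bz \<xi> (g x0)) * a (act (inv g) \<xi>)"

lemma zero_mean_continuous: "\<phi> \<in> zero_mean \<Longrightarrow> continuous_on bd \<phi>"
  by (simp add: zero_mean_def)

lemma zero_mean_integral: "\<phi> \<in> zero_mean \<Longrightarrow> (\<integral>\<xi>. \<phi> \<xi> \<partial>M) = 0"
  by (simp add: zero_mean_def)

lemma exp_bz_continuous: "continuous_on bd (\<lambda>\<xi>. exp (- \<delta> * bz \<xi> x))"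
  by (intro continuous_intros continuous_on_bz)

lemma integral_cong_bd:
  fixes f g :: "(real \<Rightarrow> 'a) \<Rightarrow> real"
  assumes "\<And>\<xi>. \<xi> \<in> bd \<Longrightarrow> f \<xi> = g \<xi>"
  shows "(\<integral>\<xi>. f \<xi> \<partial>M) = (\<integral>\<xi>. g \<xi> \<partial>M)"
  by (rule Bochner_Integration.integral_cong) (auto simp: space_M assms)

lemma cocyc_real_zero_mean:
  assumes "g \<in> G" shows "cocyc_real g \<in> zero_mean"
proof -
  have "continuous_on bd (cocyc_real g)"
    unfolding cocyc_real_def[abs_def] by (intro continuous_on_diff exp_bz_continuous)
  moreover have "(\<integral>\<xi>. cocyc_real g \<xi> \<partial>M) = (\<integral>\<xi>. 1 - exp (- \<delta> * bz \<xi> (g x0)) \<partial>M)"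
    by (rule integral_cong_bd) (simp add: cocyc_real_def bz_0)
  moreover have "\<dots> = 0"
    using integral_density_1[OF assms] by (simp add: M.prob_space)
  ultimately show ?thesis by (simp add: zero_mean_def)
qed

lemma pi_real_continuous:
  assumes g: "g \<in> G" and a: "continuous_on bd a" shows "continuous_on bd (pi_real g a)"
  unfolding pi_real_def[abs_def]
proof (intro continuous_on_mult exp_bz_continuous)
  show "continuous_on bd (\<lambda>\<xi>. a (act (inv g) \<xi>))"
    by (rule continuous_on_compose2[OF a continuous_on_act[OF isom[OF G_inv[OF g]]]])
       (use G_act_bd[OF G_inv[OF g]] in blast)
qed

lemma compose_act_measurable:
  assumes "g \<in> G" "f \<in> borel_measurable Bd" shows "(\<lambda>\<xi>. f (act g \<xi>)) \<in> borel_measurable Bd"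
  by (rule measurable_compose[OF act_measurable[OF assms(1)] assms(2)])

text \<open>The signed measure with density \<open>pi_real g a\<close> is the image under
  \<open>act g\<close> of the one with density \<open>a\<close>. Coefficients of the representation
  thus become integrals of a potential composed with \<open>act g\<close>.\<close>

lemma change_pi_real:
  assumes g: "g \<in> G" and a: "continuous_on bd a" and f: "f \<in> borel_measurable Bd"
  shows "(\<integral>\<xi>. pi_real g a \<xi> * f \<xi> \<partial>M) = (\<integral>\<xi>. a \<xi> * f (act g \<xi>) \<partial>M)"
proof -
  have m: "(\<lambda>\<xi>. a (act (inv g) \<xi>) * f \<xi>) \<in> borel_measurable Bd"
    by (intro borel_measurable_times compose_act_measurable G_inv g continuous_borel a f)
  have "(\<integral>\<xi>. pi_real g a \<xi> * f \<xi> \<partial>M) = (\<integral>\<xi>. exp (- \<delta> * bz \<xi> (g x0)) * (a (act (inv g) \<xi>) * f \<xi>) \<partial>M)"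
    by (simp add: pi_real_def mult.assoc)
  also have "\<dots> = (\<integral>\<xi>. a (act (inv g) (act g \<xi>)) * f (act g \<xi>) \<partial>M)" by (rule change_of_base(1)[OF g m])
  also have "\<dots> = (\<integral>\<xi>. a \<xi> * f (act g \<xi>) \<partial>M)"
    by (rule integral_cong_bd) (simp add: act_inv_act[OF isom[OF g]])
  finally show ?thesis .
qed

lemma pi_real_zero_mean:
  assumes g: "g \<in> G" and a: "a \<in> zero_mean" shows "pi_real g a \<in> zero_mean"
  using change_pi_real[OF g zero_mean_continuous[OF a], of "\<lambda>_. 1"] pi_real_continuous[OF g zero_mean_continuous[OF a]] zero_mean_integral[OF a]
  by (simp add: zero_mean_def)

lemma potential_bounded:
  assumes "continuous_on bd \<phi>" shows "\<exists>B\<ge>0. \<forall>\<zeta>\<in>\<Lambda>. \<bar>potential \<phi> \<zeta>\<bar> \<le> B"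
proof -
  obtain C where C: "0 \<le> C" "\<forall>\<xi>\<in>bd. \<bar>\<phi> \<xi>\<bar> \<le> C" using continuous_bounded[OF assms] by blast
  then show ?thesis using potential_bound(2)[OF assms C(2)] C1_nonneg
    by (intro exI[of _ "C * C1"]) auto
qed

lemma integrable_potential:
  assumes a: "continuous_on bd a" and \<phi>: "continuous_on bd \<phi>"
  shows "integrable M (\<lambda>\<xi>. a \<xi> * potential \<phi> \<xi>)" "g \<in> G \<Longrightarrow> integrable M (\<lambda>\<xi>. a \<xi> * potential \<phi> (act g \<xi>))"
proof -
  obtain C where C: "0 \<le> C" "\<forall>\<xi>\<in>bd. \<bar>a \<xi>\<bar> \<le> C" using continuous_bounded[OF a] by blast
  obtain B where B: "0 \<le> B" "\<forall>\<zeta>\<in>\<Lambda>. \<bar>potential \<phi> \<zeta>\<bar> \<le> B" using potential_bounded[OF \<phi>] by blast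
  have le: "\<bar>a \<xi> * potential \<phi> \<zeta>\<bar> \<le> C * B" if "\<xi> \<in> \<Lambda>" "\<zeta> \<in> \<Lambda>" for \<xi> \<zeta>
    unfolding abs_mult using C B that \<Lambda>_bd by (intro mult_mono) auto
  show "integrable M (\<lambda>\<xi>. a \<xi> * potential \<phi> \<xi>)"
  proof (rule abs_integral_le_const(1))
    show "AE \<xi> in M. \<bar>a \<xi> * potential \<phi> \<xi>\<bar> \<le> C * B" using AE_\<Lambda> by eventually_elim (rule le)
  qed (intro borel_measurable_times continuous_borel a potential_measurable \<phi>)
  assume g: "g \<in> G"
  show "integrable M (\<lambda>\<xi>. a \<xi> * potential \<phi> (act g \<xi>))"
  proof (rule abs_integral_le_const(1))
    show "AE \<xi> in M. \<bar>a \<xi> * potential \<phi> (act g \<xi>)\<bar> \<le> C * B"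
      using AE_\<Lambda> by eventually_elim (rule le[OF _ act_\<Lambda>[OF g]])
  qed (intro borel_measurable_times continuous_borel a compose_act_measurable g potential_measurable \<phi>)
qed

lemma Q_real_pi_real:
  assumes "g \<in> G" "continuous_on bd a" "continuous_on bd \<phi>"
  shows "Q_real (pi_real g a) \<phi> = (\<integral>\<xi>. a \<xi> * potential \<phi> (act g \<xi>) \<partial>M)"
  unfolding Q_real_def by (rule change_pi_real[OF assms(1,2) potential_measurable[OF assms(3)]])

text \<open>\<open>cocyc_real g\<close> is the density of \<open>M\<close> minus its image under
  \<open>act g\<close>.\<close>

lemma Q_real_cocyc:
  assumes g: "g \<in> G" and \<phi>: "continuous_on bd \<phi>"
  shows "Q_real (cocyc_real g) \<phi> = (\<integral>\<xi>. potential \<phi> \<xi> \<partial>M) - (\<integral>\<xi>. potential \<phi> (act g \<xi>) \<partial>M)"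
proof -
  have "Q_real (cocyc_real g) \<phi> = (\<integral>\<xi>. potential \<phi> \<xi> - exp (- \<delta> * bz \<xi> (g x0)) * potential \<phi> \<xi> \<partial>M)"
    unfolding Q_real_def by (rule integral_cong_bd) (simp add: cocyc_real_def bz_0 left_diff_distrib)
  also have "\<dots> = (\<integral>\<xi>. potential \<phi> \<xi> \<partial>M) - (\<integral>\<xi>. exp (- \<delta> * bz \<xi> (g x0)) * potential \<phi> \<xi> \<partial>M)"
    using integrable_potential(1)[OF continuous_on_const[of _ 1] \<phi>] integrable_potential(1)[OF exp_bz_continuous \<phi>, of "g x0"] by simp
  also have "(\<integral>\<xi>. exp (- \<delta> * bz \<xi> (g x0)) * potential \<phi> \<xi> \<partial>M) = (\<integral>\<xi>. potential \<phi> (act g \<xi>) \<partial>M)"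
    by (rule change_of_base(1)[OF g potential_measurable[OF \<phi>]])
  finally show ?thesis .
qed

lemma cocycle_limit:
  assumes \<phi>: "continuous_on bd \<phi>" and e: "0 < e"
  shows "\<exists>n0. \<forall>n\<ge>n0. \<forall>\<zeta> g. tracks n \<zeta> g \<longrightarrow> \<bar>Q_real (cocyc_real g) \<phi> - ((\<integral>\<xi>. potential \<phi> \<xi> \<partial>M) - potential \<phi> \<zeta>)\<bar> \<le> e"
proof -
  obtain n0 where n0: "\<And>n \<zeta> g. n0 \<le> n \<Longrightarrow> tracks n \<zeta> g \<Longrightarrow>
     \<bar>(\<integral>\<xi>. 1 * potential \<phi> (act g \<xi>) \<partial>M) - (\<integral>\<xi>. 1 \<partial>M) * potential \<phi> \<zeta>\<bar> \<le> e"
    using potential_along[OF continuous_on_const[of _ 1] \<phi> e] by metis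
  have "\<bar>Q_real (cocyc_real g) \<phi> - ((\<integral>\<xi>. potential \<phi> \<xi> \<partial>M) - potential \<phi> \<zeta>)\<bar> \<le> e" if "n0 \<le> n" "tracks n \<zeta> g" for n \<zeta> g
  proof -
    have "g \<in> G" using that by (simp add: tracks_def)
    then show ?thesis using n0[OF that] Q_real_cocyc[OF _ \<phi>, of g] by (simp add: M.prob_space abs_le_iff)
  qed
  then show ?thesis by blast
qed

text \<open>In \<open>potential_along\<close> a weight of mean zero kills the main term, the
  multiple of the value at \<open>\<zeta>\<close>. In \<open>cocycle_limit\<close> the weight is 1
  and this term is what survives.\<close>

lemma mixing:
  assumes a: "a \<in> zero_mean" and \<phi>: "continuous_on bd \<phi>" and e: "0 < e"
  shows "\<exists>n0. \<forall>n\<ge>n0. \<forall>\<zeta> g. tracks n \<zeta> g \<longrightarrow> \<bar>Q_real (pi_real g a) \<phi>\<bar> \<le> e"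
proof -
  obtain n0 where n0: "\<And>n \<zeta> g. n0 \<le> n \<Longrightarrow> tracks n \<zeta> g \<Longrightarrow>
     \<bar>(\<integral>\<xi>. a \<xi> * potential \<phi> (act g \<xi>) \<partial>M) - (\<integral>\<xi>. a \<xi> \<partial>M) * potential \<phi> \<zeta>\<bar> \<le> e"
    using potential_along[OF zero_mean_continuous[OF a] \<phi> e] by metis
  have "\<bar>Q_real (pi_real g a) \<phi>\<bar> \<le> e" if "n0 \<le> n" "tracks n \<zeta> g" for n \<zeta> g
  proof -
    have "g \<in> G" using that by (simp add: tracks_def)
    then show ?thesis using n0[OF that] Q_real_pi_real[OF _ zero_mean_continuous[OF a] \<phi>, of g] zero_mean_integral[OF a] by simp
  qed
  then show ?thesis by blast
qed

section \<open>Unitarity of the representation\<close>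

lemma potential_pi_real:
  assumes g: "g \<in> G" and b: "b \<in> zero_mean" and \<xi>: "\<xi> \<in> \<Lambda>"
  shows "potential (pi_real g b) (act g \<xi>) = potential b \<xi> + (\<integral>\<eta>. b \<eta> * (bz \<eta> (inv g x0) / 2) \<partial>M)"
proof -
  note cb = zero_mean_continuous[OF b]
  note g\<xi> = \<Lambda>_bd[OF act_\<Lambda>[OF g \<xi>]]
  obtain C where C: "\<forall>\<xi>\<in>bd. \<bar>b \<xi>\<bar> \<le> C" using continuous_bounded[OF cb] by blast
  have c2: "continuous_on bd (\<lambda>\<eta>. b \<eta> * (bz \<eta> (inv g x0) / 2))"
    by (intro continuous_on_mult cb continuous_on_divide continuous_on_bz continuous_on_const) simp
  have "potential (pi_real g b) (act g \<xi>) = (\<integral>\<eta>. b \<eta> * gromov_bb (act g \<xi>) (act g \<eta>) \<partial>M)"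
    unfolding potential_def by (rule change_pi_real[OF g cb gromov_borel[OF g\<xi>]])
  \<comment> \<open>By \<open>gromov_act\<close> the kernel gains half of two Busemann terms. The
    one in \<open>\<xi>\<close> multiplies the mean of \<open>b\<close>, which is 0; the one in
    \<open>\<eta>\<close> integrates to a constant.\<close>
  also have "\<dots> = (\<integral>\<eta>. b \<eta> * gromov_bb \<xi> \<eta> + (bz \<xi> (inv g x0) / 2) * b \<eta> + b \<eta> * (bz \<eta> (inv g x0) / 2) \<partial>M)"
  proof (rule integral_cong_AE)
    show "AE \<eta> in M. b \<eta> * gromov_bb (act g \<xi>) (act g \<eta>) = b \<eta> * gromov_bb \<xi> \<eta> + (bz \<xi> (inv g x0) / 2) * b \<eta> + b \<eta> * (bz \<eta> (inv g x0) / 2)"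
      using AE_bd AE_neq[OF \<xi>]
    proof eventually_elim
      case (elim \<eta>)
      then show ?case using gromov_act[OF isom[OF g] \<Lambda>_bd[OF \<xi>] elim(1)] by (simp add: field_simps)
    qed
    show "(\<lambda>\<eta>. b \<eta> * gromov_bb (act g \<xi>) (act g \<eta>)) \<in> borel_measurable M"
      unfolding measurable_M
      by (intro borel_measurable_times continuous_borel cb compose_act_measurable g gromov_borel g\<xi>)
    show "(\<lambda>\<eta>. b \<eta> * gromov_bb \<xi> \<eta> + (bz \<xi> (inv g x0) / 2) * b \<eta> + b \<eta> * (bz \<eta> (inv g x0) / 2)) \<in> borel_measurable M"
      unfolding measurable_M
      by (intro borel_measurable_times borel_measurable_add borel_measurable_const continuous_borel[OF cb] continuous_borel[OF c2] gromov_borel \<Lambda>_bd[OF \<xi>])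
  qed
  also have "\<dots> = potential b \<xi> + (bz \<xi> (inv g x0) / 2) * (\<integral>\<eta>. b \<eta> \<partial>M) + (\<integral>\<eta>. b \<eta> * (bz \<eta> (inv g x0) / 2) \<partial>M)"
    unfolding potential_def using potential_bound(1)[OF cb C \<xi>] continuous_integrable[OF cb] continuous_integrable[OF c2] by simp
  finally show ?thesis using zero_mean_integral[OF b] by simp
qed

text \<open>Under \<open>g\<close> the potential changes by a constant only, which \<open>a\<close>
  of mean zero does not see. From this \<open>U_norm\<close> obtains that the bounded operators
  \<open>U g\<close> are contractions.\<close>

lemma Q_real_unitary:
  assumes g: "g \<in> G" and a: "a \<in> zero_mean" and b: "b \<in> zero_mean"
  shows "Q_real (pi_real g a) (pi_real g b) = Q_real a b"
proof -
  define c where "c = (\<integral>\<eta>. b \<eta> * (bz \<eta> (inv g x0) / 2) \<partial>M)"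
  note ca = zero_mean_continuous[OF a] and cb = zero_mean_continuous[OF b]
  note cp = pi_real_continuous[OF g cb]
  have "Q_real (pi_real g a) (pi_real g b) = (\<integral>\<xi>. a \<xi> * potential (pi_real g b) (act g \<xi>) \<partial>M)"
    by (rule Q_real_pi_real[OF g ca cp])
  also have "\<dots> = (\<integral>\<xi>. a \<xi> * potential b \<xi> + c * a \<xi> \<partial>M)"
  proof (rule integral_cong_AE)
    show "AE \<xi> in M. a \<xi> * potential (pi_real g b) (act g \<xi>) = a \<xi> * potential b \<xi> + c * a \<xi>"
      using AE_\<Lambda> by eventually_elim (simp add: potential_pi_real[OF g b] c_def distrib_left)
    show "(\<lambda>\<xi>. a \<xi> * potential (pi_real g b) (act g \<xi>)) \<in> borel_measurable M"
      unfolding measurable_M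
      by (intro borel_measurable_times continuous_borel ca compose_act_measurable g potential_measurable cp)
    show "(\<lambda>\<xi>. a \<xi> * potential b \<xi> + c * a \<xi>) \<in> borel_measurable M"
      unfolding measurable_M
      by (intro borel_measurable_times borel_measurable_add borel_measurable_const continuous_borel ca potential_measurable cb)
  qed
  also have "\<dots> = Q_real a b"
    unfolding Q_real_def using integrable_potential(1)[OF ca cb] continuous_integrable[OF ca] zero_mean_integral[OF a] by simp
  finally show ?thesis .
qed

section \<open>Bounds for the pairing of two cocycle vectors\<close>

lemma shadow_potential:
  assumes h: "tracks n t h" and \<zeta>: "\<zeta> \<in> \<Lambda>" "\<zeta> \<noteq> t"
  shows "integrable M (\<lambda>\<eta>. gromov_bb \<zeta> (act h \<eta>))"
    and "\<bar>\<integral>\<eta>. gromov_bb \<zeta> (act h \<eta>) \<partial>M\<bar> \<le> C1 + R + gromov_bb \<zeta> t"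
proof -
  have hG: "h \<in> G" and t: "t \<in> \<Lambda>" "dist (t (real n)) (h x0) \<le> R" using h by (auto simp: tracks_def)
  define \<xi> where "\<xi> = act (inv h) \<zeta>"
  have \<xi>: "\<xi> \<in> \<Lambda>" unfolding \<xi>_def by (rule act_\<Lambda>[OF G_inv[OF hG] \<zeta>(1)])
  have \<zeta>\<xi>: "\<zeta> = act h \<xi>" unfolding \<xi>_def by (simp add: act_act_inv isom hG \<Lambda>_bd \<zeta>)
  define c where "c = R + gromov_bb \<zeta> t"
  have meas: "(\<lambda>\<eta>. gromov_bb \<zeta> (act h \<eta>)) \<in> borel_measurable Bd"
    by (intro compose_act_measurable hG gromov_borel \<Lambda>_bd[OF \<zeta>(1)])
  have i: "integrable M (\<lambda>\<eta>. gromov_bb \<xi> \<eta> + c)" using gromov_integrable(1)[OF \<xi>] by simp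
  have ae: "AE \<eta> in M. \<bar>gromov_bb \<zeta> (act h \<eta>)\<bar> \<le> gromov_bb \<xi> \<eta> + c"
    using AE_bd AE_neq[OF \<xi>]
  proof eventually_elim
    case (elim \<eta>)
    \<comment> \<open>The Busemann term of \<open>\<eta>\<close> is at most \<open>n + R\<close>,
      that of \<open>\<xi>\<close> at most \<open>2 * gromov_bb \<zeta> t + R - n\<close>. The times
      \<open>n\<close> cancel, and half the sum is at most \<open>c\<close>.\<close>
    have "gromov_bb \<zeta> (act h \<eta>) = gromov_bb \<xi> \<eta> + (bz \<xi> (inv h x0) + bz \<eta> (inv h x0)) / 2"
      unfolding \<zeta>\<xi> using elim gromov_act[OF isom[OF hG] \<Lambda>_bd[OF \<xi>] elim(1)] by simp
    moreover have "bz \<eta> (inv h x0) \<le> real n + R"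
      using bz_abs_le[OF elim(1), of "inv h x0"] tracks_dist[OF h] inv_dist[OF hG] by simp
    moreover have "bz \<xi> (inv h x0) = - bz \<zeta> (h x0)"
      unfolding \<zeta>\<xi> by (simp add: bz_act_neg isom hG \<Lambda>_bd[OF \<xi>])
    moreover have "- bz \<zeta> (h x0) \<le> R - bz \<zeta> (t n)"
      using bz_lipschitz[OF \<Lambda>_bd[OF \<zeta>(1)], of "t n" "h x0"] t(2) by simp
    moreover have "(real n - bz \<zeta> (t n)) / 2 \<le> gromov_bb \<zeta> t"
      using \<zeta> t by (intro gromov_ge_point \<Lambda>_bd) auto
    moreover have "0 \<le> gromov_bb \<zeta> (act h \<eta>)"
      by (intro gromov_bb_nonneg G_act_bd hG elim \<Lambda>_bd \<zeta>)
    ultimately show ?case by (simp add: c_def)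
  qed
  show "integrable M (\<lambda>\<eta>. gromov_bb \<zeta> (act h \<eta>))" by (rule abs_integral_le(1)[OF meas i ae])
  have "\<bar>\<integral>\<eta>. gromov_bb \<zeta> (act h \<eta>) \<partial>M\<bar> \<le> (\<integral>\<eta>. gromov_bb \<xi> \<eta> + c \<partial>M)"
    by (rule abs_integral_le(2)[OF meas i ae])
  also have "\<dots> = (\<integral>\<eta>. gromov_bb \<xi> \<eta> \<partial>M) + c" using gromov_integrable(1)[OF \<xi>] by (simp add: M.prob_space)
  also have "\<dots> \<le> C1 + R + gromov_bb \<zeta> t" using gromov_integrable(2)[OF \<xi>] by (simp add: c_def)
  finally show "\<bar>\<integral>\<eta>. gromov_bb \<zeta> (act h \<eta>) \<partial>M\<bar> \<le> C1 + R + gromov_bb \<zeta> t" .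
qed

lemma potential_cocyc_bound:
  assumes h: "tracks n t h" and \<zeta>: "\<zeta> \<in> \<Lambda>" "\<zeta> \<noteq> t"
  shows "\<bar>potential (cocyc_real h) \<zeta>\<bar> \<le> 2 * C1 + R + gromov_bb \<zeta> t"
proof -
  have hG: "h \<in> G" using h by (auto simp: tracks_def)
  note b = \<Lambda>_bd[OF \<zeta>(1)]
  obtain C where C: "\<forall>\<xi>\<in>bd. \<bar>exp (- \<delta> * bz \<xi> (h x0))\<bar> \<le> C" using continuous_bounded[OF exp_bz_continuous] by blast
  have "potential (cocyc_real h) \<zeta> = (\<integral>\<eta>. gromov_bb \<zeta> \<eta> - exp (- \<delta> * bz \<eta> (h x0)) * gromov_bb \<zeta> \<eta> \<partial>M)"
    unfolding potential_def by (rule integral_cong_bd) (simp add: cocyc_real_def bz_0 left_diff_distrib)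
  also have "\<dots> = (\<integral>\<eta>. gromov_bb \<zeta> \<eta> \<partial>M) - (\<integral>\<eta>. exp (- \<delta> * bz \<eta> (h x0)) * gromov_bb \<zeta> \<eta> \<partial>M)"
    using gromov_integrable(1)[OF \<zeta>(1)] potential_bound(1)[OF exp_bz_continuous C \<zeta>(1)]
    by (rule Bochner_Integration.integral_diff)
  also have "(\<integral>\<eta>. exp (- \<delta> * bz \<eta> (h x0)) * gromov_bb \<zeta> \<eta> \<partial>M) = (\<integral>\<eta>. gromov_bb \<zeta> (act h \<eta>) \<partial>M)"
    by (rule change_of_base(1)[OF hG gromov_borel[OF b]])
  finally show ?thesis
    using gromov_integrable(2,3)[OF \<zeta>(1)] shadow_potential(2)[OF assms] by linarith
qed

text \<open>\<open>Q_real_cocyc\<close> leaves two means of \<open>potential (cocyc_real h)\<close>,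
  one of them transported by \<open>g\<close>. Up to a constant the integrand is bounded by the
  Gromov product with \<open>t\<close>, whose mean is at most \<open>C1\<close> in the first and, by
  \<open>shadow_potential\<close>, at most \<open>C1 + R + gromov_bb s t\<close> in the second. The
  bound does not depend on \<open>n\<close>.\<close>

lemma cocycle_bound:
  assumes g: "tracks n s g" and h: "tracks n t h" and st: "s \<noteq> t"
  shows "\<bar>Q_real (cocyc_real g) (cocyc_real h)\<bar> \<le> 6 * C1 + 3 * R + gromov_bb s t"
proof -
  have G: "g \<in> G" "h \<in> G" and L: "s \<in> \<Lambda>" "t \<in> \<Lambda>" using g h by (auto simp: tracks_def)
  note ch = zero_mean_continuous[OF cocyc_real_zero_mean[OF G(2)]]
  define c where "c = 2 * C1 + R"
  note gi = gromov_integrable[OF L(2)]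
  have "\<bar>\<integral>\<xi>. potential (cocyc_real h) \<xi> \<partial>M\<bar> \<le> (\<integral>\<xi>. gromov_bb t \<xi> + c \<partial>M)"
  proof (rule abs_integral_le(2)[OF potential_measurable[OF ch]])
    show "AE \<xi> in M. \<bar>potential (cocyc_real h) \<xi>\<bar> \<le> gromov_bb t \<xi> + c"
      using AE_\<Lambda> AE_neq[OF L(2)] 
    proof eventually_elim
      case (elim \<xi>)
      then show ?case using potential_cocyc_bound[OF h, of \<xi>] by (simp add: c_def gromov_bb_commute)
    qed
  qed (use gi in simp)
  also have "\<dots> = (\<integral>\<xi>. gromov_bb t \<xi> \<partial>M) + c" using gi by (simp add: M.prob_space)
  finally have 1: "\<bar>\<integral>\<xi>. potential (cocyc_real h) \<xi> \<partial>M\<bar> \<le> C1 + c" using gi(2) by linarith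
  note sp = shadow_potential[OF g L(2) st[symmetric]]
  have "\<bar>\<integral>\<xi>. potential (cocyc_real h) (act g \<xi>) \<partial>M\<bar> \<le> (\<integral>\<xi>. gromov_bb t (act g \<xi>) + c \<partial>M)"
  proof (rule abs_integral_le(2)[OF compose_act_measurable[OF G(1) potential_measurable[OF ch]]])
    show "AE \<xi> in M. \<bar>potential (cocyc_real h) (act g \<xi>)\<bar> \<le> gromov_bb t (act g \<xi>) + c"
      using AE_\<Lambda> AE_neq[OF act_\<Lambda>[OF G_inv[OF G(1)] L(2)]]
    proof eventually_elim
      case (elim \<xi>)
      have "act g \<xi> \<noteq> t" using elim act_inv_act[OF isom[OF G(1)] \<Lambda>_bd[OF elim(1)]] by auto
      then show ?case using potential_cocyc_bound[OF h act_\<Lambda>[OF G(1) elim(1)]]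
        by (simp add: c_def gromov_bb_commute)
    qed
  qed (use sp(1) in simp)
  also have "\<dots> = (\<integral>\<xi>. gromov_bb t (act g \<xi>) \<partial>M) + c" using sp(1) by (simp add: M.prob_space)
  finally have 2: "\<bar>\<integral>\<xi>. potential (cocyc_real h) (act g \<xi>) \<partial>M\<bar> \<le> C1 + R + gromov_bb s t + c"
    using sp(2) unfolding gromov_bb_commute[of s t] by linarith
  show ?thesis
    unfolding Q_real_cocyc[OF G(1) ch] using 1 2 unfolding c_def by linarith
qed

section \<open>Measurable choice of tracking elements and finite averages\<close>

lemma ex_partition:
  "\<exists>N hs idx. (\<forall>i<N. hs i \<in> G) \<and> idx \<in> measurable Bd (count_space (UNIV::nat set)) \<and>
     (\<forall>\<xi>\<in>\<Lambda>. idx \<xi> < N \<and> tracks n \<xi> (hs (idx \<xi>)))"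
proof -
  \<comment> \<open>By \<open>tracks_dist\<close> an element tracking at time \<open>n\<close> moves
    \<open>x0\<close> by at most \<open>n + R\<close>, and discreteness leaves finitely many of
    those.\<close>
  define S where "S = {g\<in>G. dist x0 (g x0) \<le> real n + R}"
  have "finite S" using discr by (simp add: S_def discrete_group_def)
  then obtain hs where hs: "bij_betw hs {0..<card S} S" using ex_bij_betw_nat_finite by blast
  define N where "N = card S"
  \<comment> \<open>Taking the first suitable index makes the choice measurable in
    \<open>\<xi>\<close>.\<close>
  define idx where "idx \<xi> = (LEAST i. i < N \<and> dist (\<xi> (real n)) (hs i x0) \<le> R)" for \<xi>
  have hsS: "hs i \<in> S" if "i < N" for i using hs that by (auto simp: bij_betw_def N_def)
  have "idx \<in> measurable Bd (count_space UNIV)"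
    unfolding idx_def
  proof (rule measurable_Least)
    fix i
    have "(\<lambda>\<xi>. dist (\<xi> (real n)) (hs i x0)) \<in> borel_measurable Bd"
      by (intro continuous_borel continuous_on_dist continuous_on_eval continuous_on_const)
    then show "Measurable.pred Bd (\<lambda>\<xi>. i < N \<and> dist (\<xi> (real n)) (hs i x0) \<le> R)" by measurable
  qed
  moreover have "idx \<xi> < N \<and> tracks n \<xi> (hs (idx \<xi>))" if \<xi>: "\<xi> \<in> \<Lambda>" for \<xi>
  proof -
    obtain g where g: "g \<in> G" "dist (\<xi> (real n)) (g x0) \<le> R" using R(2)[OF \<xi>, of "real n"] by auto
    then have "g \<in> S" using tracks_dist[of n \<xi> g] \<xi> by (auto simp: S_def tracks_def dist_commute)
    then have "g \<in> hs ` {0..<card S}" using hs by (simp add: bij_betw_def)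
    then obtain i where "i < N" "g = hs i" by (auto simp: N_def)
    then have i: "i < N \<and> dist (\<xi> (real n)) (hs i x0) \<le> R" using g by simp
    have "idx \<xi> < N \<and> dist (\<xi> (real n)) (hs (idx \<xi>) x0) \<le> R"
      unfolding idx_def by (rule LeastI[where P = "\<lambda>i. i < N \<and> dist (\<xi> (real n)) (hs i x0) \<le> R", OF i])
    then show ?thesis using hsS \<xi> by (auto simp: tracks_def S_def)
  qed
  moreover have "hs i \<in> G" if "i < N" for i using hsS[OF that] by (simp add: S_def)
  ultimately have "(\<forall>i<N. hs i \<in> G) \<and> idx \<in> measurable Bd (count_space (UNIV::nat set)) \<and>
     (\<forall>\<xi>\<in>\<Lambda>. idx \<xi> < N \<and> tracks n \<xi> (hs (idx \<xi>)))" by blast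
  then show ?thesis by (intro exI)
qed

lemma idx_compose_measurable:
  assumes "idx \<in> measurable Bd (count_space (UNIV::nat set))"
  shows "(\<lambda>\<xi>. (f (idx \<xi>) :: real)) \<in> borel_measurable Bd"
  by (rule measurable_compose[OF assms borel_measurable_count_space])

text \<open>\<open>F\<close> will run through functionals on the Hilbert space: the Bochner integral of \<open>\<psi>\<close> times a
  vector-valued simple function is only available as this finite sum, since the Hilbert space need not be
  second countable.\<close>
lemma partition_sum:
  fixes F :: "nat \<Rightarrow> real"
  assumes \<psi>: "continuous_on bd \<psi>" and idx: "idx \<in> measurable Bd (count_space (UNIV::nat set))"
    and N: "\<And>\<xi>. \<xi> \<in> \<Lambda> \<Longrightarrow> idx \<xi> < N"
  shows "(\<Sum>i<N. (\<integral>\<xi>. \<psi> \<xi> * indicator {i} (idx \<xi>) \<partial>M) * F i) = (\<integral>\<xi>. \<psi> \<xi> * F (idx \<xi>) \<partial>M)"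
proof -
  note m1 = idx_compose_measurable[OF idx]
  have i: "integrable M (\<lambda>\<xi>. \<psi> \<xi> * indicator {i} (idx \<xi>))" for i
  proof (rule abs_integral_le(1))
    show "integrable M (\<lambda>\<xi>. \<bar>\<psi> \<xi>\<bar>)" using continuous_integrable[OF \<psi>] by simp
    show "(\<lambda>\<xi>. \<psi> \<xi> * indicator {i} (idx \<xi>)) \<in> borel_measurable Bd"
      by (intro borel_measurable_times continuous_borel \<psi> m1)
  qed (simp add: indicator_def)
  have "(\<Sum>i<N. (\<integral>\<xi>. \<psi> \<xi> * indicator {i} (idx \<xi>) \<partial>M) * F i) = (\<Sum>i<N. (\<integral>\<xi>. \<psi> \<xi> * indicator {i} (idx \<xi>) * F i \<partial>M))"
    by (simp only: integral_mult_left_zero)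
  also have "\<dots> = (\<integral>\<xi>. (\<Sum>i<N. \<psi> \<xi> * indicator {i} (idx \<xi>) * F i) \<partial>M)"
    using i by (intro Bochner_Integration.integral_sum[symmetric]) simp
  also have "\<dots> = (\<integral>\<xi>. \<psi> \<xi> * F (idx \<xi>) \<partial>M)"
  proof (rule integral_cong_AE)
    show "AE \<xi> in M. (\<Sum>i<N. \<psi> \<xi> * indicator {i} (idx \<xi>) * F i) = \<psi> \<xi> * F (idx \<xi>)"
      using AE_\<Lambda>
    proof eventually_elim
      case (elim \<xi>)
      have "(\<Sum>i<N. \<psi> \<xi> * indicator {i} (idx \<xi>) * F i) = (\<Sum>i<N. if i = idx \<xi> then \<psi> \<xi> * F i else 0)"
        by (intro sum.cong) (auto simp: indicator_def)
      then show ?case using N[OF elim] by simp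
    qed
    show "(\<lambda>\<xi>. \<Sum>i<N. \<psi> \<xi> * indicator {i} (idx \<xi>) * F i) \<in> borel_measurable M"
      unfolding measurable_M
      by (intro borel_measurable_sum borel_measurable_times borel_measurable_const continuous_borel \<psi> m1)
    show "(\<lambda>\<xi>. \<psi> \<xi> * F (idx \<xi>)) \<in> borel_measurable M"
      unfolding measurable_M
      by (intro borel_measurable_times continuous_borel \<psi> m1)
  qed
  finally show ?thesis .
qed

end

section \<open>Real Hilbert spaces\<close>

lemma ex_orthogonal:
  fixes S :: "'h::{real_inner,complete_space} set"
  assumes S: "subspace S" "closed S" and x: "x \<notin> S"
  shows "\<exists>v. v \<noteq> 0 \<and> (\<forall>s\<in>S. inner v s = 0)"
proof -
  define d where "d = infdist x S"
  have ne: "S \<noteq> {}" using subspace_0[OF S(1)] by blast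
  have d0: "0 \<le> d" by (simp add: d_def infdist_nonneg)
  have dle: "d \<le> norm (x - s)" if "s \<in> S" for s
    using infdist_le[OF that, of x] by (simp add: d_def dist_norm)
  have "\<exists>s\<in>S. norm (x - s) < d + inverse (real (Suc n))" for n
  proof (rule ccontr)
    assume "\<not> ?thesis"
    then have "d + inverse (real (Suc n)) \<le> (INF s\<in>S. dist x s)"
      using ne by (intro cINF_greatest) (auto simp: dist_norm not_less)
    then show False using ne by (simp add: d_def infdist_notempty)
  qed
  then obtain s where s: "\<And>n. s n \<in> S" "\<And>n. norm (x - s n) < d + inverse (real (Suc n))" by metis
  have bound: "(norm (x - s n))\<^sup>2 - d\<^sup>2 \<le> (2 * d + 1) * inverse (real (Suc n))" for n
  proof -
    define \<epsilon> where "\<epsilon> = inverse (real (Suc n))"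
    have \<epsilon>: "0 \<le> \<epsilon>" "\<epsilon> \<le> 1" by (simp_all add: \<epsilon>_def inverse_le_1_iff)
    have "(norm (x - s n))\<^sup>2 \<le> (d + \<epsilon>)\<^sup>2" using s(2)[of n] by (intro power_mono) (auto simp: \<epsilon>_def)
    also have "\<dots> = d\<^sup>2 + 2 * d * \<epsilon> + \<epsilon> * \<epsilon>" by (simp add: power2_eq_square algebra_simps)
    also have "\<epsilon> * \<epsilon> \<le> \<epsilon> * 1" using \<epsilon> by (intro mult_left_mono) auto
    finally show ?thesis by (simp add: \<epsilon>_def algebra_simps)
  qed
  \<comment> \<open>Parallelogram law: the midpoint of two points of \<open>S\<close> lies in
    \<open>S\<close>, so its distance from \<open>x\<close> is at least \<open>d\<close>.\<close>
  have par: "(norm (s m - s n))\<^sup>2 \<le> 2 * ((norm (x - s m))\<^sup>2 - d\<^sup>2) + 2 * ((norm (x - s n))\<^sup>2 - d\<^sup>2)" for m n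
  proof -
    define mid where "mid = (1/2::real) *\<^sub>R (s m + s n)"
    have "mid \<in> S" unfolding mid_def using S(1) s(1) by (intro subspace_scale subspace_add)
    then have "d\<^sup>2 \<le> (norm (x - mid))\<^sup>2" using dle d0 by (intro power_mono) auto
    moreover have "(norm (s m - s n))\<^sup>2 = 2 * (norm (x - s m))\<^sup>2 + 2 * (norm (x - s n))\<^sup>2 - 4 * (norm (x - mid))\<^sup>2"
      unfolding mid_def power2_norm_eq_inner by (simp add: inner_simps inner_commute algebra_simps)
    ultimately show ?thesis by simp
  qed
  have "Cauchy s"
  proof (rule metric_CauchyI)
    fix e :: real assume e: "0 < e"
    have "0 < e\<^sup>2 / (4 * (2 * d + 1))" using e d0 by simp
    then obtain N where N: "inverse (real (Suc N)) < e\<^sup>2 / (4 * (2 * d + 1))" using reals_Archimedean by blast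
    have "dist (s m) (s n) < e" if "N \<le> m" "N \<le> n" for m n
    proof -
      define q where "q = (2 * d + 1) * inverse (real (Suc N))"
      have le: "(norm (x - s k))\<^sup>2 - d\<^sup>2 \<le> q" if "N \<le> k" for k
      proof -
        have "(2 * d + 1) * inverse (real (Suc k)) \<le> q"
          unfolding q_def using that d0 by (intro mult_left_mono) (auto simp: field_simps)
        then show ?thesis using bound[of k] by (rule order_trans[rotated])
      qed
      have "(norm (s m - s n))\<^sup>2 \<le> 2 * q + 2 * q"
        by (rule order_trans[OF par]) (intro add_mono mult_left_mono le that; simp)
      then have "(norm (s m - s n))\<^sup>2 \<le> 4 * q" by simp
      then have "(norm (s m - s n))\<^sup>2 \<le> 4 * ((2 * d + 1) * inverse (real (Suc N)))" by (simp only: q_def)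
      also have "\<dots> < e\<^sup>2" using N d0 by (simp add: field_simps)
      finally show ?thesis using e by (simp add: dist_norm power2_less_imp_less)
    qed
    then show "\<exists>M. \<forall>m\<ge>M. \<forall>n\<ge>M. dist (s m) (s n) < e" by blast
  qed
  then obtain z where z: "s \<longlonglongrightarrow> z" using Cauchy_convergent convergent_def by blast
  have zS: "z \<in> S" using closed_sequentially[OF S(2)] s(1) z by blast
  have "norm (x - z) \<le> d + 0"
  proof (rule tendsto_le)
    show "(\<lambda>n. norm (x - s n)) \<longlonglongrightarrow> norm (x - z)" by (intro tendsto_intros z)
    show "(\<lambda>n. d + inverse (real (Suc n))) \<longlonglongrightarrow> d + 0" by (intro tendsto_intros LIMSEQ_inverse_real_of_nat)
    show "\<forall>\<^sub>F n in sequentially. norm (x - s n) \<le> d + inverse (real (Suc n))"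
      using s(2) by (intro always_eventually allI less_imp_le)
  qed simp
  then have nd: "norm (x - z) = d" using dle[OF zS] by simp
  define v where "v = x - z"
  have "inner v y = 0" if y: "y \<in> S" for y
  proof (rule ccontr)
    assume c: "inner v y \<noteq> 0"
    then have yy: "0 < inner y y" by auto
    \<comment> \<open>This multiple of \<open>y\<close> is the one closest to \<open>v\<close>. If
      \<open>inner v y\<close> were nonzero, adding it to \<open>z\<close> would give a point of
      \<open>S\<close> closer to \<open>x\<close> than \<open>d\<close>.\<close>
    define t where "t = inner v y / inner y y"
    have "z + t *\<^sub>R y \<in> S" using S(1) zS y by (intro subspace_add subspace_scale)
    then have "d\<^sup>2 \<le> (norm (v - t *\<^sub>R y))\<^sup>2" using dle[of "z + t *\<^sub>R y"] d0 by (intro power_mono) (auto simp: v_def algebra_simps)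
    also have "\<dots> = inner v v - 2 * t * inner v y + t * (t * inner y y)"
      unfolding power2_norm_eq_inner by (simp add: inner_simps inner_commute algebra_simps)
    also have "t * inner y y = inner v y" using yy by (simp add: t_def)
    also have "inner v v = d\<^sup>2" using nd by (simp add: v_def power2_norm_eq_inner[symmetric])
    finally have "t * inner v y \<le> 0" by simp
    moreover have "t * inner v y = (inner v y)\<^sup>2 / inner y y" by (simp add: t_def power2_eq_square)
    moreover have "0 < (inner v y)\<^sup>2 / inner y y" using c yy by simp
    ultimately show False by simp
  qed
  moreover have "v \<noteq> 0" using zS x by (auto simp: v_def)
  ultimately show ?thesis by blast
qed

lemma riesz:
  fixes f :: "'h::{real_inner,complete_space} \<Rightarrow> real"
  assumes f: "bounded_linear f"
  shows "\<exists>y. \<forall>x. f x = inner y x"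
proof -
  interpret bounded_linear f by (rule f)
  define S where "S = {x. f x = 0}"
  have S: "subspace S" by (auto simp: S_def subspace_def zero add scaleR)
  have "closed S" unfolding S_def
    by (intro closed_Collect_eq continuous_on_const linear_continuous_on f)
  show ?thesis
  proof (cases "S = UNIV")
    case True
    then show ?thesis by (intro exI[of _ 0]) (auto simp: S_def)
  next
    case False
    then obtain v where v: "v \<noteq> 0" "\<And>s. s \<in> S \<Longrightarrow> inner v s = 0"
      using ex_orthogonal[OF S \<open>closed S\<close>] by blast
    have vv: "inner v v \<noteq> 0" using v by simp
    have fv: "f v \<noteq> 0" using v(2)[of v] vv by (auto simp: S_def)
    have "f x = inner ((f v / inner v v) *\<^sub>R v) x" for x
    proof -
      have "x - (f x / f v) *\<^sub>R v \<in> S" using fv by (simp add: S_def diff scaleR)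
      from v(2)[OF this] have "inner v x = (f x / f v) * inner v v" by (simp add: inner_simps)
      then show ?thesis using vv fv by simp
    qed
    then show ?thesis by blast
  qed
qed

text \<open>The uniform norm bound carries the convergence from \<open>D\<close> to all test
  vectors; this is why \<open>weak_approximation\<close> has to control norms.\<close>

lemma weak_convergence_dense:
  fixes u :: "nat \<Rightarrow> 'h::real_inner"
  assumes B: "\<And>n. norm (u n) \<le> B" and D: "closure D = UNIV"
    and lim: "\<And>y. y \<in> D \<Longrightarrow> (\<lambda>n. inner (u n) y) \<longlonglongrightarrow> inner w y"
  shows "(\<lambda>n. inner (u n) y) \<longlonglongrightarrow> inner w y"
proof (rule LIMSEQ_I)
  fix e :: real assume e: "0 < e"
  have B0: "0 \<le> B" using B[of 0] norm_ge_zero[of "u 0"] by linarith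
  define c where "c = B + norm w + 1"
  have c: "0 < c" unfolding c_def using B0 by (intro add_nonneg_pos add_nonneg_nonneg) auto
  define \<eta> where "\<eta> = e / (2 * c)"
  have \<eta>: "0 < \<eta>" using e c by (simp add: \<eta>_def)
  have "y \<in> closure D" using D by simp
  then obtain y' where y': "y' \<in> D" "dist y' y < \<eta>" using \<eta> unfolding closure_approachable by blast
  obtain N where N: "\<And>n. N \<le> n \<Longrightarrow> norm (inner (u n) y' - inner w y') < e / 2"
    using LIMSEQ_D[OF lim[OF y'(1)], of "e/2"] e by auto
  have "norm (inner (u n) y - inner w y) < e" if "N \<le> n" for n
  proof -
    have "\<bar>inner (u n - w) (y - y')\<bar> \<le> norm (u n - w) * norm (y - y')" by (rule Cauchy_Schwarz_ineq2)
    also have "\<dots> \<le> (B + norm w) * \<eta>"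
      using B[of n] norm_triangle_ineq4[of "u n" w] y'(2) B0
      by (intro mult_mono) (auto simp: dist_norm norm_minus_commute)
    also have "\<dots> \<le> c * \<eta>" using \<eta> by (intro mult_right_mono) (auto simp: c_def)
    also have "\<dots> = e / 2" using c by (simp add: \<eta>_def)
    finally have "\<bar>inner (u n - w) (y - y')\<bar> \<le> e / 2" .
    moreover have "inner (u n) y - inner w y = inner (u n - w) (y - y') + (inner (u n) y' - inner w y')"
      by (simp add: inner_simps)
    moreover have "\<bar>inner (u n - w) (y - y') + (inner (u n) y' - inner w y')\<bar>
        \<le> \<bar>inner (u n - w) (y - y')\<bar> + \<bar>inner (u n) y' - inner w y'\<bar>" by (rule abs_triangle_ineq)
    moreover have "\<bar>inner (u n) y' - inner w y'\<bar> < e / 2" using N[OF that] by simp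
    ultimately show ?thesis unfolding real_norm_def by argo
  qed
  then show "\<exists>no. \<forall>n\<ge>no. norm (inner (u n) y - inner w y) < e" by blast
qed

lemma subspace_closure:
  fixes S :: "'h::real_normed_vector set"
  assumes "subspace S" shows "subspace (closure S)"
  unfolding subspace_def
proof (intro conjI ballI allI)
  show "0 \<in> closure S" using subspace_0[OF assms] closure_subset by blast
next
  fix x y assume "x \<in> closure S" "y \<in> closure S"
  then obtain a b where "\<And>n. a n \<in> S" "a \<longlonglongrightarrow> x" "\<And>n. b n \<in> S" "b \<longlonglongrightarrow> y"
    unfolding closure_sequential by blast
  then show "x + y \<in> closure S"
    unfolding closure_sequential using subspace_add[OF assms]
    by (intro exI[of _ "\<lambda>n. a n + b n"]) (auto intro: tendsto_add)
next
  fix c and x assume "x \<in> closure S"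
  then obtain a where "\<And>n. a n \<in> S" "a \<longlonglongrightarrow> x" unfolding closure_sequential by blast
  then show "c *\<^sub>R x \<in> closure S"
    unfolding closure_sequential using subspace_scale[OF assms]
    by (intro exI[of _ "\<lambda>n. c *\<^sub>R a n"]) (auto intro: tendsto_scaleR)
qed

section \<open>The affine action\<close>

locale ps_rep = ps_space x0 G \<delta> \<mu>
  for x0 :: "'a::metric_space" and G \<delta> \<mu> +
  fixes J :: "'h::{real_inner,complete_space} \<Rightarrow> 'h"
    and j :: "((real \<Rightarrow> 'a) \<Rightarrow> complex) \<Rightarrow> 'h" and U :: "('a \<Rightarrow> 'a) \<Rightarrow> 'h \<Rightarrow> 'h"
  assumes H: "hilbert_completion J j (F10 x0 \<mu>) (Q1' x0 \<mu>) (\<lambda>\<phi> \<psi> \<xi>. \<phi> \<xi> + \<psi> \<xi>) (\<lambda>a \<phi> \<xi>. a * \<phi> \<xi>)"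
    and U: "\<forall>g\<in>G. bounded_linear (U g) \<and> (\<forall>v. U g (J v) = J (U g v)) \<and>
              (\<forall>\<phi>\<in>F10 x0 \<mu>. U g (j \<phi>) = j (pi1 x0 \<delta> g \<phi>))"
begin

lemma J: "linear J" "J (J x) = - x" "inner (J x) (J y) = inner x y"
  using H by (auto simp: hilbert_completion_def complex_structure_def)

lemma J_skew: "inner (J x) y = - inner x (J y)"
  using J(3)[of x "J y"] by (simp add: J(2))

section \<open>Real and imaginary parts in the Hilbert space\<close>

definition j_real :: "((real \<Rightarrow> 'a) \<Rightarrow> real) \<Rightarrow> 'h" where
  "j_real \<phi> = j (\<lambda>\<xi>. complex_of_real (\<phi> \<xi>))"

lemma of_real_F10: "\<phi> \<in> zero_mean \<Longrightarrow> (\<lambda>\<xi>. complex_of_real (\<phi> \<xi>)) \<in> F10 x0 \<mu>"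
  by (auto simp: F10_def zero_mean_def M_def[symmetric] intro!: continuous_on_of_real)

lemma j_add: "\<phi> \<in> F10 x0 \<mu> \<Longrightarrow> \<psi> \<in> F10 x0 \<mu> \<Longrightarrow> j (\<lambda>\<xi>. \<phi> \<xi> + \<psi> \<xi>) = j \<phi> + j \<psi>"
  using H by (simp add: hilbert_completion_def)

lemma j_scale: "\<phi> \<in> F10 x0 \<mu> \<Longrightarrow> j (\<lambda>\<xi>. a * \<phi> \<xi>) = Re a *\<^sub>R j \<phi> + Im a *\<^sub>R J (j \<phi>)"
  using H by (simp add: hilbert_completion_def)

lemma j_inner: "\<phi> \<in> F10 x0 \<mu> \<Longrightarrow> \<psi> \<in> F10 x0 \<mu> \<Longrightarrow> inner (j \<phi>) (j \<psi>) = Re (Q1' x0 \<mu> \<phi> \<psi>)"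
  using H by (simp add: hilbert_completion_def)

lemma ii_F10: "\<phi> \<in> F10 x0 \<mu> \<Longrightarrow> (\<lambda>\<xi>. \<i> * \<phi> \<xi>) \<in> F10 x0 \<mu>"
  by (auto simp: F10_def intro!: continuous_on_mult_left)

lemma J_j_real: "\<phi> \<in> zero_mean \<Longrightarrow> J (j_real \<phi>) = j (\<lambda>\<xi>. \<i> * complex_of_real (\<phi> \<xi>))"
  using j_scale[OF of_real_F10, of \<phi> \<i>] by (simp add: j_real_def)

lemma inner_j_real: "a \<in> zero_mean \<Longrightarrow> b \<in> zero_mean \<Longrightarrow> inner (j_real a) (j_real b) = Q_real a b"
proof -
  assume ab: "a \<in> zero_mean" "b \<in> zero_mean"
  have "Q1' x0 \<mu> (\<lambda>\<xi>. complex_of_real (a \<xi>)) (\<lambda>\<xi>. complex_of_real (b \<xi>))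
      = (LINT \<xi>|M. LINT \<eta>|M. complex_of_real (a \<xi> * (b \<eta> * gromov_bb \<xi> \<eta>)))"
    unfolding Q1'_def M_def by (simp add: mult.assoc)
  also have "\<dots> = complex_of_real (Q_real a b)"
    unfolding Q_real_def potential_def integral_complex_of_real integral_mult_right_zero ..
  finally show ?thesis unfolding j_real_def using j_inner[OF of_real_F10 of_real_F10] ab by simp
qed

text \<open>The kernel is real, so the form takes a purely imaginary value on a real and an
  imaginary function, and the inner product is its real part.\<close>

lemma inner_j_real_J: "a \<in> zero_mean \<Longrightarrow> b \<in> zero_mean \<Longrightarrow> inner (j_real a) (J (j_real b)) = 0"
proof -
  assume ab: "a \<in> zero_mean" "b \<in> zero_mean"
  have "Q1' x0 \<mu> (\<lambda>\<xi>. complex_of_real (a \<xi>)) (\<lambda>\<xi>. \<i> * complex_of_real (b \<xi>))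
      = (LINT \<xi>|M. LINT \<eta>|M. (- \<i>) * complex_of_real (a \<xi> * (b \<eta> * gromov_bb \<xi> \<eta>)))"
    unfolding Q1'_def M_def by (simp add: mult.assoc mult.left_commute)
  also have "\<dots> = (- \<i>) * complex_of_real (Q_real a b)"
    unfolding Q_real_def potential_def integral_complex_of_real integral_mult_right_zero ..
  finally show ?thesis
    unfolding J_j_real[OF ab(2)] unfolding j_real_def using j_inner[OF of_real_F10 ii_F10[OF of_real_F10]] ab by simp
qed

text \<open>A dense set on which computations reduce to \<open>Q_real\<close>: by
  \<open>inner_j_span\<close> real and imaginary parts are orthogonal, and by
  \<open>F10_j_span\<close> every class has this shape.\<close>

definition j_span :: "'h set" where "j_span = {j_real a + J (j_real b) | a b. a \<in> zero_mean \<and> b \<in> zero_mean}"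

lemma inner_j_span:
  assumes "a \<in> zero_mean" "b \<in> zero_mean" "a' \<in> zero_mean" "b' \<in> zero_mean"
  shows "inner (j_real a + J (j_real b)) (j_real a' + J (j_real b')) = Q_real a a' + Q_real b b'"
proof -
  have "inner (J (j_real b)) (j_real a') = 0" using inner_j_real_J[of a' b] assms by (simp add: inner_commute)
  then show ?thesis using assms by (simp add: inner_add_left inner_add_right J(3) inner_j_real inner_j_real_J)
qed

lemma F10_j_span:
  assumes \<Phi>: "\<Phi> \<in> F10 x0 \<mu>" shows "j \<Phi> \<in> j_span"
proof -
  have c: "continuous_on bd \<Phi>" and i0: "integral\<^sup>L M \<Phi> = 0" using \<Phi> by (auto simp: F10_def M_def)
  have cRe: "continuous_on bd (\<lambda>\<xi>. Re (\<Phi> \<xi>))" and cIm: "continuous_on bd (\<lambda>\<xi>. Im (\<Phi> \<xi>))"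
    by (intro continuous_on_Re continuous_on_Im c)+
  have "integrable M (\<lambda>\<xi>. complex_of_real (Re (\<Phi> \<xi>)) + \<i> * complex_of_real (Im (\<Phi> \<xi>)))"
    using continuous_integrable[OF cRe] continuous_integrable[OF cIm]
    by (intro Bochner_Integration.integrable_add integrable_mult_right integrable_of_real)
  then have i: "integrable M \<Phi>" by (simp add: complex_eq[symmetric])
  have a: "(\<lambda>\<xi>. Re (\<Phi> \<xi>)) \<in> zero_mean" "(\<lambda>\<xi>. Im (\<Phi> \<xi>)) \<in> zero_mean"
    using cRe cIm integral_Re[OF i] integral_Im[OF i] i0 by (simp_all add: zero_mean_def)
  have "j \<Phi> = j (\<lambda>\<xi>. complex_of_real (Re (\<Phi> \<xi>)) + \<i> * complex_of_real (Im (\<Phi> \<xi>)))"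
    by (simp add: complex_eq[symmetric])
  also have "\<dots> = j_real (\<lambda>\<xi>. Re (\<Phi> \<xi>)) + J (j_real (\<lambda>\<xi>. Im (\<Phi> \<xi>)))"
    unfolding J_j_real[OF a(2)] unfolding j_real_def by (rule j_add[OF of_real_F10[OF a(1)] ii_F10[OF of_real_F10[OF a(2)]]])
  finally show ?thesis using a unfolding j_span_def by blast
qed

lemma j_span_dense: "closure j_span = UNIV"
proof -
  have "closure (j ` F10 x0 \<mu>) \<subseteq> closure j_span" using F10_j_span by (intro closure_mono) auto
  then show ?thesis using H by (auto simp: hilbert_completion_def)
qed

lemma U_linear: "g \<in> G \<Longrightarrow> bounded_linear (U g)"
  using U by blast

lemma U_J: "g \<in> G \<Longrightarrow> U g (J v) = J (U g v)"
  using U by blast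

lemma U_j_real:
  assumes "g \<in> G" "a \<in> zero_mean" shows "U g (j_real a) = j_real (pi_real g a)"
proof -
  have "U g (j_real a) = j (pi1 x0 \<delta> g (\<lambda>\<xi>. complex_of_real (a \<xi>)))"
    using U of_real_F10[OF assms(2)] assms(1) unfolding j_real_def by blast
  also have "pi1 x0 \<delta> g (\<lambda>\<xi>. complex_of_real (a \<xi>)) = (\<lambda>\<xi>. complex_of_real (pi_real g a \<xi>))"
    by (simp add: pi1_def pi_real_def bz_def)
  finally show ?thesis by (simp add: j_real_def)
qed

lemma U_j_span:
  assumes "g \<in> G" "a \<in> zero_mean" "b \<in> zero_mean"
  shows "U g (j_real a + J (j_real b)) = j_real (pi_real g a) + J (j_real (pi_real g b))"
  using assms by (simp add: linear_add[OF bounded_linear.linear[OF U_linear]] U_J U_j_real)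

text \<open>On \<open>j_span\<close> the norm is preserved by \<open>Q_real_unitary\<close>; the
  inequality is a closed condition and passes to the closure.\<close>

lemma U_norm:
  assumes g: "g \<in> G" shows "norm (U g v) \<le> norm v"
proof -
  have "closed {v. norm (U g v) \<le> norm v}"
    by (intro closed_Collect_le continuous_on_norm linear_continuous_on U_linear g continuous_on_id)
  moreover have "j_span \<subseteq> {v. norm (U g v) \<le> norm v}"
  proof
    fix v assume "v \<in> j_span"
    then obtain a b where ab: "a \<in> zero_mean" "b \<in> zero_mean" "v = j_real a + J (j_real b)" by (auto simp: j_span_def)
    have "inner (U g v) (U g v) = inner v v"
      unfolding ab(3) U_j_span[OF g ab(1,2)] using ab g by (simp add: inner_j_span pi_real_zero_mean Q_real_unitary)
    then show "v \<in> {v. norm (U g v) \<le> norm v}" by (simp add: norm_eq_sqrt_inner)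
  qed
  ultimately have "closure j_span \<subseteq> {v. norm (U g v) \<le> norm v}" by (rule closure_minimal[rotated])
  then show ?thesis using j_span_dense by auto
qed

section \<open>Limits along tracking elements\<close>

definition tends_along :: "(('a \<Rightarrow> 'a) \<Rightarrow> real) \<Rightarrow> real \<Rightarrow> bool" where
  "tends_along f l \<longleftrightarrow> (\<forall>e>0. \<exists>n0. \<forall>n\<ge>n0. \<forall>\<zeta> g. tracks n \<zeta> g \<longrightarrow> \<bar>f g - l\<bar> \<le> e)"

text \<open>On \<open>j_span\<close> this is \<open>mixing\<close> for the real and the imaginary
  parts. Since the \<open>U g\<close> are contractions, replacing both vectors by elements of
  \<open>j_span\<close> costs an error uniform in \<open>g\<close>.\<close>

lemma mixing_H: "tends_along (\<lambda>g. inner (U g u) v) 0"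
  unfolding tends_along_def
proof (intro allI impI)
  fix e :: real assume e: "0 < e"
  define c where "c = norm u + norm v + 1"
  have c: "0 < c" unfolding c_def by (intro add_nonneg_pos add_nonneg_nonneg) auto
  \<comment> \<open>The bound \<open>\<eta> \<le> 1\<close> gives
    \<open>norm u' \<le> norm u + 1\<close> for the approximant; the two errors then add up to
    \<open>\<eta> * (norm u + norm v + 1)\<close>.\<close>
  define \<eta> where "\<eta> = min 1 (e / (4 * c))"
  have \<eta>: "0 < \<eta>" "\<eta> \<le> 1" using e c by (auto simp: \<eta>_def)
  have "\<eta> * c \<le> e / (4 * c) * c" using c by (intro mult_right_mono) (auto simp: \<eta>_def)
  then have "\<eta> * c \<le> e / 4" using c by simp
  then have \<eta>e: "\<eta> * (norm u + norm v + 1) \<le> e / 4" by (simp only: c_def)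
  have "u \<in> closure j_span" "v \<in> closure j_span" using j_span_dense by auto
  then obtain u' v' where uv: "u' \<in> j_span" "v' \<in> j_span" "norm (u - u') < \<eta>" "norm (v - v') < \<eta>"
    using \<eta> unfolding closure_approachable dist_norm by (metis norm_minus_commute)
  obtain a b where ab: "a \<in> zero_mean" "b \<in> zero_mean" "u' = j_real a + J (j_real b)" using uv by (auto simp: j_span_def)
  obtain a' b' where ab': "a' \<in> zero_mean" "b' \<in> zero_mean" "v' = j_real a' + J (j_real b')" using uv by (auto simp: j_span_def)
  have e4: "0 < e / 4" using e by simp
  obtain n1 where n1: "\<forall>n\<ge>n1. \<forall>\<zeta> g. tracks n \<zeta> g \<longrightarrow> \<bar>Q_real (pi_real g a) a'\<bar> \<le> e / 4"
    using mixing[OF ab(1) zero_mean_continuous[OF ab'(1)] e4] by blast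
  obtain n2 where n2: "\<forall>n\<ge>n2. \<forall>\<zeta> g. tracks n \<zeta> g \<longrightarrow> \<bar>Q_real (pi_real g b) b'\<bar> \<le> e / 4"
    using mixing[OF ab(2) zero_mean_continuous[OF ab'(2)] e4] by blast
  have "\<bar>inner (U g u) v - 0\<bar> \<le> e" if n: "max n1 n2 \<le> n" and gd: "tracks n \<zeta> g" for n \<zeta> g
  proof -
    have g: "g \<in> G" using gd by (simp add: tracks_def)
    have "inner (U g u') v' = Q_real (pi_real g a) a' + Q_real (pi_real g b) b'"
      unfolding ab ab' U_j_span[OF g ab(1,2)] using ab ab' g by (simp add: inner_j_span pi_real_zero_mean)
    moreover have "\<bar>Q_real (pi_real g a) a'\<bar> \<le> e / 4" "\<bar>Q_real (pi_real g b) b'\<bar> \<le> e / 4" using n1 n2 n gd by auto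
    ultimately have 1: "\<bar>inner (U g u') v'\<bar> \<le> e / 2" by linarith
    have Ud: "U g (u - u') = U g u - U g u'" by (rule linear_diff[OF bounded_linear.linear[OF U_linear[OF g]]])
    have "\<bar>inner (U g (u - u')) v\<bar> \<le> norm (U g (u - u')) * norm v" by (rule Cauchy_Schwarz_ineq2)
    also have "\<dots> \<le> \<eta> * norm v" using U_norm[OF g, of "u - u'"] uv by (intro mult_right_mono) auto
    finally have 2: "\<bar>inner (U g (u - u')) v\<bar> \<le> \<eta> * norm v" .
    have "\<bar>inner (U g u') (v - v')\<bar> \<le> norm (U g u') * norm (v - v')" by (rule Cauchy_Schwarz_ineq2)
    also have "\<dots> \<le> (norm u + 1) * \<eta>"
    proof (intro mult_mono)
      have "norm u' \<le> norm u + norm (u' - u)" using norm_triangle_ineq[of u "u' - u"] by simp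
      then show "norm (U g u') \<le> norm u + 1"
        using U_norm[OF g, of u'] uv \<eta> by (simp add: norm_minus_commute)
    qed (use uv \<eta> in auto)
    finally have 3: "\<bar>inner (U g u') (v - v')\<bar> \<le> (norm u + 1) * \<eta>" .
    have "inner (U g u) v = inner (U g (u - u')) v + inner (U g u') (v - v') + inner (U g u') v'"
      unfolding Ud by (simp add: inner_simps)
    moreover have "\<eta> * norm v + (norm u + 1) * \<eta> = \<eta> * (norm u + norm v + 1)" by (simp add: algebra_simps)
    ultimately show ?thesis using 1 2 3 \<eta>e e by linarith
  qed
  then show "\<exists>n0. \<forall>n\<ge>n0. \<forall>\<zeta> g. tracks n \<zeta> g \<longrightarrow> \<bar>inner (U g u) v - 0\<bar> \<le> e" by blast
qed

abbreviation jc :: "('a \<Rightarrow> 'a) \<Rightarrow> 'h" where "jc g \<equiv> j (cocyc x0 \<delta> g)"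

lemma jc_eq: "jc g = j_real (cocyc_real g)"
  unfolding j_real_def cocyc_real_def[abs_def] cocyc_def cfun_def bz_def ..

text \<open>\<open>u\<close> is the average of \<open>\<psi> \<xi>\<close> times the cocycle vector
  of an element tracking \<open>\<xi>\<close> at time \<open>n\<close>. The same \<open>u\<close>
  must serve every test vector \<open>y\<close> with its own limit function \<open>L\<close>, since
  it is later paired both with an unknown vector and with all of \<open>j_span\<close>; hence the
  inner quantifiers.\<close>

lemma weak_approximation:
  assumes \<psi>: "\<psi> \<in> zero_mean"
  shows "\<exists>B. \<forall>n. \<exists>u. norm u \<le> B \<and>
     (\<forall>y L e. L \<in> borel_measurable Bd \<longrightarrow> integrable M (\<lambda>\<xi>. \<psi> \<xi> * L \<xi>) \<longrightarrow>
       (\<forall>\<zeta> g. tracks n \<zeta> g \<longrightarrow> \<bar>inner (jc g) y - L \<zeta>\<bar> \<le> e) \<longrightarrow>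
       \<bar>inner u y - (\<integral>\<xi>. \<psi> \<xi> * L \<xi> \<partial>M)\<bar> \<le> B * e)"
proof -
  note c\<psi> = zero_mean_continuous[OF \<psi>]
  obtain C where C: "0 \<le> C" "\<forall>\<xi>\<in>bd. \<bar>\<psi> \<xi>\<bar> \<le> C" using continuous_bounded[OF c\<psi>] by blast
  define K where "K = 6 * C1 + 3 * R"
  \<comment> \<open>\<open>C\<close> is the factor of the error. The root bounds the norm:
    \<open>inner u u\<close> is a double integral of two weights of size at most \<open>C\<close>
    and a kernel of size at most \<open>K + gromov_bb s t\<close>, whose mean in \<open>t\<close> is
    at most \<open>K + C1\<close>.\<close>
  define B where "B = max C (sqrt (C * (C * (K + C1))))"
  have "\<exists>u. norm u \<le> B \<and>
     (\<forall>y L e. L \<in> borel_measurable Bd \<longrightarrow> integrable M (\<lambda>\<xi>. \<psi> \<xi> * L \<xi>) \<longrightarrow>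
       (\<forall>\<zeta> g. tracks n \<zeta> g \<longrightarrow> \<bar>inner (jc g) y - L \<zeta>\<bar> \<le> e) \<longrightarrow>
       \<bar>inner u y - (\<integral>\<xi>. \<psi> \<xi> * L \<xi> \<partial>M)\<bar> \<le> B * e)" for n
  proof -
    obtain N hs idx where hs: "\<forall>i<N. hs i \<in> G" and idx: "idx \<in> measurable Bd (count_space (UNIV::nat set))"
      and p: "\<And>\<xi>. \<xi> \<in> \<Lambda> \<Longrightarrow> idx \<xi> < N" "\<And>\<xi>. \<xi> \<in> \<Lambda> \<Longrightarrow> tracks n \<xi> (hs (idx \<xi>))"
      using ex_partition[of n] by blast
    define u where "u = (\<Sum>i<N. (\<integral>\<xi>. \<psi> \<xi> * indicator {i} (idx \<xi>) \<partial>M) *\<^sub>R jc (hs i))"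
    have inner_u: "inner u y = (\<integral>\<xi>. \<psi> \<xi> * inner (jc (hs (idx \<xi>))) y \<partial>M)" for y
      unfolding u_def inner_sum_left inner_scaleR_left
      by (rule partition_sum[OF c\<psi> idx p(1)])
    have meas: "(\<lambda>\<xi>. \<psi> \<xi> * inner (jc (hs (idx \<xi>))) y) \<in> borel_measurable Bd" for y
      by (intro borel_measurable_times continuous_borel c\<psi> idx_compose_measurable[OF idx])
    have approx: "\<bar>inner u y - (\<integral>\<xi>. \<psi> \<xi> * L \<xi> \<partial>M)\<bar> \<le> B * e"
      if L: "L \<in> borel_measurable Bd" "integrable M (\<lambda>\<xi>. \<psi> \<xi> * L \<xi>)"
        and le: "\<And>\<zeta> g. tracks n \<zeta> g \<Longrightarrow> \<bar>inner (jc g) y - L \<zeta>\<bar> \<le> e" for y L e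
    proof -
      have ae: "AE \<xi> in M. \<bar>\<psi> \<xi> * inner (jc (hs (idx \<xi>))) y - \<psi> \<xi> * L \<xi>\<bar> \<le> C * e"
        using AE_\<Lambda>
      proof eventually_elim
        case (elim \<xi>)
        have "\<bar>\<psi> \<xi>\<bar> * \<bar>inner (jc (hs (idx \<xi>))) y - L \<xi>\<bar> \<le> C * e"
          using C \<Lambda>_bd[OF elim] le[OF p(2)[OF elim]] by (intro mult_mono) auto
        then show ?case by (simp only: abs_mult[symmetric] right_diff_distrib)
      qed
      have i: "integrable M (\<lambda>\<xi>. \<psi> \<xi> * inner (jc (hs (idx \<xi>))) y)"
      proof (rule abs_integral_le(1)[OF meas])
        show "integrable M (\<lambda>\<xi>. \<bar>\<psi> \<xi> * L \<xi>\<bar> + C * e)" using L by simp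
        show "AE \<xi> in M. \<bar>\<psi> \<xi> * inner (jc (hs (idx \<xi>))) y\<bar> \<le> \<bar>\<psi> \<xi> * L \<xi>\<bar> + C * e"
          using ae by eventually_elim linarith
      qed
      have "inner u y - (\<integral>\<xi>. \<psi> \<xi> * L \<xi> \<partial>M) = (\<integral>\<xi>. \<psi> \<xi> * inner (jc (hs (idx \<xi>))) y - \<psi> \<xi> * L \<xi> \<partial>M)"
        unfolding inner_u by (rule Bochner_Integration.integral_diff[OF i L(2), symmetric])
      also have "\<bar>\<dots>\<bar> \<le> C * e"
        by (rule abs_integral_le_const(2)[OF _ ae])
           (intro borel_measurable_diff meas borel_measurable_times continuous_borel c\<psi> L)
      also have "\<dots> \<le> B * e"
      proof (rule mult_right_mono)
        obtain \<zeta> where \<zeta>: "\<zeta> \<in> \<Lambda>" using \<Lambda>_nonempty by blast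
        show "0 \<le> e" by (rule order_trans[OF abs_ge_zero le[OF p(2)[OF \<zeta>]]])
      qed (simp add: B_def)
      finally show ?thesis .
    qed
    have inner_le: "\<bar>inner (jc (hs (idx s))) u\<bar> \<le> C * (K + C1)" if s: "s \<in> \<Lambda>" for s
    proof -
      have gi: "integrable M (\<lambda>t. C * (K + gromov_bb s t))" using gromov_integrable(1)[OF s] by simp
      have "\<bar>inner u (jc (hs (idx s)))\<bar> \<le> (\<integral>t. C * (K + gromov_bb s t) \<partial>M)"
        unfolding inner_u
      proof (rule abs_integral_le(2)[OF meas gi])
        \<comment> \<open>The diagonal \<open>t = s\<close>, where \<open>cocycle_bound\<close> does
          not apply, is a null set by \<open>AE_neq\<close>.\<close>
        show "AE t in M. \<bar>\<psi> t * inner (jc (hs (idx t))) (jc (hs (idx s)))\<bar> \<le> C * (K + gromov_bb s t)"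
          using AE_\<Lambda> AE_neq[OF s]
        proof eventually_elim
          case (elim t)
          have G: "hs (idx t) \<in> G" "hs (idx s) \<in> G" using p(2)[OF s] p(2)[OF elim(1)] by (auto simp: tracks_def)
          have "\<bar>inner (jc (hs (idx t))) (jc (hs (idx s)))\<bar> \<le> K + gromov_bb s t"
            using cocycle_bound[OF p(2)[OF elim(1)] p(2)[OF s] elim(2)] G
            by (simp add: jc_eq inner_j_real cocyc_real_zero_mean K_def gromov_bb_commute)
          then show ?case unfolding abs_mult using C \<Lambda>_bd[OF elim(1)] by (intro mult_mono) auto
        qed
      qed
      also have "\<dots> = C * (K + (\<integral>t. gromov_bb s t \<partial>M))"
        using gromov_integrable(1)[OF s] by (simp add: M.prob_space)
      also have "\<dots> \<le> C * (K + C1)" using gromov_integrable(2)[OF s] C(1) by (intro mult_left_mono) auto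
      finally show ?thesis by (simp add: inner_commute)
    qed
    have "inner u u \<le> C * (C * (K + C1))"
    proof -
      have "\<bar>inner u u\<bar> \<le> C * (C * (K + C1))"
        unfolding inner_u[of u]
      proof (rule abs_integral_le_const(2)[OF meas])
        show "AE \<xi> in M. \<bar>\<psi> \<xi> * inner (jc (hs (idx \<xi>))) u\<bar> \<le> C * (C * (K + C1))"
          using AE_\<Lambda>
        proof eventually_elim
          case (elim \<xi>)
          then show ?case unfolding abs_mult using C \<Lambda>_bd[OF elim] inner_le[OF elim] by (intro mult_mono) auto
        qed
      qed
      then show ?thesis by simp
    qed
    then have "norm u \<le> B" unfolding norm_eq_sqrt_inner B_def by (simp add: max.coboundedI2)
    show ?thesis
    proof (intro exI[of _ u] conjI allI impI)
      fix y L e assume L: "L \<in> borel_measurable Bd" "integrable M (\<lambda>\<xi>. \<psi> \<xi> * L \<xi>)"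
        and le: "\<forall>\<zeta> g. tracks n \<zeta> g \<longrightarrow> \<bar>inner (jc g) y - L \<zeta>\<bar> \<le> e"
      show "\<bar>inner u y - (\<integral>\<xi>. \<psi> \<xi> * L \<xi> \<partial>M)\<bar> \<le> B * e" by (rule approx[OF L]) (rule le[rule_format])
    qed (rule \<open>norm u \<le> B\<close>)
  qed
  then show ?thesis by (intro exI[of _ B] allI)
qed

text \<open>A limit \<open>l\<close> common to all \<open>\<zeta>\<close> turns into
  \<open>l\<close> times the mean of \<open>\<psi>\<close>, so the averages pair with
  \<open>y\<close> to 0 in the limit. Their weak limit is \<open>- j_real \<psi>\<close>.\<close>

lemma tends_along_orthogonal:
  assumes y: "tends_along (\<lambda>g. inner (jc g) y) l" and \<psi>: "\<psi> \<in> zero_mean"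
  shows "inner (j_real \<psi>) y = 0"
proof -
  note c\<psi> = zero_mean_continuous[OF \<psi>]
  obtain B where "\<forall>n. \<exists>u. norm u \<le> B \<and>
     (\<forall>y L e. L \<in> borel_measurable Bd \<longrightarrow> integrable M (\<lambda>\<xi>. \<psi> \<xi> * L \<xi>) \<longrightarrow>
       (\<forall>\<zeta> g. tracks n \<zeta> g \<longrightarrow> \<bar>inner (jc g) y - L \<zeta>\<bar> \<le> e) \<longrightarrow>
       \<bar>inner u y - (\<integral>\<xi>. \<psi> \<xi> * L \<xi> \<partial>M)\<bar> \<le> B * e)"
    using weak_approximation[OF \<psi>] by (elim exE)
  from choice[OF this] obtain u where uB: "\<forall>n. norm (u n) \<le> B \<and>
     (\<forall>y L e. L \<in> borel_measurable Bd \<longrightarrow> integrable M (\<lambda>\<xi>. \<psi> \<xi> * L \<xi>) \<longrightarrow>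
       (\<forall>\<zeta> g. tracks n \<zeta> g \<longrightarrow> \<bar>inner (jc g) y - L \<zeta>\<bar> \<le> e) \<longrightarrow>
       \<bar>inner (u n) y - (\<integral>\<xi>. \<psi> \<xi> * L \<xi> \<partial>M)\<bar> \<le> B * e)"
    by (elim exE)
  note B = conjunct1[OF spec[OF uB]] and u = conjunct2[OF spec[OF uB], rule_format]
  have B0: "0 \<le> B" using B[of 0] norm_ge_zero[of "u 0"] by linarith
  have lim: "(\<lambda>n. inner (u n) z) \<longlonglongrightarrow> (\<integral>\<xi>. \<psi> \<xi> * L \<xi> \<partial>M)"
    if L: "L \<in> borel_measurable Bd" "integrable M (\<lambda>\<xi>. \<psi> \<xi> * L \<xi>)"
      and ev: "\<And>e. 0 < e \<Longrightarrow> \<exists>n0. \<forall>n\<ge>n0. \<forall>\<zeta> g. tracks n \<zeta> g \<longrightarrow> \<bar>inner (jc g) z - L \<zeta>\<bar> \<le> e" for z L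
  proof (rule LIMSEQ_I)
    fix e :: real assume e: "0 < e"
    define e' where "e' = e / (B + 1)"
    have e': "0 < e'" "B * e' < e" using e B0 by (auto simp: e'_def field_simps)
    obtain n0 where n0: "\<forall>n\<ge>n0. \<forall>\<zeta> g. tracks n \<zeta> g \<longrightarrow> \<bar>inner (jc g) z - L \<zeta>\<bar> \<le> e'"
      using ev[OF e'(1)] by blast
    have "norm (inner (u n) z - (\<integral>\<xi>. \<psi> \<xi> * L \<xi> \<partial>M)) < e" if n: "n0 \<le> n" for n
    proof -
      have "\<bar>inner (u n) z - (\<integral>\<xi>. \<psi> \<xi> * L \<xi> \<partial>M)\<bar> \<le> B * e'"
        by (rule u[OF L]) (use n0 n in blast)
      then show ?thesis unfolding real_norm_def using e'(2) by (rule le_less_trans)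
    qed
    then show "\<exists>no. \<forall>n\<ge>no. norm (inner (u n) z - (\<integral>\<xi>. \<psi> \<xi> * L \<xi> \<partial>M)) < e" by blast
  qed
  have 0: "(\<lambda>n. inner (u n) y) \<longlonglongrightarrow> 0"
  proof -
    have "(\<lambda>n. inner (u n) y) \<longlonglongrightarrow> (\<integral>\<xi>. \<psi> \<xi> * l \<partial>M)"
    proof (rule lim)
      show "integrable M (\<lambda>\<xi>. \<psi> \<xi> * l)" using continuous_integrable[OF c\<psi>] by simp
      show "\<exists>n0. \<forall>n\<ge>n0. \<forall>\<zeta> g. tracks n \<zeta> g \<longrightarrow> \<bar>inner (jc g) y - l\<bar> \<le> e" if "0 < e" for e
        using y that unfolding tends_along_def by blast
    qed simp
    then show ?thesis using zero_mean_integral[OF \<psi>] by simp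
  qed
  have "(\<lambda>n. inner (u n) z) \<longlonglongrightarrow> inner (- j_real \<psi>) z" if z: "z \<in> j_span" for z
  proof -
    obtain a b where ab: "a \<in> zero_mean" "b \<in> zero_mean" "z = j_real a + J (j_real b)" using z by (auto simp: j_span_def)
    note ca = zero_mean_continuous[OF ab(1)]
    \<comment> \<open>By \<open>cocycle_limit\<close> the limit function is
      \<open>k - potential a \<zeta>\<close>. The constant disappears against \<open>\<psi>\<close>
      and leaves \<open>- Q_real \<psi> a\<close>.\<close>
    define k where "k = (\<integral>\<xi>. potential a \<xi> \<partial>M)"
    have i: "integrable M (\<lambda>\<xi>. \<psi> \<xi> * potential a \<xi>)" by (rule integrable_potential(1)[OF c\<psi> ca])
    have i': "integrable M (\<lambda>\<xi>. \<psi> \<xi> * (k - potential a \<xi>))"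
      using i continuous_integrable[OF c\<psi>] by (simp add: right_diff_distrib)
    have eq: "(\<integral>\<xi>. \<psi> \<xi> * (k - potential a \<xi>) \<partial>M) = - Q_real \<psi> a"
      using i continuous_integrable[OF c\<psi>] zero_mean_integral[OF \<psi>] by (simp add: right_diff_distrib Q_real_def)
    have "(\<lambda>n. inner (u n) (j_real a)) \<longlonglongrightarrow> - Q_real \<psi> a"
      unfolding eq[symmetric]
    proof (rule lim[OF _ i'])
      show "(\<lambda>\<xi>. k - potential a \<xi>) \<in> borel_measurable Bd"
        by (intro borel_measurable_diff borel_measurable_const potential_measurable ca)
      fix e :: real assume "0 < e"
      then obtain n0 where n0: "\<forall>n\<ge>n0. \<forall>\<zeta> g. tracks n \<zeta> g \<longrightarrow> \<bar>Q_real (cocyc_real g) a - (k - potential a \<zeta>)\<bar> \<le> e"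
        using cocycle_limit[OF ca] unfolding k_def by blast
      have "\<bar>inner (jc g) (j_real a) - (k - potential a \<zeta>)\<bar> \<le> e" if n: "n0 \<le> n" and gd: "tracks n \<zeta> g" for n \<zeta> g
      proof -
        have "inner (jc g) (j_real a) = Q_real (cocyc_real g) a"
          using gd ab(1) by (simp add: jc_eq inner_j_real cocyc_real_zero_mean tracks_def)
        then show ?thesis using n0 n gd by simp
      qed
      then show "\<exists>n0. \<forall>n\<ge>n0. \<forall>\<zeta> g. tracks n \<zeta> g \<longrightarrow> \<bar>inner (jc g) (j_real a) - (k - potential a \<zeta>)\<bar> \<le> e" by blast
    qed
    \<comment> \<open>Cocycle vectors are classes of real functions and so orthogonal to
      \<open>J (j_real b)\<close>; the limit function is 0.\<close>
    moreover have "(\<lambda>n. inner (u n) (J (j_real b))) \<longlonglongrightarrow> (\<integral>\<xi>. \<psi> \<xi> * 0 \<partial>M)"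
    proof (rule lim)
      fix e :: real assume e: "0 < e"
      have "\<bar>inner (jc g) (J (j_real b)) - 0\<bar> \<le> e" if "tracks n \<zeta> g" for n \<zeta> g
      proof -
        have "g \<in> G" using that by (simp add: tracks_def)
        then show ?thesis using e inner_j_real_J[OF cocyc_real_zero_mean ab(2)] by (simp add: jc_eq)
      qed
      then show "\<exists>n0. \<forall>n\<ge>n0. \<forall>\<zeta> g. tracks n \<zeta> g \<longrightarrow> \<bar>inner (jc g) (J (j_real b)) - 0\<bar> \<le> e" by blast
    qed simp_all
    ultimately have "(\<lambda>n. inner (u n) (j_real a) + inner (u n) (J (j_real b))) \<longlonglongrightarrow> - Q_real \<psi> a + 0"
      by (intro tendsto_add) simp_all
    moreover have "inner (- j_real \<psi>) z = - Q_real \<psi> a"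
      using ab \<psi> by (simp add: inner_simps inner_j_real inner_j_real_J)
    ultimately show ?thesis by (simp add: ab(3) inner_add_right)
  qed
  from weak_convergence_dense[OF B j_span_dense this, of y]
  have "inner (- j_real \<psi>) y = 0" by (rule LIMSEQ_unique[OF _ 0])
  then show ?thesis by simp
qed

text \<open>\<open>tends_along_orthogonal\<close> reaches only classes of real functions. As
  \<open>J\<close> is skew, the condition on \<open>J y\<close> is the same statement for the
  imaginary ones.\<close>

lemma tends_along_zero:
  assumes "tends_along (\<lambda>g. inner (jc g) y) l" "tends_along (\<lambda>g. inner (jc g) (J y)) l'"
  shows "y = 0"
proof -
  have "closed {z. inner z y = 0}"
    by (intro closed_Collect_eq continuous_on_inner continuous_on_id continuous_on_const)
  moreover have "j_span \<subseteq> {z. inner z y = 0}"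
    using tends_along_orthogonal[OF assms(1)] tends_along_orthogonal[OF assms(2)]
    by (auto simp: j_span_def inner_add_left J_skew)
  ultimately have "closure j_span \<subseteq> {z. inner z y = 0}" by (rule closure_minimal[rotated])
  then have "y \<in> {z. inner z y = 0}" using j_span_dense by blast
  then show ?thesis by simp
qed

text \<open>By \<open>mixing_H\<close> the term with \<open>U g w\<close> tends to 0, so every
  coefficient of a coboundary has a limit that does not depend on \<open>\<zeta>\<close>.\<close>

lemma tends_along_coboundary:
  assumes "\<And>g. g \<in> G \<Longrightarrow> f g = inner (U g w - w) z"
  shows "tends_along f (- inner w z)"
proof -
  have "\<bar>f g - - inner w z\<bar> = \<bar>inner (U g w) z - 0\<bar>" if "tracks n \<zeta> g" for n \<zeta> g
    using assms[of g] that by (simp add: tracks_def inner_diff_left)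
  then show ?thesis using mixing_H[of w z] unfolding tends_along_def by metis
qed

section \<open>Spanning, irreducibility and the affine commutant\<close>

lemma cspan_subspace: "subspace (cspan J S)"
  by (simp add: cspan_def)

text \<open>For a vector \<open>y\<close> orthogonal to the span, \<open>inner (jc g) y\<close>
  equals \<open>inner (U g w - w) y\<close> and so converges along tracking elements. The vectors
  under \<open>J\<close> in the complex span give the same for \<open>J y\<close>.\<close>

lemma closure_cspan_eq_UNIV: "closure (cspan J {jc g + w - U g w | g. g \<in> G}) = UNIV"
proof (rule ccontr)
  let ?B = "{jc g + w - U g w | g. g \<in> G}"
  assume "closure (cspan J ?B) \<noteq> UNIV"
  then obtain x where "x \<notin> closure (cspan J ?B)" by blast
  then obtain y where y: "y \<noteq> 0" "\<And>s. s \<in> closure (cspan J ?B) \<Longrightarrow> inner y s = 0"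
    using ex_orthogonal[OF subspace_closure[OF cspan_subspace] closed_closure] by blast
  have "y = 0"
  proof (rule tends_along_zero)
    have 1: "inner y (jc g + w - U g w) = 0" "inner y (J (jc g + w - U g w)) = 0" if "g \<in> G" for g
    proof -
      have "jc g + w - U g w \<in> cspan J ?B" "J (jc g + w - U g w) \<in> cspan J ?B"
        unfolding cspan_def by (intro span_base; use that in blast)+
      then show "inner y (jc g + w - U g w) = 0" "inner y (J (jc g + w - U g w)) = 0"
        using y(2) closure_subset by blast+
    qed
    show "tends_along (\<lambda>g. inner (jc g) y) (- inner w y)"
    proof (rule tends_along_coboundary)
      fix g assume "g \<in> G"
      then show "inner (jc g) y = inner (U g w - w) y"
        using 1(1)[of g] by (simp add: inner_diff_left inner_diff_right inner_add_right inner_commute algebra_simps)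
    qed
    show "tends_along (\<lambda>g. inner (jc g) (J y)) (- inner w (J y))"
    proof (rule tends_along_coboundary)
      fix g assume "g \<in> G"
      then have "inner (jc g + w - U g w) (J y) = 0"
        using 1(2)[of g] J_skew[of "jc g + w - U g w" y] by (simp add: inner_commute)
      then show "inner (jc g) (J y) = inner (U g w - w) (J y)"
        by (simp add: inner_diff_left inner_add_left)
    qed
  qed
  then show False using y by simp
qed

text \<open>The coefficient \<open>inner (U g v) v\<close> tends to 0 along tracking elements, yet
  it is \<open>inner v v\<close> for every \<open>g\<close>.\<close>

lemma invariant_zero:
  assumes v: "\<And>g. g \<in> G \<Longrightarrow> U g v = v" shows "v = 0"
proof (rule ccontr)
  assume "v \<noteq> 0"
  then have p: "0 < inner v v" by simp
  then obtain n0 where n0: "\<forall>n\<ge>n0. \<forall>\<zeta> g. tracks n \<zeta> g \<longrightarrow> \<bar>inner (U g v) v - 0\<bar> \<le> inner v v / 2"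
    using mixing_H[of v v] unfolding tends_along_def by (meson half_gt_zero)
  obtain \<zeta> where \<zeta>: "\<zeta> \<in> \<Lambda>" using \<Lambda>_nonempty by blast
  then obtain g where g: "g \<in> G" "dist (\<zeta> (real n0)) (g x0) \<le> R" using R(2)[OF \<zeta>, of "real n0"] by auto
  have "tracks n0 \<zeta> g" using \<zeta> g by (simp add: tracks_def)
  then have "\<bar>inner (U g v) v - 0\<bar> \<le> inner v v / 2" using n0 by blast
  then show False using v[OF g(1)] p by simp
qed

text \<open>The directions of \<open>A\<close> at a point \<open>a\<close> form a closed complex
  subspace. Invariance puts \<open>U g a + jc g - a\<close> into it, which is the spanning vector
  for \<open>w = - a\<close>.\<close>

lemma affine_irreducible:
  assumes A: "A \<noteq> {}" "closed A" "caffine J A" and inv: "\<And>g. g \<in> G \<Longrightarrow> (\<lambda>v. U g v + jc g) ` A \<subseteq> A"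
  shows "A = UNIV"
proof -
  obtain a where a: "a \<in> A" using A(1) by blast
  have aff: "affine A" and Jc: "\<And>x y. x \<in> A \<Longrightarrow> y \<in> A \<Longrightarrow> x + J (y - x) \<in> A" using A(3) by (auto simp: caffine_def)
  define S where "S = {v. a + v \<in> A}"
  have "S = (\<lambda>x. x - a) ` A"
  proof (intro set_eqI iffI)
    fix v assume "v \<in> S"
    then show "v \<in> (\<lambda>x. x - a) ` A" by (intro image_eqI[of _ _ "a + v"]) (auto simp: S_def)
  qed (auto simp: S_def)
  then have sub: "subspace S" using affine_diffs_subspace_subtract[OF aff a] by simp
  have cl: "closed S" unfolding S_def
    using continuous_closed_vimage[OF A(2), of "\<lambda>v. a + v"] by (simp add: vimage_def continuous_intros)
  have b: "jc g + (- a) - U g (- a) \<in> S" if g: "g \<in> G" for g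
  proof -
    have "U g a + jc g \<in> A" using inv[OF g] a by blast
    moreover have "U g (- a) = - U g a" by (rule linear_neg[OF bounded_linear.linear[OF U_linear[OF g]]])
    ultimately show ?thesis by (simp add: S_def algebra_simps)
  qed
  have JS: "J v \<in> S" if "v \<in> S" for v using Jc[OF a, of "a + v"] that by (simp add: S_def)
  have "cspan J {jc g + (- a) - U g (- a) | g. g \<in> G} \<subseteq> S"
    unfolding cspan_def using b JS by (intro span_minimal sub) auto
  then have "closure (cspan J {jc g + (- a) - U g (- a) | g. g \<in> G}) \<subseteq> S" using cl by (rule closure_minimal)
  then have "S = UNIV" using closure_cspan_eq_UNIV[of "- a"] by blast
  then have "a + (x - a) \<in> A" for x unfolding S_def by blast
  then show ?thesis by auto
qed

text \<open>Commutation at the vector 0 says that the linear part minus the identity maps the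
  cocycle to the coboundary of \<open>b\<close>; coefficients of a coboundary converge, and
  \<open>tends_along_zero\<close> applies to the Riesz vector.\<close>

lemma affine_commutant_trivial:
  assumes T: "cont_caffine_map J T"
    and comm: "\<And>g v. g \<in> G \<Longrightarrow> T (U g v + jc g) = U g (T v) + jc g"
  shows "T = id"
proof -
  obtain L b where L: "bounded_linear L" "\<And>x. L (J x) = J (L x)" "\<And>x. T x = L x + b"
    using T unfolding cont_caffine_map_def by blast
  interpret L: bounded_linear L by (rule L(1))
  have c: "L (jc g) - jc g = U g b - b" if g: "g \<in> G" for g
  proof -
    interpret Ug: bounded_linear "U g" by (rule U_linear[OF g])
    show ?thesis using comm[OF g, of 0] by (simp add: L(3) L.add L.zero Ug.add Ug.zero algebra_simps)
  qed
  have "L h = h" for h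
  proof -
    have "inner (L h - h) z = 0" for z
    proof -
      have "bounded_linear (\<lambda>h. inner (L h - h) z)"
        by (intro bounded_linear_inner_left_comp bounded_linear_sub L(1) bounded_linear_ident)
      then obtain y where y: "\<And>h. inner (L h - h) z = inner y h" using riesz by blast
      have "y = 0"
      proof (rule tends_along_zero)
        show "tends_along (\<lambda>g. inner (jc g) y) (- inner b z)"
        proof (rule tends_along_coboundary)
          fix g assume "g \<in> G"
          then show "inner (jc g) y = inner (U g b - b) z" using y[of "jc g"] c by (simp add: inner_commute)
        qed
        show "tends_along (\<lambda>g. inner (jc g) (J y)) (- inner b (J z))"
        proof (rule tends_along_coboundary)
          fix g assume g: "g \<in> G"
          \<comment> \<open>Complex linearity of \<open>L\<close> moves \<open>J\<close> from the
            Riesz vector \<open>y\<close> over to \<open>z\<close>.\<close>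
          have "inner (jc g) (J y) = - inner y (J (jc g))" using J_skew[of "jc g" y] by (simp add: inner_commute)
          also have "\<dots> = - inner (J (L (jc g) - jc g)) z"
            unfolding y[symmetric] L(2) by (simp add: linear_diff[OF J(1)])
          also have "\<dots> = inner (U g b - b) (J z)" by (simp add: J_skew c[OF g])
          finally show "inner (jc g) (J y) = inner (U g b - b) (J z)" .
        qed
      qed
      then show ?thesis using y by simp
    qed
    from this[of "L h - h"] show ?thesis by simp
  qed
  \<comment> \<open>With \<open>L\<close> the identity, the relation \<open>c\<close> says that
    \<open>b\<close> is invariant.\<close>
  moreover from this have "b = 0" using c by (intro invariant_zero) simp
  ultimately show ?thesis using L(3) by (auto simp: fun_eq_iff)
qed

end

theorem theorem1p4:
  fixes x0 :: "'a::metric_space"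
    and G :: "('a \<Rightarrow> 'a) set"
    and \<delta> :: real
    and \<mu> :: "'a \<Rightarrow> (real \<Rightarrow> 'a) measure"
    and J :: "'h::{real_inner,complete_space} \<Rightarrow> 'h"
    and j :: "((real \<Rightarrow> 'a) \<Rightarrow> complex) \<Rightarrow> 'h"
    and U :: "('a \<Rightarrow> 'a) \<Rightarrow> 'h \<Rightarrow> 'h"
  assumes X: "proper_geodesic_CAT_m1 TYPE('a)"
    and G: "isom_group G" "discrete_group x0 G" "non_elementary x0 G" "convex_cocompact x0 G"
    and delta: "\<delta> = critical_exponent x0 G" "0 < \<delta>"
    and PS: "PS_density x0 G \<delta> \<mu>"
    and o_in: "x0 \<in> join_hull x0 (limit_set x0 G)"
    and Qpos: "\<forall>\<phi>\<in>F10 x0 \<mu>. 0 \<le> Re (Q1' x0 \<mu> \<phi> \<phi>)"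
    and H: "hilbert_completion J j (F10 x0 \<mu>) (Q1' x0 \<mu>) (\<lambda>\<phi> \<psi> \<xi>. \<phi> \<xi> + \<psi> \<xi>) (\<lambda>a \<phi> \<xi>. a * \<phi> \<xi>)"
    and U: "\<forall>g\<in>G. bounded_linear (U g) \<and> (\<forall>v. U g (J v) = J (U g v)) \<and>
              (\<forall>\<phi>\<in>F10 x0 \<mu>. U g (j \<phi>) = j (pi1 x0 \<delta> g \<phi>))"
  shows "(\<forall>w. closure (cspan J {j (cocyc x0 \<delta> g) + w - U g w | g. g \<in> G}) = UNIV)
       \<and> (\<forall>A. A \<noteq> {} \<and> closed A \<and> caffine J A \<and>
              (\<forall>g\<in>G. (\<lambda>v. U g v + j (cocyc x0 \<delta> g)) ` A \<subseteq> A) \<longrightarrow> A = UNIV)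
       \<and> (\<forall>v. (\<forall>g\<in>G. U g v = v) \<longrightarrow> v = 0)
       \<and> (\<forall>T. cont_caffine_map J T \<and>
              (\<forall>g\<in>G. \<forall>v. T (U g v + j (cocyc x0 \<delta> g)) = U g (T v) + j (cocyc x0 \<delta> g)) \<longrightarrow> T = id)"
proof -
  interpret ps_rep x0 G \<delta> \<mu> J j U
    by unfold_locales (fact X G PS o_in delta H U)+
  show ?thesis
  proof (intro conjI allI impI)
    fix w show "closure (cspan J {j (cocyc x0 \<delta> g) + w - U g w | g. g \<in> G}) = UNIV"
      by (rule closure_cspan_eq_UNIV)
  next
    fix A assume "A \<noteq> {} \<and> closed A \<and> caffine J A \<and>
      (\<forall>g\<in>G. (\<lambda>v. U g v + j (cocyc x0 \<delta> g)) ` A \<subseteq> A)"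
    then show "A = UNIV" by (elim conjE) (rule affine_irreducible, assumption+, erule bspec)
  next
    fix v assume "\<forall>g\<in>G. U g v = v"
    then show "v = 0" by (intro invariant_zero) (erule bspec)
  next
    fix T assume T: "cont_caffine_map J T \<and>
      (\<forall>g\<in>G. \<forall>v. T (U g v + j (cocyc x0 \<delta> g)) = U g (T v) + j (cocyc x0 \<delta> g))"
    show "T = id"
      by (rule affine_commutant_trivial[OF conjunct1[OF T]]) (rule conjunct2[OF T, rule_format])
  qed
qed

end
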